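(* Let $\{A_\circ,S_{\mathcal U},T',S_{\mathcal Y}\}$ be a commutant lifting data set, with $A_\circ:\ell^2_+(\mathcal U)\to\mathcal H'$, $\mathcal H'\subset\ell^2_+(\mathcal Y)$. Assume that $A_\circ$ is a strict contraction. Let $\Theta\in\mathcal S(\mathcal E,\mathcal Y)$ be an inner function with $\ell^2_+(\mathcal Y)\ominus\mathcal H'=\operatorname{Im}T_\Theta$, and put $$C=E_{\mathcal E}^*T_\Theta^*S_{\mathcal Y}\Pi_{\mathcal H'}^*:\mathcal H'\to\mathcal E,\qquad D=\Theta(0)^*:\mathcal Y\to\mathcal E.$$ Then all solutions $F$ to the commutant lifting problem for the data set $\{A_\circ,S_{\mathcal U},T',S_{\mathcal Y}\}$ are given by $$F(\lambda)=\bigl(\Upsilon_{11}(\lambda)X(\lambda)+\Upsilon_{12}(\lambda)\bigr)\bigl(\Upsilon_{21}(\lambda)X(\lambda)+\Upsilon_{22}(\lambda)\bigr)^{-1},\qquad\lambda\in\mathbb D,$$ where the free parameter $X$ is an arbitrary Schur class function $X\in\mathcal S(\mathcal U,\mathcal E)$, and the coefficients are the analytic functions on $\mathbb D$ defined by \begin{align*} \Upsilon_{11}(\lambda)&=D^*Q_\circ+\lambda E_{\mathcal Y}^*(I-\lambda S_{\mathcal Y}^* )^{-1}\Pi_{\mathcal H'}^*(I-A_\circ A_\circ^* )^{-1}C^*Q_\circ,\\ \Upsilon_{12}(\lambda)&=E_{\mathcal Y}^*(I-\lambda S_{\mathcal Y}^* )^{-1}\Pi_{\mathcal H'}^*A_\circ(I-A_\circ^*A_\circ)^{-1}E_{\mathcal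 U}R_\circ,\\ \Upsilon_{21}(\lambda)&=\lambda E_{\mathcal U}^*(I-\lambda S_{\mathcal U}^* )^{-1}A_\circ^*(I-A_\circ A_\circ^* )^{-1}C^*Q_\circ,\\ \Upsilon_{22}(\lambda)&=E_{\mathcal U}^*(I-\lambda S_{\mathcal U}^* )^{-1}(I-A_\circ^*A_\circ)^{-1}E_{\mathcal U}R_\circ . \end{align*} Here $$Q_\circ=\bigl(I_{\mathcal E}+CA_\circ(I-A_\circ^*A_\circ)^{-1}A_\circ^*C^*\bigr)^{-1/2},\qquad R_\circ=\bigl(E_{\mathcal U}^*(I-A_\circ^*A_\circ)^{-1}E_{\mathcal U}\bigr)^{-1/2},$$ and these operators are strictly positive.
   Context: All spaces are complex Hilbert spaces and "operator" means bounded linear operator. An operator is strictly positive if it is non-negative and invertible; a strict contraction is an operator of norm strictly less than one. $\mathbb D$ is the open unit disc. For a Hilbert space $\mathcal V$, $\ell^2_+(\mathcal V)$ is the space of square summable unilateral sequences in $\mathcal V$, $S_{\mathcal V}$ is the unilateral forward shift on it, and $E_{\mathcal V}:\mathcal V\to\ell^2_+(\mathcal V)$, $E_{\mathcal V}v=(v,0,0,\dots)$. The Schur class $\mathcal S(\mathcal U,\mathcal Y)$ is the set of analytic functions $F$ on $\mathbb D$ with values operators from $\mathcal U$ to $\mathcal Y$ and $\sup_{\lambda\in\mathbb D}\|F(\lambda)\|\le1$; $T_F:\ell^2_+(\mathcal U)\to\ell^2_+(\mathcal Y)$ is the corresponding block lower triangular Toeplitz operator. $\Theta\in\mathcal S(\mathcal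 E,\mathcal Y)$ is inner if $T_\Theta$ is an isometry. A commutant lifting data set $\{A_\circ,S_{\mathcal U},T',S_{\mathcal Y}\}$ (in the class considered) consists of: a closed subspace $\mathcal H'\subset\ell^2_+(\mathcal Y)$ invariant under $S_{\mathcal Y}^*$; the compression $T'=\Pi_{\mathcal H'}S_{\mathcal Y}\Pi_{\mathcal H'}^*$ of $S_{\mathcal Y}$ to $\mathcal H'$, where $\Pi_{\mathcal H'}:\ell^2_+(\mathcal Y)\to\mathcal H'$ is the orthogonal projection viewed as a map onto $\mathcal H'$ (so $\Pi_{\mathcal H'}^*$ is the embedding of $\mathcal H'$ into $\ell^2_+(\mathcal Y)$); and an operator $A_\circ:\ell^2_+(\mathcal U)\to\mathcal H'$ with $A_\circ S_{\mathcal U}=T'A_\circ$. A solution of the commutant lifting problem is a function $F\in\mathcal S(\mathcal U,\mathcal Y)$ with $\Pi_{\mathcal H'}T_F=A_\circ$. By the Beurling-Lax-Halmos theorem an inner function $\Theta\in\mathcal S(\mathcal E,\mathcal Y)$ (for some Hilbert space $\mathcal E$) with $\operatorname{Im}T_\Theta=\ell^2_+(\mathcal Y)\ominus\mathcal H'$ exists. *)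

theory Defs
  imports "HOL-Analysis.Analysis"
begin

section \<open>Complex Hilbert spaces\<close>

class complex_vector = real_vector +
  fixes scaleC :: "complex \<Rightarrow> 'a \<Rightarrow> 'a"  (infixr \<open>*\<^sub>C\<close> 75)
  assumes scaleC_add_right: "a *\<^sub>C (x + y) = a *\<^sub>C x + a *\<^sub>C y"
    and scaleC_add_left: "(a + b) *\<^sub>C x = a *\<^sub>C x + b *\<^sub>C x"
    and scaleC_scaleC: "a *\<^sub>C (b *\<^sub>C x) = (a * b) *\<^sub>C x"
    and scaleR_scaleC: "r *\<^sub>R x = complex_of_real r *\<^sub>C x"

class complex_normed_vector = complex_vector + real_normed_vector +
  assumes norm_scaleC: "norm (a *\<^sub>C x) = cmod a * norm x"

text \<open>
  The complex inner product is linear in its first argument.  Its real part is the library's real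
  inner product, from which positive definiteness and the norm
  \<^term>\<open>norm x = sqrt (inner x x)\<close> are inherited.
\<close>

class complex_inner = complex_vector + real_inner +
  fixes cinner :: "'a \<Rightarrow> 'a \<Rightarrow> complex"
  assumes cinner_commute: "cinner x y = cnj (cinner y x)"
    and cinner_add_left: "cinner (x + y) z = cinner x z + cinner y z"
    and cinner_scaleC_left: "cinner (a *\<^sub>C x) y = a * cinner x y"
    and Re_cinner: "Re (cinner x y) = inner x y"

lemma cinner_same: "cinner x x = complex_of_real ((norm x)\<^sup>2)" for x :: "'a::complex_inner"
proof (rule complex_eqI)
  show "Re (cinner x x) = Re (complex_of_real ((norm x)\<^sup>2))"
    by (simp add: Re_cinner power2_norm_eq_inner)
  have "Im (cinner x x) = - Im (cinner x x)"
    using arg_cong[OF cinner_commute[of x x], of Im] by simp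
  then show "Im (cinner x x) = Im (complex_of_real ((norm x)\<^sup>2))"
    by simp
qed

subclass (in complex_inner) complex_normed_vector
proof
  fix a x
  have i: "inner z z = Re (cinner z z)" for z
    by (simp add: Re_cinner)
  have *: "cinner (a *\<^sub>C x) (a *\<^sub>C x) = complex_of_real ((cmod a)\<^sup>2) * cinner x x"
    by (metis (no_types, lifting) cinner_commute cinner_scaleC_left complex_cnj_mult
        complex_norm_square mult.assoc mult.commute)
  have "inner (a *\<^sub>C x) (a *\<^sub>C x) = (cmod a)\<^sup>2 * inner x x"
    unfolding i * by simp
  then show "norm (a *\<^sub>C x) = cmod a * norm x"
    by (simp add: norm_eq_sqrt_inner real_sqrt_mult)
qed

class chilbert_space = complex_inner + complete_space

subclass (in chilbert_space) banach ..

instantiation complex :: chilbert_space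
begin

definition scaleC_complex :: "complex \<Rightarrow> complex \<Rightarrow> complex" where
  "scaleC_complex a x = a * x"

definition cinner_complex :: "complex \<Rightarrow> complex \<Rightarrow> complex" where
  "cinner_complex x y = x * cnj y"

instance
  by standard
    (auto simp: scaleC_complex_def cinner_complex_def algebra_simps scaleR_conv_of_real
      inner_complex_def)

end

lemma norm_cinner_le: "cmod (cinner x y) \<le> norm x * norm y" for x y :: "'a::complex_inner"
proof -
  define c where "c = (if cinner x y = 0 then 1 else cnj (cinner x y) / of_real (cmod (cinner x y)))"
  have c: "cmod c = 1"
    by (auto simp: c_def norm_divide)
  have "c * cinner x y = of_real (cmod (cinner x y))"
    by (auto simp: c_def field_simps complex_norm_square[symmetric] power2_eq_square)
  then have "cmod (cinner x y) = Re (cinner (c *\<^sub>C x) y)"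
    by (simp add: cinner_scaleC_left)
  also have "\<dots> = inner (c *\<^sub>C x) y"
    by (rule Re_cinner)
  also have "\<dots> \<le> norm (c *\<^sub>C x) * norm y"
    by (rule norm_cauchy_schwarz)
  finally show ?thesis
    by (simp add: norm_scaleC c)
qed

definition csubspace :: "'a::complex_vector set \<Rightarrow> bool" where
  "csubspace M \<longleftrightarrow> 0 \<in> M \<and> (\<forall>x\<in>M. \<forall>y\<in>M. x + y \<in> M) \<and> (\<forall>c. \<forall>x\<in>M. c *\<^sub>C x \<in> M)"

definition closed_csubspace :: "'a::complex_normed_vector set \<Rightarrow> bool" where
  "closed_csubspace M \<longleftrightarrow> csubspace M \<and> closed M"

definition orth_complement :: "'a::complex_inner set \<Rightarrow> 'a set" where
  "orth_complement M = {x. \<forall>y\<in>M. cinner x y = 0}"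


section \<open>Bounded complex-linear operators\<close>

typedef (overloaded) ('a, 'b) cblinfun  (\<open>(_ \<Rightarrow>\<^sub>C\<^sub>L /_)\<close> [22, 21] 21) =
  "{T :: 'a::complex_normed_vector \<Rightarrow>\<^sub>L 'b::complex_normed_vector.
     \<forall>c x. blinfun_apply T (c *\<^sub>C x) = c *\<^sub>C blinfun_apply T x}"
  morphisms blinfun_of_cblinfun Abs_cblinfun
proof
  have "c *\<^sub>C (0::'b) = 0" for c
    using scaleC_add_right[of c "0::'b" 0] by simp
  then show "0 \<in> {T :: 'a \<Rightarrow>\<^sub>L 'b. \<forall>c x. blinfun_apply T (c *\<^sub>C x) = c *\<^sub>C blinfun_apply T x}"
    by simp
qed

setup_lifting type_definition_cblinfun

lift_definition cblinfun_apply :: "'a::complex_normed_vector \<Rightarrow>\<^sub>C\<^sub>L 'b::complex_normed_vector \<Rightarrow> 'a \<Rightarrow> 'b"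
  (infixr \<open>*\<^sub>V\<close> 70) is blinfun_apply .

definition CBlinfun :: "('a::complex_normed_vector \<Rightarrow> 'b::complex_normed_vector) \<Rightarrow> 'a \<Rightarrow>\<^sub>C\<^sub>L 'b" where
  "CBlinfun f = Abs_cblinfun (Blinfun f)"

lemma CBlinfun_apply:
  assumes "bounded_linear f" "\<And>c x. f (c *\<^sub>C x) = c *\<^sub>C f x"
  shows "CBlinfun f *\<^sub>V x = f x"
  using assms
  by (simp add: CBlinfun_def cblinfun_apply.rep_eq Abs_cblinfun_inverse bounded_linear_Blinfun_apply)

lemma cblinfun_eqI: "(\<And>x. S *\<^sub>V x = T *\<^sub>V x) \<Longrightarrow> S = T"
  by transfer (rule blinfun_eqI)

lemma scaleC_zero_right: "c *\<^sub>C 0 = (0 :: 'a::complex_vector)"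
  using scaleC_add_right[of c "0::'a" 0] by simp

lemma scaleC_minus_right: "c *\<^sub>C (- x) = - (c *\<^sub>C x)" for x :: "'a::complex_vector"
  using scaleC_add_right[of c x "- x"] by (simp add: scaleC_zero_right eq_neg_iff_add_eq_0 add.commute)

lemma scaleC_diff_right: "c *\<^sub>C (x - y) = c *\<^sub>C x - c *\<^sub>C y" for x :: "'a::complex_vector"
  using scaleC_add_right[of c x "- y"] by (simp add: scaleC_minus_right)

lemma bounded_linear_scaleC: "bounded_linear (\<lambda>x::'a::complex_normed_vector. c *\<^sub>C x)"
  by (rule bounded_linear_intro[where K = "cmod c"])
    (simp_all add: scaleC_add_right scaleR_scaleC scaleC_scaleC norm_scaleC mult.commute)

instantiation cblinfun :: (complex_normed_vector, complex_normed_vector) complex_normed_vector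
begin

lift_definition norm_cblinfun :: "'a \<Rightarrow>\<^sub>C\<^sub>L 'b \<Rightarrow> real" is norm .

lift_definition minus_cblinfun :: "'a \<Rightarrow>\<^sub>C\<^sub>L 'b \<Rightarrow> 'a \<Rightarrow>\<^sub>C\<^sub>L 'b \<Rightarrow> 'a \<Rightarrow>\<^sub>C\<^sub>L 'b" is minus
  by (simp add: blinfun.diff_left scaleC_diff_right)

lift_definition uminus_cblinfun :: "'a \<Rightarrow>\<^sub>C\<^sub>L 'b \<Rightarrow> 'a \<Rightarrow>\<^sub>C\<^sub>L 'b" is uminus
  by (simp add: blinfun.minus_left scaleC_minus_right)

lift_definition zero_cblinfun :: "'a \<Rightarrow>\<^sub>C\<^sub>L 'b" is 0
  by (simp add: scaleC_zero_right)

lift_definition plus_cblinfun :: "'a \<Rightarrow>\<^sub>C\<^sub>L 'b \<Rightarrow> 'a \<Rightarrow>\<^sub>C\<^sub>L 'b \<Rightarrow> 'a \<Rightarrow>\<^sub>C\<^sub>L 'b" is plus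
  by (simp add: blinfun.add_left scaleC_add_right)

lift_definition scaleC_cblinfun :: "complex \<Rightarrow> 'a \<Rightarrow>\<^sub>C\<^sub>L 'b \<Rightarrow> 'a \<Rightarrow>\<^sub>C\<^sub>L 'b"
  is "\<lambda>c T. Blinfun (\<lambda>x. c *\<^sub>C blinfun_apply T x)"
  by (simp add: bounded_linear_Blinfun_apply scaleC_scaleC mult.commute
      bounded_linear_compose[OF bounded_linear_scaleC blinfun.bounded_linear_right])

lift_definition scaleR_cblinfun :: "real \<Rightarrow> 'a \<Rightarrow>\<^sub>C\<^sub>L 'b \<Rightarrow> 'a \<Rightarrow>\<^sub>C\<^sub>L 'b" is scaleR
  by (simp add: blinfun.scaleR_left scaleR_scaleC scaleC_scaleC mult.commute)

definition sgn_cblinfun :: "'a \<Rightarrow>\<^sub>C\<^sub>L 'b \<Rightarrow> 'a \<Rightarrow>\<^sub>C\<^sub>L 'b" where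
  "sgn_cblinfun x = inverse (norm x) *\<^sub>R x"

definition dist_cblinfun :: "'a \<Rightarrow>\<^sub>C\<^sub>L 'b \<Rightarrow> 'a \<Rightarrow>\<^sub>C\<^sub>L 'b \<Rightarrow> real" where
  "dist_cblinfun a b = norm (a - b)"

definition uniformity_cblinfun :: "(('a \<Rightarrow>\<^sub>C\<^sub>L 'b) \<times> ('a \<Rightarrow>\<^sub>C\<^sub>L 'b)) filter" where
  "uniformity_cblinfun = (INF e\<in>{0 <..}. principal {(x, y). dist x y < e})"

definition open_cblinfun :: "('a \<Rightarrow>\<^sub>C\<^sub>L 'b) set \<Rightarrow> bool" where
  "open_cblinfun S = (\<forall>x\<in>S. \<forall>\<^sub>F (x', y) in uniformity. x' = x \<longrightarrow> y \<in> S)"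

lemma scaleC_cblinfun_apply: "(c *\<^sub>C T) *\<^sub>V x = c *\<^sub>C (T *\<^sub>V x)" for T :: "'a \<Rightarrow>\<^sub>C\<^sub>L 'b"
  by transfer
    (simp add: bounded_linear_Blinfun_apply
      bounded_linear_compose[OF bounded_linear_scaleC blinfun.bounded_linear_right])

lemma plus_cblinfun_apply: "(S + T) *\<^sub>V x = S *\<^sub>V x + T *\<^sub>V x" for T :: "'a \<Rightarrow>\<^sub>C\<^sub>L 'b"
  by transfer (simp add: blinfun.add_left)

lemma scaleR_cblinfun_apply: "(r *\<^sub>R T) *\<^sub>V x = r *\<^sub>R (T *\<^sub>V x)" for T :: "'a \<Rightarrow>\<^sub>C\<^sub>L 'b"
  by transfer (simp add: blinfun.scaleR_left)

lemma norm_scaleC_cblinfun_le: "norm (c *\<^sub>C T) \<le> cmod c * norm T" for T :: "'a \<Rightarrow>\<^sub>C\<^sub>L 'b"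
proof -
  have "norm ((c *\<^sub>C T) *\<^sub>V x) \<le> cmod c * norm T * norm x" for x
  proof -
    have "norm (T *\<^sub>V x) \<le> norm T * norm x"
      by transfer (rule norm_blinfun)
    then show ?thesis
      by (simp add: scaleC_cblinfun_apply norm_scaleC mult.assoc mult_left_mono)
  qed
  moreover have "norm S \<le> b" if "0 \<le> b" "\<And>x. norm (S *\<^sub>V x) \<le> b * norm x" for S :: "'a \<Rightarrow>\<^sub>C\<^sub>L 'b" and b
    using that by transfer (rule norm_blinfun_bound)
  moreover have "0 \<le> norm T"
    by transfer simp
  ultimately show ?thesis
    by simp
qed

instance
proof
  fix x y z :: "'a \<Rightarrow>\<^sub>C\<^sub>L 'b" and a b :: real and c d :: complex
  show "x + y + z = x + (y + z)" "x + y = y + x" "0 + x = x" "- x + x = 0" "x - y = x + - y"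
    by (transfer; simp)+
  show "a *\<^sub>R (x + y) = a *\<^sub>R x + a *\<^sub>R y" "(a + b) *\<^sub>R x = a *\<^sub>R x + b *\<^sub>R x"
    "a *\<^sub>R b *\<^sub>R x = (a * b) *\<^sub>R x" "1 *\<^sub>R x = x"
    by (transfer; simp add: scaleR_add_right scaleR_add_left)+
  show "c *\<^sub>C (x + y) = c *\<^sub>C x + c *\<^sub>C y" "(c + d) *\<^sub>C x = c *\<^sub>C x + d *\<^sub>C x"
    "c *\<^sub>C (d *\<^sub>C x) = (c * d) *\<^sub>C x" "a *\<^sub>R x = complex_of_real a *\<^sub>C x"
    by (rule cblinfun_eqI;
      simp add: scaleC_cblinfun_apply plus_cblinfun_apply scaleR_cblinfun_apply scaleC_add_right
        scaleC_add_left scaleC_scaleC scaleR_scaleC)+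
  show "(norm x = 0) = (x = 0)" "norm (x + y) \<le> norm x + norm y" "norm (a *\<^sub>R x) = \<bar>a\<bar> * norm x"
    by (transfer; simp add: norm_triangle_ineq)+
  show "norm (c *\<^sub>C x) = cmod c * norm x"
  proof (cases "c = 0")
    case True
    have "0 *\<^sub>C x = 0"
      by (rule cblinfun_eqI, simp add: scaleC_cblinfun_apply)
        (transfer, metis of_real_0 scaleR_scaleC scaleR_zero_left blinfun.zero_left)
    then show ?thesis
      using True by simp (transfer, simp)
  next
    case False
    have "1 *\<^sub>C x = x"
      by (rule cblinfun_eqI, simp add: scaleC_cblinfun_apply)
        (metis of_real_1 scaleR_scaleC scaleR_one)
    then have "x = inverse c *\<^sub>C (c *\<^sub>C x)"
      using False
      by (intro cblinfun_eqI) (simp add: scaleC_cblinfun_apply scaleC_scaleC, metis scaleC_cblinfun_apply)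
    then have "norm x \<le> cmod (inverse c) * norm (c *\<^sub>C x)"
      by (metis norm_scaleC_cblinfun_le)
    then have "cmod c * norm x \<le> norm (c *\<^sub>C x)"
      using False by (simp add: norm_inverse norm_divide field_simps)
    then show ?thesis
      using norm_scaleC_cblinfun_le[of c x] by simp
  qed
  show "dist x y = norm (x - y)"
    by (rule dist_cblinfun_def)
  show "sgn x = inverse (norm x) *\<^sub>R x"
    by (rule sgn_cblinfun_def)
  show "(uniformity :: (('a \<Rightarrow>\<^sub>C\<^sub>L 'b) \<times> _) filter) = (INF e\<in>{0 <..}. principal {(x, y). dist x y < e})"
    by (rule uniformity_cblinfun_def)
  show "open U = (\<forall>x\<in>U. \<forall>\<^sub>F (x', y) in uniformity. x' = x \<longrightarrow> y \<in> U)" for U :: "('a \<Rightarrow>\<^sub>C\<^sub>L 'b) set"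
    by (rule open_cblinfun_def)
qed

end

lift_definition id_op :: "'a::complex_normed_vector \<Rightarrow>\<^sub>C\<^sub>L 'a" is id_blinfun
  by simp

lift_definition comp_op :: "'b::complex_normed_vector \<Rightarrow>\<^sub>C\<^sub>L 'c::complex_normed_vector \<Rightarrow>
    'a::complex_normed_vector \<Rightarrow>\<^sub>C\<^sub>L 'b \<Rightarrow> 'a \<Rightarrow>\<^sub>C\<^sub>L 'c"  (infixl \<open>o\<^sub>C\<^sub>L\<close> 67)
  is blinfun_compose
  by simp

text \<open>
  The operators below, as well as \<open>proj\<close>, \<open>taylor_coeffs\<close> and \<open>toeplitz\<close>, are described by properties
  that determine them uniquely.  The descriptions are meaningful whenever such an object exists: always
  for adjoints, for the square root when the operator is non-negative, for \<open>proj M\<close> when \<open>M\<close> is a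
  closed subspace, and for \<open>toeplitz F\<close> when \<open>F\<close> is in the Schur class.
\<close>

definition adj :: "'a::chilbert_space \<Rightarrow>\<^sub>C\<^sub>L 'b::chilbert_space \<Rightarrow> 'b \<Rightarrow>\<^sub>C\<^sub>L 'a"  (\<open>_*\<close> [99] 100) where
  "T* = (THE S. \<forall>x y. cinner (T *\<^sub>V x) y = cinner x (S *\<^sub>V y))"

definition is_inverse_op :: "'a::complex_normed_vector \<Rightarrow>\<^sub>C\<^sub>L 'b::complex_normed_vector \<Rightarrow> 'b \<Rightarrow>\<^sub>C\<^sub>L 'a \<Rightarrow> bool" where
  "is_inverse_op T R \<longleftrightarrow> R o\<^sub>C\<^sub>L T = id_op \<and> T o\<^sub>C\<^sub>L R = id_op"

definition invertible_op :: "'a::complex_normed_vector \<Rightarrow>\<^sub>C\<^sub>L 'b::complex_normed_vector \<Rightarrow> bool" where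
  "invertible_op T \<longleftrightarrow> (\<exists>R. is_inverse_op T R)"

definition inverse_op :: "'a::complex_normed_vector \<Rightarrow>\<^sub>C\<^sub>L 'b::complex_normed_vector \<Rightarrow> 'b \<Rightarrow>\<^sub>C\<^sub>L 'a" where
  "inverse_op T = (THE R. is_inverse_op T R)"

definition nonneg_op :: "'a::chilbert_space \<Rightarrow>\<^sub>C\<^sub>L 'a \<Rightarrow> bool" where
  "nonneg_op T \<longleftrightarrow> (\<forall>x. cinner (T *\<^sub>V x) x \<in> \<real>\<^sub>\<ge>\<^sub>0)"

definition strictly_positive_op :: "'a::chilbert_space \<Rightarrow>\<^sub>C\<^sub>L 'a \<Rightarrow> bool" where
  "strictly_positive_op T \<longleftrightarrow> nonneg_op T \<and> invertible_op T"

definition sqrt_op :: "'a::chilbert_space \<Rightarrow>\<^sub>C\<^sub>L 'a \<Rightarrow> 'a \<Rightarrow>\<^sub>C\<^sub>L 'a" where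
  "sqrt_op T = (THE S. nonneg_op S \<and> S o\<^sub>C\<^sub>L S = T)"

definition inv_sqrt_op :: "'a::chilbert_space \<Rightarrow>\<^sub>C\<^sub>L 'a \<Rightarrow> 'a \<Rightarrow>\<^sub>C\<^sub>L 'a" where
  "inv_sqrt_op T = inverse_op (sqrt_op T)"

definition isometry_op :: "'a::complex_normed_vector \<Rightarrow>\<^sub>C\<^sub>L 'b::complex_normed_vector \<Rightarrow> bool" where
  "isometry_op T \<longleftrightarrow> (\<forall>x. norm (T *\<^sub>V x) = norm x)"


subsection \<open>Operators on a closed subspace\<close>

text \<open>
  Let \<open>M\<close> be a closed subspace.  An operator into \<open>M\<close> is written as an operator into the ambient
  space with range in \<open>M\<close>, and an operator defined on \<open>M\<close> as the operator on the ambient space that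
  extends it by zero on the orthogonal complement of \<open>M\<close>.  This identification respects sums, products, adjoints and norms.
  Under it both the projection of the ambient space onto \<open>M\<close> and its adjoint, the embedding of \<open>M\<close>,
  become \<open>proj M\<close>, and so does the identity operator of \<open>M\<close>.  Accordingly
  \<open>inverse_op_on M T\<close> is the inverse of \<open>T\<close> as an operator on \<open>M\<close>.
\<close>

definition proj :: "'a::chilbert_space set \<Rightarrow> 'a \<Rightarrow>\<^sub>C\<^sub>L 'a" where
  "proj M = (THE P. \<forall>x. P *\<^sub>V x \<in> M \<and> x - P *\<^sub>V x \<in> orth_complement M)"

definition inverse_op_on :: "'a::chilbert_space set \<Rightarrow> 'a \<Rightarrow>\<^sub>C\<^sub>L 'a \<Rightarrow> 'a \<Rightarrow>\<^sub>C\<^sub>L 'a" where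
  "inverse_op_on M T = (THE R. proj M o\<^sub>C\<^sub>L R = R \<and> R o\<^sub>C\<^sub>L proj M = R \<and>
     R o\<^sub>C\<^sub>L T = proj M \<and> T o\<^sub>C\<^sub>L R = proj M)"


section \<open>Square summable sequences\<close>

typedef (overloaded) 'a ell2 = "{x :: nat \<Rightarrow> 'a::real_normed_vector. summable (\<lambda>n. (norm (x n))\<^sup>2)}"
  morphisms ell2_nth Abs_ell2
  by (rule exI[of _ "\<lambda>_. 0"]) simp

setup_lifting type_definition_ell2

lemma ell2_eqI: "(\<And>n. ell2_nth x n = ell2_nth y n) \<Longrightarrow> x = y"
  by transfer auto

lemma square_summable_add:
  fixes x y :: "nat \<Rightarrow> 'a::real_normed_vector"
  assumes "summable (\<lambda>n. (norm (x n))\<^sup>2)" "summable (\<lambda>n. (norm (y n))\<^sup>2)"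
  shows "summable (\<lambda>n. (norm (x n + y n))\<^sup>2)"
proof (rule summable_comparison_test')
  show "summable (\<lambda>n. 2 * (norm (x n))\<^sup>2 + 2 * (norm (y n))\<^sup>2)"
    by (intro summable_add summable_mult assms)
  fix n :: nat
  have "(norm (x n + y n))\<^sup>2 \<le> (norm (x n) + norm (y n))\<^sup>2"
    by (intro power_mono norm_triangle_ineq norm_ge_zero)
  also have "\<dots> \<le> 2 * (norm (x n))\<^sup>2 + 2 * (norm (y n))\<^sup>2"
    using zero_le_power2[of "norm (x n) - norm (y n)"] by (simp add: power2_eq_square algebra_simps)
  finally show "norm ((norm (x n + y n))\<^sup>2) \<le> 2 * (norm (x n))\<^sup>2 + 2 * (norm (y n))\<^sup>2"
    by simp
qed

lemma square_summable_prod: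
  fixes x y :: "nat \<Rightarrow> 'a::real_normed_vector"
  assumes "summable (\<lambda>n. (norm (x n))\<^sup>2)" "summable (\<lambda>n. (norm (y n))\<^sup>2)"
  shows "summable (\<lambda>n. norm (x n) * norm (y n))"
proof (rule summable_comparison_test')
  show "summable (\<lambda>n. (norm (x n))\<^sup>2 + (norm (y n))\<^sup>2)"
    by (intro summable_add assms)
  fix n :: nat
  have "0 \<le> (norm (x n) - norm (y n))\<^sup>2" "0 \<le> norm (x n) * norm (y n)"
    by simp_all
  then show "norm (norm (x n) * norm (y n)) \<le> (norm (x n))\<^sup>2 + (norm (y n))\<^sup>2"
    unfolding power2_diff real_norm_def by linarith
qed

instantiation ell2 :: (complex_inner) complex_inner
begin

lift_definition zero_ell2 :: "'a ell2" is "\<lambda>_. 0"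
  by simp

lift_definition plus_ell2 :: "'a ell2 \<Rightarrow> 'a ell2 \<Rightarrow> 'a ell2" is "\<lambda>x y n. x n + y n"
  by (rule square_summable_add)

lift_definition uminus_ell2 :: "'a ell2 \<Rightarrow> 'a ell2" is "\<lambda>x n. - x n"
  by simp

lift_definition minus_ell2 :: "'a ell2 \<Rightarrow> 'a ell2 \<Rightarrow> 'a ell2" is "\<lambda>x y n. x n - y n"
  subgoal for x y using square_summable_add[of x "\<lambda>n. - y n"] by simp
  done

lift_definition scaleR_ell2 :: "real \<Rightarrow> 'a ell2 \<Rightarrow> 'a ell2" is "\<lambda>r x n. r *\<^sub>R x n"
  by (simp add: power_mult_distrib summable_mult)

lift_definition scaleC_ell2 :: "complex \<Rightarrow> 'a ell2 \<Rightarrow> 'a ell2" is "\<lambda>c x n. c *\<^sub>C x n"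
  by (simp add: norm_scaleC power_mult_distrib summable_mult)

definition inner_ell2 :: "'a ell2 \<Rightarrow> 'a ell2 \<Rightarrow> real" where
  "inner_ell2 x y = (\<Sum>n. inner (ell2_nth x n) (ell2_nth y n))"

definition cinner_ell2 :: "'a ell2 \<Rightarrow> 'a ell2 \<Rightarrow> complex" where
  "cinner_ell2 x y = (\<Sum>n. cinner (ell2_nth x n) (ell2_nth y n))"

definition norm_ell2 :: "'a ell2 \<Rightarrow> real" where
  "norm_ell2 x = sqrt (\<Sum>n. (norm (ell2_nth x n))\<^sup>2)"

definition sgn_ell2 :: "'a ell2 \<Rightarrow> 'a ell2" where
  "sgn_ell2 x = inverse (norm x) *\<^sub>R x"

definition dist_ell2 :: "'a ell2 \<Rightarrow> 'a ell2 \<Rightarrow> real" where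
  "dist_ell2 a b = norm (a - b)"

definition uniformity_ell2 :: "('a ell2 \<times> 'a ell2) filter" where
  "uniformity_ell2 = (INF e\<in>{0 <..}. principal {(x, y). dist x y < e})"

definition open_ell2 :: "'a ell2 set \<Rightarrow> bool" where
  "open_ell2 S = (\<forall>x\<in>S. \<forall>\<^sub>F (x', y) in uniformity. x' = x \<longrightarrow> y \<in> S)"

lemma summable_ell2: "summable (\<lambda>n. (norm (ell2_nth x n))\<^sup>2)" for x :: "'a ell2"
  by transfer

lemma summable_inner_ell2: "summable (\<lambda>n. inner (ell2_nth x n) (ell2_nth y n))" for x y :: "'a ell2"
  by (rule summable_comparison_test'[OF square_summable_prod[OF summable_ell2[of x] summable_ell2[of y]]])
    (simp add: Cauchy_Schwarz_ineq2)

lemma summable_cinner_ell2: "summable (\<lambda>n. cinner (ell2_nth x n) (ell2_nth y n))" for x y :: "'a ell2"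
  by (rule summable_comparison_test'[OF square_summable_prod[OF summable_ell2[of x] summable_ell2[of y]]])
    (simp add: norm_cinner_le)

instance
proof
  fix x y z :: "'a ell2" and a b :: real and c d :: complex
  show "x + y + z = x + (y + z)" "x + y = y + x" "0 + x = x" "- x + x = 0" "x - y = x + - y"
    by (transfer; simp add: algebra_simps)+
  show "a *\<^sub>R (x + y) = a *\<^sub>R x + a *\<^sub>R y" "(a + b) *\<^sub>R x = a *\<^sub>R x + b *\<^sub>R x"
    "a *\<^sub>R b *\<^sub>R x = (a * b) *\<^sub>R x" "1 *\<^sub>R x = x"
    by (transfer; simp add: scaleR_add_right scaleR_add_left)+
  show "c *\<^sub>C (x + y) = c *\<^sub>C x + c *\<^sub>C y" "(c + d) *\<^sub>C x = c *\<^sub>C x + d *\<^sub>C x"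
    "c *\<^sub>C (d *\<^sub>C x) = (c * d) *\<^sub>C x" "a *\<^sub>R x = complex_of_real a *\<^sub>C x"
    by (transfer; simp add: scaleC_add_right scaleC_add_left scaleC_scaleC scaleR_scaleC)+
  show "dist x y = norm (x - y)"
    by (rule dist_ell2_def)
  show "sgn x = inverse (norm x) *\<^sub>R x"
    by (rule sgn_ell2_def)
  show "(uniformity :: ('a ell2 \<times> _) filter) = (INF e\<in>{0 <..}. principal {(x, y). dist x y < e})"
    by (rule uniformity_ell2_def)
  show "open U = (\<forall>x\<in>U. \<forall>\<^sub>F (x', y) in uniformity. x' = x \<longrightarrow> y \<in> U)" for U :: "'a ell2 set"
    by (rule open_ell2_def)
  show "inner x y = inner y x"
    by (simp add: inner_ell2_def inner_commute)
  show "inner (x + y) z = inner x z + inner y z"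
    by (simp add: inner_ell2_def plus_ell2.rep_eq inner_add_left suminf_add summable_inner_ell2)
  show "inner (a *\<^sub>R x) y = a * inner x y"
    by (simp add: inner_ell2_def scaleR_ell2.rep_eq suminf_mult summable_inner_ell2)
  show "0 \<le> inner x x"
    by (simp add: inner_ell2_def suminf_nonneg summable_inner_ell2)
  show "inner x x = 0 \<longleftrightarrow> x = 0"
    by (auto simp: inner_ell2_def suminf_eq_zero_iff summable_inner_ell2 zero_ell2.rep_eq intro!: ell2_eqI)
  show "norm x = sqrt (inner x x)"
    by (simp add: norm_ell2_def inner_ell2_def power2_norm_eq_inner)
  show "cinner (x + y) z = cinner x z + cinner y z"
    by (simp add: cinner_ell2_def plus_ell2.rep_eq cinner_add_left suminf_add summable_cinner_ell2)
  show "cinner (c *\<^sub>C x) y = c * cinner x y"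
    by (simp add: cinner_ell2_def scaleC_ell2.rep_eq cinner_scaleC_left suminf_mult summable_cinner_ell2)
  have "(\<lambda>n. cnj (cinner (ell2_nth y n) (ell2_nth x n))) sums cnj (cinner y x)"
    unfolding cinner_ell2_def sums_cnj by (rule summable_sums[OF summable_cinner_ell2])
  then show "cinner x y = cnj (cinner y x)"
    unfolding cinner_commute[of "ell2_nth y _", symmetric] cinner_ell2_def
    by (metis (no_types, lifting) cinner_commute sums_unique sums_cong)
  have "(\<lambda>n. Re (cinner (ell2_nth x n) (ell2_nth y n))) sums Re (cinner x y)"
    unfolding cinner_ell2_def by (rule sums_Re[OF summable_sums[OF summable_cinner_ell2]])
  then show "Re (cinner x y) = inner x y"
    unfolding inner_ell2_def Re_cinner by (simp add: sums_unique)
qed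

end

lemma norm_ell2_nth_le: "norm (ell2_nth x n) \<le> norm x" for x :: "'a::complex_inner ell2"
proof -
  have "(norm (ell2_nth x n))\<^sup>2 = (\<Sum>k\<in>{n}. (norm (ell2_nth x k))\<^sup>2)"
    by simp
  also have "\<dots> \<le> (\<Sum>k. (norm (ell2_nth x k))\<^sup>2)"
    by (rule sum_le_suminf[OF summable_ell2]) auto
  finally show ?thesis
    unfolding norm_ell2_def by (rule real_le_rsqrt)
qed

instance ell2 :: (chilbert_space) chilbert_space
proof
  fix X :: "nat \<Rightarrow> 'a ell2"
  assume X: "Cauchy X"
  have nth_diff: "ell2_nth (x - y) n = ell2_nth x n - ell2_nth y n" for x y :: "'a ell2" and n
    by (simp add: minus_ell2.rep_eq)
  have "Cauchy (\<lambda>i. ell2_nth (X i) n)" for n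
  proof (rule CauchyI)
    fix e :: real
    assume "0 < e"
    with X obtain M where M: "\<forall>i\<ge>M. \<forall>j\<ge>M. norm (X i - X j) < e"
      by (auto dest: CauchyD)
    have "norm (ell2_nth (X i) n - ell2_nth (X j) n) \<le> norm (X i - X j)" for i j
      using norm_ell2_nth_le[of "X i - X j" n] by (simp add: nth_diff)
    with M show "\<exists>M. \<forall>i\<ge>M. \<forall>j\<ge>M. norm (ell2_nth (X i) n - ell2_nth (X j) n) < e"
      by (meson le_less_trans)
  qed
  then have "\<exists>l. (\<lambda>i. ell2_nth (X i) n) \<longlonglongrightarrow> l" for n
    using Cauchy_convergent convergent_def by blast
  then obtain L where L: "\<And>n. (\<lambda>i. ell2_nth (X i) n) \<longlonglongrightarrow> L n"
    by metis
  have bnd: "(\<Sum>n<m. (norm (ell2_nth (X i) n - L n))\<^sup>2) \<le> e\<^sup>2"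
    if N: "\<forall>i\<ge>N. \<forall>j\<ge>N. norm (X i - X j) < e" and i: "i \<ge> N" for N i m and e :: real
  proof (rule tendsto_upperbound)
    show "(\<lambda>j. \<Sum>n<m. (norm (ell2_nth (X i) n - ell2_nth (X j) n))\<^sup>2)
        \<longlonglongrightarrow> (\<Sum>n<m. (norm (ell2_nth (X i) n - L n))\<^sup>2)"
      by (intro tendsto_intros L)
    show "\<forall>\<^sub>F j in sequentially. (\<Sum>n<m. (norm (ell2_nth (X i) n - ell2_nth (X j) n))\<^sup>2) \<le> e\<^sup>2"
    proof (rule eventually_sequentiallyI[of N])
      fix j
      assume j: "N \<le> j"
      have "(\<Sum>n<m. (norm (ell2_nth (X i - X j) n))\<^sup>2) \<le> (\<Sum>n. (norm (ell2_nth (X i - X j) n))\<^sup>2)"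
        by (rule sum_le_suminf[OF summable_ell2]) auto
      also have "\<dots> = (norm (X i - X j))\<^sup>2"
        by (simp add: norm_ell2_def suminf_nonneg summable_ell2)
      also have "\<dots> \<le> e\<^sup>2"
        using N i j by (intro power_mono) (auto intro: less_imp_le)
      finally show "(\<Sum>n<m. (norm (ell2_nth (X i) n - ell2_nth (X j) n))\<^sup>2) \<le> e\<^sup>2"
        by (simp add: nth_diff)
    qed
  qed simp
  have diff_summable: "summable (\<lambda>n. (norm (ell2_nth (X i) n - L n))\<^sup>2)"
    if N: "\<forall>i\<ge>N. \<forall>j\<ge>N. norm (X i - X j) < e" and i: "i \<ge> N" for N i and e :: real
    by (rule bounded_imp_summable[where B = "e\<^sup>2"])
      (simp, subst lessThan_Suc_atMost[symmetric], rule bnd[OF N i])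
  obtain N1 where N1: "\<forall>i\<ge>N1. \<forall>j\<ge>N1. norm (X i - X j) < 1"
    using CauchyD[OF X, of 1] by auto
  have "summable (\<lambda>n. (norm (ell2_nth (X N1) n + - (ell2_nth (X N1) n - L n)))\<^sup>2)"
    by (rule square_summable_add[OF summable_ell2])
      (simp only: norm_minus_cancel, rule diff_summable[OF N1], simp)
  then have LS: "summable (\<lambda>n. (norm (L n))\<^sup>2)"
    by simp
  define l where "l = Abs_ell2 L"
  have l: "ell2_nth l = L"
    unfolding l_def using LS by (simp add: Abs_ell2_inverse)
  have "X \<longlonglongrightarrow> l"
  proof (rule LIMSEQ_I)
    fix r :: real
    assume r: "0 < r"
    obtain N where N: "\<forall>i\<ge>N. \<forall>j\<ge>N. norm (X i - X j) < r / 2"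
      using CauchyD[OF X, of "r / 2"] r by auto
    have "norm (X i - l) < r" if i: "i \<ge> N" for i
    proof -
      have "(\<Sum>n. (norm (ell2_nth (X i) n - L n))\<^sup>2) \<le> (r / 2)\<^sup>2"
        by (rule suminf_le_const[OF diff_summable[OF N i] bnd[OF N i]])
      then have "norm (X i - l) \<le> r / 2"
        unfolding norm_ell2_def nth_diff l using r by (intro real_le_lsqrt) auto
      then show ?thesis
        using r by simp
    qed
    then show "\<exists>N. \<forall>i\<ge>N. norm (X i - l) < r"
      by blast
  qed
  then show "convergent X"
    by (auto simp: convergent_def)
qed


section \<open>Shift, Schur class and Toeplitz operators\<close>

definition shift :: "'a::chilbert_space ell2 \<Rightarrow>\<^sub>C\<^sub>L 'a ell2" where
  "shift = CBlinfun (\<lambda>x. Abs_ell2 (\<lambda>n. case n of 0 \<Rightarrow> 0 | Suc m \<Rightarrow> ell2_nth x m))"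

lemma shift_nth:
  "ell2_nth (shift *\<^sub>V x) n = (case n of 0 \<Rightarrow> 0 | Suc m \<Rightarrow> ell2_nth x m)" for x :: "'a::chilbert_space ell2"
proof -
  define S where "S = (\<lambda>x :: 'a ell2. Abs_ell2 (\<lambda>n. case n of 0 \<Rightarrow> 0 | Suc m \<Rightarrow> ell2_nth x m))"
  have sums: "(\<lambda>n. (norm (case n of 0 \<Rightarrow> 0 | Suc m \<Rightarrow> ell2_nth x m))\<^sup>2) sums (\<Sum>n. (norm (ell2_nth x n))\<^sup>2)"
    for x :: "'a ell2"
    using sums_Suc[where f = "\<lambda>n. (norm (case n of 0 \<Rightarrow> 0 | Suc m \<Rightarrow> ell2_nth x m))\<^sup>2",
        simplified nat.case, OF summable_sums[OF summable_ell2[of x]]]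
    by simp
  have nth: "ell2_nth (S x) = (\<lambda>n. case n of 0 \<Rightarrow> 0 | Suc m \<Rightarrow> ell2_nth x m)" for x
    unfolding S_def using sums_summable[OF sums[of x]] by (simp add: Abs_ell2_inverse)
  have "bounded_linear S"
  proof (rule bounded_linear_intro[where K = 1])
    show "S (x + y) = S x + S y" "S (r *\<^sub>R x) = r *\<^sub>R S x" for x y r
      by (rule ell2_eqI; simp add: nth plus_ell2.rep_eq scaleR_ell2.rep_eq split: nat.split)+
    show "norm (S x) \<le> norm x * 1" for x
      using sums_unique[OF sums[of x]] by (simp add: norm_ell2_def nth)
  qed
  moreover have "S (c *\<^sub>C x) = c *\<^sub>C S x" for c x
    by (rule ell2_eqI) (simp add: nth scaleC_ell2.rep_eq scaleC_zero_right split: nat.split)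
  ultimately show ?thesis
    unfolding shift_def S_def[symmetric] by (simp add: CBlinfun_apply nth)
qed

definition embed0 :: "'a::chilbert_space \<Rightarrow>\<^sub>C\<^sub>L 'a ell2" where
  "embed0 = CBlinfun (\<lambda>v. Abs_ell2 (\<lambda>n. if n = 0 then v else 0))"

lemma embed0_nth: "ell2_nth (embed0 *\<^sub>V v) n = (if n = 0 then v else 0)" for v :: "'a::chilbert_space"
proof -
  define E where "E = (\<lambda>v :: 'a. Abs_ell2 (\<lambda>n. if n = 0 then v else 0))"
  have sums: "(\<lambda>n. (norm (if n = 0 then v else 0))\<^sup>2) sums (norm v)\<^sup>2" for v :: 'a
    using sums_finite[of "{0}" "\<lambda>n. (norm (if n = 0 then v else 0))\<^sup>2"] by simp
  have nth: "ell2_nth (E v) = (\<lambda>n. if n = 0 then v else 0)" for v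
    unfolding E_def using sums_summable[OF sums[of v]] by (simp add: Abs_ell2_inverse)
  have "bounded_linear E"
  proof (rule bounded_linear_intro[where K = 1])
    show "E (x + y) = E x + E y" "E (r *\<^sub>R x) = r *\<^sub>R E x" for x y r
      by (rule ell2_eqI; simp add: nth plus_ell2.rep_eq scaleR_ell2.rep_eq)+
    show "norm (E x) \<le> norm x * 1" for x
      using sums_unique[OF sums[of x], symmetric] by (simp add: norm_ell2_def nth del: if_distrib)
  qed
  moreover have "E (c *\<^sub>C x) = c *\<^sub>C E x" for c x
    by (rule ell2_eqI) (simp add: nth scaleC_ell2.rep_eq scaleC_zero_right)
  ultimately show ?thesis
    unfolding embed0_def E_def[symmetric] by (simp add: CBlinfun_apply nth)
qed

definition analytic_on_disc ::
    "(complex \<Rightarrow> 'a::complex_normed_vector \<Rightarrow>\<^sub>C\<^sub>L 'b::complex_normed_vector) \<Rightarrow> bool" where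
  "analytic_on_disc F \<longleftrightarrow>
     (\<forall>z\<in>ball 0 1. \<exists>F'. ((\<lambda>w. inverse (w - z) *\<^sub>C (F w - F z)) \<longlongrightarrow> F') (at z))"

text \<open>
  Functions on the disc are total functions on the complex plane whose values off the disc are
  irrelevant.
\<close>

definition schur_class ::
    "(complex \<Rightarrow> 'a::complex_normed_vector \<Rightarrow>\<^sub>C\<^sub>L 'b::complex_normed_vector) \<Rightarrow> bool" where
  "schur_class F \<longleftrightarrow> analytic_on_disc F \<and> (\<forall>z\<in>ball 0 1. norm (F z) \<le> 1)"

definition taylor_coeffs ::
    "(complex \<Rightarrow> 'a::complex_normed_vector \<Rightarrow>\<^sub>C\<^sub>L 'b::complex_normed_vector) \<Rightarrow> nat \<Rightarrow> 'a \<Rightarrow>\<^sub>C\<^sub>L 'b" where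
  "taylor_coeffs F = (THE a. \<forall>z\<in>ball 0 1. (\<lambda>n. z ^ n *\<^sub>C a n) sums F z)"

definition toeplitz ::
    "(complex \<Rightarrow> 'a::chilbert_space \<Rightarrow>\<^sub>C\<^sub>L 'b::chilbert_space) \<Rightarrow> 'a ell2 \<Rightarrow>\<^sub>C\<^sub>L 'b ell2" where
  "toeplitz F = (THE T. \<forall>x n. ell2_nth (T *\<^sub>V x) n = (\<Sum>k\<le>n. taylor_coeffs F (n - k) *\<^sub>V ell2_nth x k))"

definition inner_function :: "(complex \<Rightarrow> 'a::chilbert_space \<Rightarrow>\<^sub>C\<^sub>L 'b::chilbert_space) \<Rightarrow> bool" where
  "inner_function F \<longleftrightarrow> schur_class F \<and> isometry_op (toeplitz F)"


section \<open>The commutant lifting problem\<close>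

text \<open>
  The compression \<open>T' = \<Pi> S \<Pi>*\<close> of the shift to \<open>H\<close> and the map \<open>A : \<ell>\<^sup>2(U) \<rightarrow> H\<close> are written
  as operators on the ambient spaces, as explained above for operators on a closed subspace.
\<close>

definition compressed_shift :: "'y::chilbert_space ell2 set \<Rightarrow> 'y ell2 \<Rightarrow>\<^sub>C\<^sub>L 'y ell2" where
  "compressed_shift H = proj H o\<^sub>C\<^sub>L shift o\<^sub>C\<^sub>L proj H"

definition commutant_lifting_data ::
    "'y::chilbert_space ell2 set \<Rightarrow> ('u::chilbert_space ell2 \<Rightarrow>\<^sub>C\<^sub>L 'y ell2) \<Rightarrow> bool" where
  "commutant_lifting_data H A \<longleftrightarrow>
     closed_csubspace H \<and> (\<forall>h\<in>H. shift* *\<^sub>V h \<in> H) \<and>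
     range (cblinfun_apply A) \<subseteq> H \<and>
     A o\<^sub>C\<^sub>L shift = compressed_shift H o\<^sub>C\<^sub>L A"

definition commutant_lifting_solution ::
    "'y::chilbert_space ell2 set \<Rightarrow> ('u::chilbert_space ell2 \<Rightarrow>\<^sub>C\<^sub>L 'y ell2) \<Rightarrow>
     (complex \<Rightarrow> 'u \<Rightarrow>\<^sub>C\<^sub>L 'y) \<Rightarrow> bool" where
  "commutant_lifting_solution H A F \<longleftrightarrow> schur_class F \<and> proj H o\<^sub>C\<^sub>L toeplitz F = A"

end

theory Submission
  imports Defs "HOL-Complex_Analysis.Cauchy_Integral_Formula"
begin

text \<open>
  Let \<open>J = diag(I, -I)\<close> on \<open>\<ell>\<^sup>2(Y) \<oplus> \<ell>\<^sup>2(U)\<close>.  The subspace \<open>M = {(y, u). P y = A u}\<close>, where \<open>P\<close> is the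
  projection onto \<open>H\<close>, is shift invariant, and a Schur function \<open>F\<close> solves the lifting problem iff \<open>M\<close>
  contains the graph of \<open>T\<^sub>F\<close>.  Strict contractivity of \<open>A\<close> makes \<open>M\<close> regular, with a bounded
  \<open>J\<close>-orthogonal projection \<open>\<Pi>\<close>, and the columns of \<open>\<Upsilon>\<close> are a \<open>J\<close>-orthonormal basis of the wandering
  subspace of \<open>M\<close>; that is, \<open>\<Pi>J - S \<Pi>J S* = \<Upsilon> J \<Upsilon>*\<close>, the last \<open>J\<close> acting on \<open>E \<oplus> U\<close>.  Compressing this
  identity with \<open>(I, -T\<^sub>F)\<close> gives an operator \<open>N\<close>, a Schur complement of \<open>I - T\<^sub>F T\<^sub>F*\<close>, with
  \<open>N - S N S* = a a* - b b*\<close> for \<open>a = \<Upsilon>\<^sub>1\<^sub>1 - F \<Upsilon>\<^sub>2\<^sub>1\<close> and \<open>b = F \<Upsilon>\<^sub>2\<^sub>2 - \<Upsilon>\<^sub>1\<^sub>2\<close>.  Now \<open>F\<close> is a solution iff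
  \<open>N \<ge> 0\<close>, and by Leech's theorem \<open>N \<ge> 0\<close> iff \<open>a X = b\<close> for some Schur function \<open>X\<close>, which is the linear
  fractional formula.
\<close>

section \<open>Operators between complex Hilbert spaces\<close>

text \<open>The sign of \<open>N\<close> decides because
  \<open>N = T_\<Theta> T_\<Theta>* - (T_F - A) \<Delta> (T_F - A)*\<close> with
  \<open>\<Delta>\<close> the inverse of \<open>I - A* A\<close>. For a solution,
  \<open>T_F - A = T_\<Theta> K\<close>, and contractivity of \<open>T_F\<close> reads
  \<open>K* K \<le> I - A* A\<close>, that is \<open>K \<Delta> K* \<le> I\<close>. Conversely, on
  \<open>H\<close> the first term vanishes, and \<open>\<Delta> \<ge> I\<close> then forces
  \<open>P T_F = A\<close>. That the formula produces Schur functions is a separate, pointwise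
  matter: \<open>J\<close> is non-negative on the \<open>J\<close>-orthogonal complement of
  \<open>M\<close>, and evaluating at kernel functions turns this into
  \<open>\<Upsilon>(z) J \<Upsilon>(z)* \<le> J\<close>. The coefficient spaces are arbitrary
  Hilbert spaces, and this shapes two arguments. A lower bound for the adjoint of
  \<open>\<Upsilon>22(z)\<close> does not make it invertible, so invertibility is carried over from
  the origin. Contractivity of \<open>T_F\<close> is obtained without boundary values, from finite
  averages on circles inside the disc.\<close>

lemma scaleC_one [simp]: "1 *\<^sub>C x = x" for x :: "'a::complex_vector"
  by (metis of_real_1 scaleR_one scaleR_scaleC)

lemma scaleC_zero_left [simp]: "0 *\<^sub>C x = 0" for x :: "'a::complex_vector"
  by (metis of_real_0 scaleR_scaleC scaleR_zero_left)

declare scaleC_zero_right [simp] scaleC_scaleC [simp]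

lemma scaleC_minus_left: "(- c) *\<^sub>C x = - (c *\<^sub>C x)" for x :: "'a::complex_vector"
  using scaleC_add_left[of c "- c" x] by (simp add: eq_neg_iff_add_eq_0 add.commute)

lemma scaleC_diff_left: "(c - d) *\<^sub>C x = c *\<^sub>C x - d *\<^sub>C x" for x :: "'a::complex_vector"
  using scaleC_add_left[of c "- d" x] by (simp add: scaleC_minus_left)

lemma scaleC_sum_right: "c *\<^sub>C (\<Sum>i\<in>I. f i) = (\<Sum>i\<in>I. c *\<^sub>C f i)" for f :: "'i \<Rightarrow> 'a::complex_vector"
  by (induction I rule: infinite_finite_induct) (simp_all add: scaleC_add_right)

lemma scaleC_scaleR: "c *\<^sub>C (r *\<^sub>R x) = r *\<^sub>R (c *\<^sub>C x)" for x :: "'a::complex_vector"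
  by (simp add: scaleR_scaleC mult.commute)

lemma bounded_bilinear_scaleC:
  "bounded_bilinear (\<lambda>(c::complex) (x::'a::complex_normed_vector). c *\<^sub>C x)"
proof (rule bounded_bilinear.intro)
  show "(r *\<^sub>R a) *\<^sub>C b = r *\<^sub>R (a *\<^sub>C b)" "a *\<^sub>C (r *\<^sub>R b) = r *\<^sub>R (a *\<^sub>C b)" for r a and b :: 'a
    by (simp_all add: scaleR_scaleC[where 'a = 'a] scaleR_conv_of_real mult.commute)
  show "\<exists>K. \<forall>a b. norm (a *\<^sub>C (b::'a)) \<le> norm a * norm b * K"
    by (intro exI[of _ 1]) (simp add: norm_scaleC)
qed (rule scaleC_add_left scaleC_add_right)+

lemmas tendsto_scaleC = bounded_bilinear.tendsto[OF bounded_bilinear_scaleC]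

lemma id_op_apply [simp]: "id_op *\<^sub>V x = x"
  by transfer simp

lemma comp_op_apply [simp]: "(S o\<^sub>C\<^sub>L T) *\<^sub>V x = S *\<^sub>V T *\<^sub>V x"
  by transfer simp

lemma zero_cblinfun_apply [simp]: "0 *\<^sub>V x = 0"
  by transfer simp

lemma minus_cblinfun_apply [simp]: "(S - T) *\<^sub>V x = S *\<^sub>V x - T *\<^sub>V x"
  by transfer (simp add: blinfun.diff_left)

lemma uminus_cblinfun_apply [simp]: "(- T) *\<^sub>V x = - (T *\<^sub>V x)"
  by transfer (simp add: blinfun.minus_left)

declare scaleC_cblinfun_apply [simp] plus_cblinfun_apply [simp] scaleR_cblinfun_apply [simp]

lemma cblinfun_apply_scaleC [simp]: "T *\<^sub>V (c *\<^sub>C x) = c *\<^sub>C (T *\<^sub>V x)"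
  by transfer simp

lemma cblinfun_apply_scaleR: "T *\<^sub>V (r *\<^sub>R x) = r *\<^sub>R (T *\<^sub>V x)"
  by (simp add: scaleR_scaleC)

lemma bounded_linear_cblinfun_apply: "bounded_linear (cblinfun_apply T)"
  by transfer (rule blinfun.bounded_linear_right)

lemma cblinfun_apply_zero [simp]: "T *\<^sub>V 0 = 0"
  and cblinfun_apply_add: "T *\<^sub>V (x + y) = T *\<^sub>V x + T *\<^sub>V y"
  and cblinfun_apply_diff: "T *\<^sub>V (x - y) = T *\<^sub>V x - T *\<^sub>V y"
  and cblinfun_apply_minus: "T *\<^sub>V (- x) = - (T *\<^sub>V x)"
  and cblinfun_apply_sum: "T *\<^sub>V (\<Sum>i\<in>I. f i) = (\<Sum>i\<in>I. T *\<^sub>V f i)"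
  using bounded_linear.linear[OF bounded_linear_cblinfun_apply[of T]]
  by (simp_all add: linear_0 linear_add linear_diff linear_neg linear_sum)

lemmas cblinfun_apply_linear =
  cblinfun_apply_add cblinfun_apply_diff cblinfun_apply_minus cblinfun_apply_sum

lemma tendsto_cblinfun_apply_right:
  "(f \<longlongrightarrow> l) F \<Longrightarrow> ((\<lambda>x. T *\<^sub>V f x) \<longlongrightarrow> T *\<^sub>V l) F"
  by (rule bounded_linear.tendsto[OF bounded_linear_cblinfun_apply])

lemma norm_cblinfun: "norm (T *\<^sub>V x) \<le> norm T * norm x"
  by transfer (rule norm_blinfun)

lemma norm_cblinfun_le: "norm T \<le> b \<Longrightarrow> norm (T *\<^sub>V x) \<le> b * norm x"
  using norm_cblinfun[of T x] mult_right_mono[of "norm T" b "norm x"] by simp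

lemma norm_cblinfun_bound: "0 \<le> b \<Longrightarrow> (\<And>x. norm (T *\<^sub>V x) \<le> b * norm x) \<Longrightarrow> norm T \<le> b"
  by transfer (rule norm_blinfun_bound)

lemma norm_comp_op_le: "norm (S o\<^sub>C\<^sub>L T) \<le> norm S * norm T"
  by transfer (rule norm_blinfun_compose)

lemma norm_id_op_le: "norm (id_op :: 'a::complex_normed_vector \<Rightarrow>\<^sub>C\<^sub>L 'a) \<le> 1"
  by (rule norm_cblinfun_bound) simp_all

lemma bounded_linear_apply_arg: "bounded_linear (\<lambda>T. T *\<^sub>V x)"
  by (rule bounded_linear_intro[where K = "norm x"])
    (use norm_cblinfun in \<open>auto simp: mult.commute\<close>)

lemma tendsto_cblinfun_apply_left:
  "(f \<longlongrightarrow> T) F \<Longrightarrow> ((\<lambda>i. f i *\<^sub>V x) \<longlongrightarrow> T *\<^sub>V x) F"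
  by (rule bounded_linear.tendsto[OF bounded_linear_apply_arg])

lemma bounded_bilinear_comp_op: "bounded_bilinear (o\<^sub>C\<^sub>L)"
proof (rule bounded_bilinear.intro)
  show "\<exists>K. \<forall>a b. norm (a o\<^sub>C\<^sub>L b) \<le> norm a * norm b * K"
    by (intro exI[of _ 1] allI) (simp add: norm_comp_op_le)
qed (auto intro!: cblinfun_eqI simp: cblinfun_apply_linear scaleR_scaleC)

lemmas tendsto_comp_op = bounded_bilinear.tendsto[OF bounded_bilinear_comp_op]

lemma comp_op_assoc: "(S o\<^sub>C\<^sub>L T) o\<^sub>C\<^sub>L U = S o\<^sub>C\<^sub>L (T o\<^sub>C\<^sub>L U)"
  by (rule cblinfun_eqI) simp

lemma comp_op_id [simp]: "id_op o\<^sub>C\<^sub>L T = T" "T o\<^sub>C\<^sub>L id_op = T"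
  by (rule cblinfun_eqI; simp)+

text \<open>Completeness in operator norm makes the Neumann series, the square root iterates and the
  Taylor series of Schur functions converge as operators.\<close>

instance cblinfun :: (complex_normed_vector, "{complex_normed_vector, complete_space}") complete_space
proof
  fix X :: "nat \<Rightarrow> 'a \<Rightarrow>\<^sub>C\<^sub>L 'b"
  assume X: "Cauchy X"
  have "Cauchy (\<lambda>i. X i *\<^sub>V x)" for x
    by (rule bounded_linear.Cauchy[OF bounded_linear_apply_arg X])
  then have "\<exists>l. (\<lambda>i. X i *\<^sub>V x) \<longlonglongrightarrow> l" for x
    using Cauchy_convergent convergent_def by blast
  then obtain L where L: "\<And>x. (\<lambda>i. X i *\<^sub>V x) \<longlonglongrightarrow> L x"
    by metis
  have bnd: "norm (X i *\<^sub>V x - L x) \<le> e * norm x"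
    if "\<And>j. j \<ge> N \<Longrightarrow> norm (X i - X j) \<le> e" for i N e x
  proof (rule tendsto_upperbound)
    show "(\<lambda>j. norm (X i *\<^sub>V x - X j *\<^sub>V x)) \<longlonglongrightarrow> norm (X i *\<^sub>V x - L x)"
      by (intro tendsto_intros L)
    show "\<forall>\<^sub>F j in sequentially. norm (X i *\<^sub>V x - X j *\<^sub>V x) \<le> e * norm x"
    proof (rule eventually_sequentiallyI[of N])
      fix j assume "N \<le> j"
      then show "norm (X i *\<^sub>V x - X j *\<^sub>V x) \<le> e * norm x"
        using norm_cblinfun_le[OF that, of j x] by simp
    qed
  qed simp
  have add: "L (x + y) = L x + L y" for x y
    by (rule LIMSEQ_unique[OF L]) (simp only: cblinfun_apply_add, intro tendsto_add L)
  have scale: "L (c *\<^sub>C x) = c *\<^sub>C L x" for c x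
    by (rule LIMSEQ_unique[OF L])
      (simp only: cblinfun_apply_scaleC, rule tendsto_scaleC[OF tendsto_const L])
  obtain N where N: "\<forall>i\<ge>N. \<forall>j\<ge>N. norm (X i - X j) < 1"
    using CauchyD[OF X, of 1] by auto
  have "bounded_linear L"
  proof (rule bounded_linear_intro[where K = "1 + norm (X N)"])
    show "L (r *\<^sub>R x) = r *\<^sub>R L x" for r x
      by (simp add: scaleR_scaleC scale)
    show "norm (L x) \<le> norm x * (1 + norm (X N))" for x
    proof -
      have "norm (X N *\<^sub>V x - L x) \<le> 1 * norm x"
        by (rule bnd[of N]) (use N in \<open>auto intro: less_imp_le\<close>)
      then show ?thesis
        using norm_cblinfun[of "X N" x] norm_triangle_sub[of "L x" "X N *\<^sub>V x"]
        by (simp add: norm_minus_commute algebra_simps)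
    qed
  qed (rule add)
  then have app: "CBlinfun L *\<^sub>V x = L x" for x
    by (rule CBlinfun_apply) (rule scale)
  have "X \<longlonglongrightarrow> CBlinfun L"
  proof (rule LIMSEQ_I)
    fix r :: real
    assume r: "0 < r"
    then obtain N where N: "\<forall>i\<ge>N. \<forall>j\<ge>N. norm (X i - X j) < r / 2"
      using CauchyD[OF X, of "r / 2"] by auto
    have "norm (X i - CBlinfun L) < r" if "i \<ge> N" for i
    proof -
      have "norm (X i - CBlinfun L) \<le> r / 2"
        by (rule norm_cblinfun_bound)
          (use r bnd[of N i "r / 2"] N that in \<open>auto simp: app intro: less_imp_le\<close>)
      then show ?thesis
        using r by simp
    qed
    then show "\<exists>N. \<forall>i\<ge>N. norm (X i - CBlinfun L) < r"
      by blast
  qed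
  then show "convergent X"
    by (auto simp: convergent_def)
qed

instance cblinfun :: (complex_normed_vector, "{complex_normed_vector, complete_space}") banach ..

section \<open>Complex inner products and Riesz representation\<close>

lemma cinner_add_right: "cinner x (y + z) = cinner x y + cinner x z" for x :: "'a::complex_inner"
  by (metis cinner_add_left cinner_commute complex_cnj_add)

lemma cinner_scaleC_right [simp]: "cinner x (c *\<^sub>C y) = cnj c * cinner x y" for x :: "'a::complex_inner"
  by (metis cinner_commute cinner_scaleC_left complex_cnj_mult)

declare cinner_scaleC_left [simp]

lemma cinner_zero [simp]: "cinner 0 x = 0" "cinner x 0 = 0" for x :: "'a::complex_inner"
  using cinner_add_left[of 0 0 x] cinner_add_right[of x 0 0] by simp_all

lemma cinner_minus_left [simp]: "cinner (- x) y = - cinner x y" for x :: "'a::complex_inner"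
  using cinner_add_left[of x "- x" y] by (simp add: eq_neg_iff_add_eq_0 add.commute)

lemma cinner_minus_right [simp]: "cinner x (- y) = - cinner x y" for x :: "'a::complex_inner"
  using cinner_add_right[of x y "- y"] by (simp add: eq_neg_iff_add_eq_0 add.commute)

lemma cinner_diff_left: "cinner (x - y) z = cinner x z - cinner y z" for x :: "'a::complex_inner"
  using cinner_add_left[of x "- y" z] by simp

lemma cinner_diff_right: "cinner x (y - z) = cinner x y - cinner x z" for x :: "'a::complex_inner"
  using cinner_add_right[of x y "- z"] by simp

lemmas cinner_linear = cinner_add_left cinner_add_right cinner_diff_left cinner_diff_right

lemma cinner_eqI: "(\<And>y. cinner x y = cinner x' y) \<Longrightarrow> x = x'" for x :: "'a::complex_inner"
  using cinner_same[of "x - x'"] by (auto simp: cinner_diff_left)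

lemma cinner_eqI_right: "(\<And>y. cinner y x = cinner y x') \<Longrightarrow> x = x'" for x :: "'a::complex_inner"
  by (rule cinner_eqI) (metis cinner_commute)

lemma norm_sq_cinner: "(norm x)\<^sup>2 = Re (cinner x x)" for x :: "'a::complex_inner"
  by (simp add: cinner_same)

lemma bounded_linear_cinner_left: "bounded_linear (\<lambda>x. cinner x y)" for y :: "'a::complex_inner"
proof (rule bounded_linear_intro[where K = "norm y"])
  show "cinner (r *\<^sub>R x) y = r *\<^sub>R cinner x y" for r x
    by (simp add: scaleR_scaleC[where 'a = 'a] scaleR_conv_of_real)
qed (simp_all add: norm_cinner_le cinner_add_left)

lemmas tendsto_cinner_left = bounded_linear.tendsto[OF bounded_linear_cinner_left]

text \<open>Riesz representation by minimizing \<open>J m = |m|^2 - 2 Re (\<phi> m)\<close>. As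
  \<open>M\<close> need not be closed, the representing vector is only a limit of a minimizing
  sequence and lies in the closure.\<close>

lemma bounded_linear_form_representation:
  fixes M :: "'a::chilbert_space set" and \<phi> :: "'a \<Rightarrow> complex"
  assumes M: "csubspace M" and K: "0 \<le> K"
    and add: "\<And>m n. m \<in> M \<Longrightarrow> n \<in> M \<Longrightarrow> \<phi> (m + n) = \<phi> m + \<phi> n"
    and scale: "\<And>c m. m \<in> M \<Longrightarrow> \<phi> (c *\<^sub>C m) = c * \<phi> m"
    and bound: "\<And>m. m \<in> M \<Longrightarrow> cmod (\<phi> m) \<le> K * norm m"
  obtains g where "g \<in> closure M" "\<And>m. m \<in> M \<Longrightarrow> \<phi> m = cinner m g" "norm g \<le> K"
proof -
  define J where "J m = (norm m)\<^sup>2 - 2 * Re (\<phi> m)" for m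
  have M0: "0 \<in> M" and Madd: "\<And>x y. x \<in> M \<Longrightarrow> y \<in> M \<Longrightarrow> x + y \<in> M"
    and Mscale: "\<And>c x. x \<in> M \<Longrightarrow> c *\<^sub>C x \<in> M"
    using M by (auto simp: csubspace_def)
  have Mreal: "r *\<^sub>R x \<in> M" if "x \<in> M" for r x
    using Mscale[OF that] by (simp add: scaleR_scaleC)
  have Jlow: "- K\<^sup>2 \<le> J m" if "m \<in> M" for m
  proof -
    have "Re (\<phi> m) \<le> K * norm m"
      using bound[OF that] complex_Re_le_cmod order_trans by blast
    moreover have "0 \<le> (norm m - K)\<^sup>2"
      by simp
    ultimately show ?thesis
      unfolding J_def by (simp add: power2_diff algebra_simps)
  qed
  define d where "d = Inf (J ` M)"
  have bdd: "bdd_below (J ` M)"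
    by (rule bdd_belowI[of _ "- K\<^sup>2"]) (use Jlow in auto)
  have d: "d \<le> J m" if "m \<in> M" for m
    unfolding d_def by (rule cInf_lower[OF imageI[OF that] bdd])
  have "\<exists>m\<in>M. J m < d + inverse (real (Suc n))" for n
    using cInf_lessD[of "J ` M" "d + inverse (real (Suc n))"] M0 by (force simp: d_def)
  then obtain s where s: "\<And>n. s n \<in> M" "\<And>n. J (s n) < d + inverse (real (Suc n))"
    by metis
  have quad: "J (m + t *\<^sub>R n) = J m + 2 * t * (inner m n - Re (\<phi> n)) + t\<^sup>2 * (norm n)\<^sup>2"
    if "m \<in> M" "n \<in> M" for m n t
  proof -
    have "Re (\<phi> (m + t *\<^sub>R n)) = Re (\<phi> m) + t * Re (\<phi> n)"
      using that by (simp add: add Mreal) (simp add: scaleR_scaleC scale)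
    moreover have "(norm (m + t *\<^sub>R n))\<^sup>2 = (norm m)\<^sup>2 + 2 * t * inner m n + t\<^sup>2 * (norm n)\<^sup>2"
      unfolding power2_norm_eq_inner
      by (simp add: inner_add_left inner_add_right inner_commute power2_eq_square)
    ultimately show ?thesis
      unfolding J_def by (simp add: algebra_simps)
  qed
  \<comment> \<open>Parallelogram identity for \<open>J\<close>: its value at the midpoint of
    \<open>m\<close> and \<open>n\<close> is at least \<open>d\<close>, so near-minimizers are close
    to each other.\<close>
  have par: "(norm (m - n))\<^sup>2 \<le> 2 * (J m - d) + 2 * (J n - d)" if m: "m \<in> M" "n \<in> M" for m n
  proof -
    have dm: "n - m \<in> M"
      using Madd[OF m(2) Mreal[OF m(1), of "-1"]] by simp
    have "J n = J (m + 1 *\<^sub>R (n - m))"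
      by simp
    also have "\<dots> = J m + 2 * (inner m (n - m) - Re (\<phi> (n - m))) + (norm (n - m))\<^sup>2"
      by (subst quad[OF m(1) dm]) simp
    finally have "2 * J (m + (1/2) *\<^sub>R (n - m)) = J m + J n - (norm (n - m))\<^sup>2 / 2"
      by (subst quad[OF m(1) dm]) (simp add: power2_eq_square)
    moreover have "d \<le> J (m + (1/2) *\<^sub>R (n - m))"
      by (intro d Madd Mreal m dm)
    ultimately show ?thesis
      by (simp add: norm_minus_commute)
  qed
  have J_lim: "(\<lambda>n. J (s n)) \<longlonglongrightarrow> d"
  proof (rule real_tendsto_sandwich[of "\<lambda>_. d" _ _ "\<lambda>n. d + inverse (real (Suc n))"])
    show "(\<lambda>n. d + inverse (real (Suc n))) \<longlonglongrightarrow> d"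
      by (rule LIMSEQ_inverse_real_of_nat_add)
  qed (use d s in \<open>auto intro!: always_eventually less_imp_le\<close>)
  have "Cauchy s"
  proof (rule CauchyI)
    fix e :: real
    assume e: "0 < e"
    then have "\<forall>\<^sub>F n in sequentially. J (s n) < d + e\<^sup>2 / 4"
      by (intro order_tendstoD(2)[OF J_lim]) simp
    then obtain N where N: "\<And>n. n \<ge> N \<Longrightarrow> J (s n) < d + e\<^sup>2 / 4"
      by (auto simp: eventually_sequentially)
    have "norm (s i - s j) < e" if "i \<ge> N" "j \<ge> N" for i j
      using par[OF s(1) s(1), of i j] N[OF that(1)] N[OF that(2)] e
      by (intro power2_less_imp_less[of _ e]) auto
    then show "\<exists>N. \<forall>i\<ge>N. \<forall>j\<ge>N. norm (s i - s j) < e"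
      by blast
  qed
  then obtain g where g: "s \<longlonglongrightarrow> g"
    using Cauchy_convergent convergent_def by blast
  have re: "inner x g = Re (\<phi> x)" if x: "x \<in> M" for x
  proof -
    define a where "a = inner g x - Re (\<phi> x)"
    define b where "b = (norm x)\<^sup>2"
    have b: "0 \<le> b"
      by (simp add: b_def)
    \<comment> \<open>First variation: moving from \<open>g\<close> by \<open>t\<close> in the
      direction \<open>x\<close> cannot push \<open>J\<close> below \<open>d\<close>, so this
      quadratic in \<open>t\<close> is non-negative.\<close>
    have *: "0 \<le> 2 * t * a + t\<^sup>2 * b" for t
    proof (rule tendsto_lowerbound)
      show "(\<lambda>n. J (s n) - d + 2 * t * (inner (s n) x - Re (\<phi> x)) + t\<^sup>2 * b)
          \<longlonglongrightarrow> 2 * t * a + t\<^sup>2 * b"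
        unfolding a_def by (rule tendsto_eq_intros J_lim g refl | simp)+
      show "\<forall>\<^sub>F n in sequentially. 0 \<le> J (s n) - d + 2 * t * (inner (s n) x - Re (\<phi> x)) + t\<^sup>2 * b"
        using d[OF Madd[OF s(1) Mreal[OF x]]] quad[OF s(1) x]
        by (auto intro!: always_eventually simp: b_def algebra_simps)
    qed simp
    \<comment> \<open>The minimizing \<open>t\<close> would be \<open>- a / b\<close>; the
      denominator \<open>b + 1\<close> also covers \<open>x = 0\<close>.\<close>
    have "0 \<le> (b + 1)\<^sup>2 * (2 * (- a / (b + 1)) * a + (- a / (b + 1))\<^sup>2 * b)"
      by (intro mult_nonneg_nonneg *) simp
    also have "\<dots> = - (a\<^sup>2 * (b + 2))"
    proof -
      have "(b + 1) * (- a / (b + 1)) = - a"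
        using b by simp
      then have "(b + 1)\<^sup>2 * (2 * (- a / (b + 1)) * a + (- a / (b + 1))\<^sup>2 * b)
          = 2 * (b + 1) * (- a) * a + (- a)\<^sup>2 * b"
        by (simp only: power2_eq_square distrib_left) algebra
      then show ?thesis
        by (simp add: power2_eq_square algebra_simps)
    qed
    finally have "a = 0"
      using b by (simp add: mult_le_0_iff)
    then show ?thesis
      by (simp add: a_def inner_commute)
  qed
  have rep: "\<phi> x = cinner x g" if x: "x \<in> M" for x
  proof (rule complex_eqI)
    show "Re (\<phi> x) = Re (cinner x g)"
      by (simp add: Re_cinner re x)
    \<comment> \<open>Only real parts have been matched so far; testing at \<open>\<i>\<close> times
      \<open>x\<close> recovers the imaginary part.\<close>
    have "Re (cinner (\<i> *\<^sub>C x) g) = Re (\<phi> (\<i> *\<^sub>C x))"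
      unfolding Re_cinner by (rule re[OF Mscale[OF x]])
    then show "Im (\<phi> x) = Im (cinner x g)"
      by (simp add: scale x)
  qed
  have "(norm g)\<^sup>2 \<le> K * norm g"
  proof (rule tendsto_le[of sequentially])
    show "(\<lambda>n. K * norm (s n)) \<longlonglongrightarrow> K * norm g"
      by (intro tendsto_intros g)
    show "(\<lambda>n. cmod (cinner (s n) g)) \<longlonglongrightarrow> (norm g)\<^sup>2"
      using tendsto_norm[OF tendsto_cinner_left[OF g, of g]]
      by (simp add: cinner_same norm_power)
    show "\<forall>\<^sub>F n in sequentially. cmod (cinner (s n) g) \<le> K * norm (s n)"
      using bound[OF s(1)] by (auto simp: rep[OF s(1)])
  qed simp
  then have "norm g \<le> K"
    using K by (cases "norm g = 0") (auto simp: power2_eq_square)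
  moreover have "g \<in> closure M"
    using s(1) g closure_sequential by blast
  ultimately show ?thesis
    using that rep by blast
qed

lemma orthogonal_closure_zero:
  fixes g :: "'a::complex_inner"
  assumes "g \<in> closure M" "\<And>m. m \<in> M \<Longrightarrow> cinner m g = 0"
  shows "g = 0"
proof -
  obtain s where s: "\<And>n. s n \<in> M" "s \<longlonglongrightarrow> g"
    using assms(1) closure_sequential by blast
  have "cinner g g = 0"
    by (rule LIMSEQ_unique[OF tendsto_cinner_left[OF s(2)]]) (simp add: assms(2) s(1))
  then show ?thesis
    by (simp add: cinner_same)
qed

lemma csubspace_closure: "csubspace (closure M)" if "csubspace M" for M :: "'a::complex_normed_vector set"
proof -
  have "x + y \<in> closure M" if xy: "x \<in> closure M" "y \<in> closure M" for x y
  proof -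
    obtain s t where "\<And>n. s n \<in> M" "s \<longlonglongrightarrow> x" "\<And>n. t n \<in> M" "t \<longlonglongrightarrow> y"
      using xy closure_sequential by metis
    then show ?thesis
      using \<open>csubspace M\<close>
      by (auto simp: closure_sequential csubspace_def intro!: exI[of _ "\<lambda>n. s n + t n"] tendsto_add)
  qed
  moreover have "c *\<^sub>C x \<in> closure M" if x: "x \<in> closure M" for c x
  proof -
    obtain s where "\<And>n. s n \<in> M" "s \<longlonglongrightarrow> x"
      using x closure_sequential by metis
    then show ?thesis
      using \<open>csubspace M\<close>
      by (auto simp: closure_sequential csubspace_def intro!: exI[of _ "\<lambda>n. c *\<^sub>C s n"]
          tendsto_scaleC tendsto_const)
  qed
  ultimately show ?thesis
    using that closure_subset[of M] by (auto simp: csubspace_def)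
qed

text \<open>Adjoints, orthogonal projections and the factorization lemma of Douglas are all instances.\<close>

lemma bounded_form_operator:
  fixes M :: "'a::chilbert_space set" and b :: "'a \<Rightarrow> 'b::complex_normed_vector \<Rightarrow> complex"
  assumes M: "csubspace M" and K: "0 \<le> K"
    and add_left: "\<And>m n l. m \<in> M \<Longrightarrow> n \<in> M \<Longrightarrow> b (m + n) l = b m l + b n l"
    and scale_left: "\<And>c m l. m \<in> M \<Longrightarrow> b (c *\<^sub>C m) l = c * b m l"
    and add_right: "\<And>m k l. m \<in> M \<Longrightarrow> b m (k + l) = b m k + b m l"
    and scale_right: "\<And>c m l. m \<in> M \<Longrightarrow> b m (c *\<^sub>C l) = cnj c * b m l"
    and bound: "\<And>m l. m \<in> M \<Longrightarrow> cmod (b m l) \<le> K * norm m * norm l"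
  shows "\<exists>T :: 'b \<Rightarrow>\<^sub>C\<^sub>L 'a. (\<forall>l. T *\<^sub>V l \<in> closure M) \<and> (\<forall>m\<in>M. \<forall>l. b m l = cinner m (T *\<^sub>V l)) \<and> norm T \<le> K"
proof -
  have "\<exists>g. g \<in> closure M \<and> (\<forall>m\<in>M. b m l = cinner m g) \<and> norm g \<le> K * norm l" for l
    by (rule bounded_linear_form_representation[OF M, of "K * norm l" "\<lambda>m. b m l"])
      (use assms in \<open>auto simp: algebra_simps\<close>)
  then obtain t where t: "\<And>l. t l \<in> closure M" "\<And>m l. m \<in> M \<Longrightarrow> b m l = cinner m (t l)"
    "\<And>l. norm (t l) \<le> K * norm l"
    by metis
  have cl: "x + y \<in> closure M" "c *\<^sub>C x \<in> closure M" "x - y \<in> closure M"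
    if "x \<in> closure M" "y \<in> closure M" for x y c
  proof -
    show *: "x + y \<in> closure M" "c *\<^sub>C x \<in> closure M" for c
      using csubspace_closure[OF M] that by (auto simp: csubspace_def)
    have "x + (- 1) *\<^sub>C y \<in> closure M"
      using csubspace_closure[OF M] that unfolding csubspace_def by blast
    then show "x - y \<in> closure M"
      by (simp add: scaleC_minus_left)
  qed
  \<comment> \<open>The values of \<open>t\<close> lie in the closure of \<open>M\<close> and are
    determined by their pairings with \<open>M\<close>, so linearity can be checked weakly.\<close>
  have add: "t (k + l) = t k + t l" for k l
  proof -
    have "t (k + l) - (t k + t l) = 0"
      by (rule orthogonal_closure_zero[of _ M])
        (auto simp: cl t(1) cinner_linear t(2)[symmetric] add_right)
    then show ?thesis
      by simp
  qed
  have scale: "t (c *\<^sub>C l) = c *\<^sub>C t l" for c l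
  proof -
    have "t (c *\<^sub>C l) - c *\<^sub>C t l = 0"
      by (rule orthogonal_closure_zero[of _ M])
        (auto intro!: cl t(1) simp: cinner_linear t(2)[symmetric] scale_right)
    then show ?thesis
      by simp
  qed
  have "bounded_linear t"
    using t(3) by (intro bounded_linear_intro[where K = K]) (auto simp: add scale scaleR_scaleC mult.commute)
  then have app: "CBlinfun t *\<^sub>V l = t l" for l
    by (rule CBlinfun_apply) (rule scale)
  show ?thesis
    by (intro exI[of _ "CBlinfun t"] conjI norm_cblinfun_bound K) (auto simp: app t)
qed

section \<open>Adjoints\<close>

lemma adj_exists: "\<exists>S. \<forall>x y. cinner (T *\<^sub>V x) y = cinner x (S *\<^sub>V y)"
  for T :: "'a::chilbert_space \<Rightarrow>\<^sub>C\<^sub>L 'b::chilbert_space"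
proof -
  have "cmod (cinner (T *\<^sub>V x) y) \<le> norm T * norm x * norm y" for x y
    using norm_cinner_le[of "T *\<^sub>V x" y] mult_right_mono[OF norm_cblinfun[of T x], of "norm y"] by simp
  then have "\<exists>S :: 'b \<Rightarrow>\<^sub>C\<^sub>L 'a. (\<forall>y. S *\<^sub>V y \<in> closure UNIV)
      \<and> (\<forall>x\<in>UNIV. \<forall>y. cinner (T *\<^sub>V x) y = cinner x (S *\<^sub>V y)) \<and> norm S \<le> norm T"
    by (intro bounded_form_operator) (simp_all add: cblinfun_apply_linear cinner_linear csubspace_def)
  then show ?thesis
    by blast
qed

lemma cinner_adj: "cinner (T *\<^sub>V x) y = cinner x (T* *\<^sub>V y)"
  for T :: "'a::chilbert_space \<Rightarrow>\<^sub>C\<^sub>L 'b::chilbert_space"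
proof -
  have "\<exists>!S. \<forall>x y. cinner (T *\<^sub>V x) y = cinner x (S *\<^sub>V y)"
  proof (rule ex_ex1I[OF adj_exists])
    fix S S'
    assume "\<forall>x y. cinner (T *\<^sub>V x) y = cinner x (S *\<^sub>V y)" "\<forall>x y. cinner (T *\<^sub>V x) y = cinner x (S' *\<^sub>V y)"
    then show "S = S'"
      by (metis cblinfun_eqI cinner_eqI_right)
  qed
  from theI'[OF this] show ?thesis
    unfolding adj_def by blast
qed

lemma cinner_adj_left: "cinner (T* *\<^sub>V x) y = cinner x (T *\<^sub>V y)"
  for T :: "'a::chilbert_space \<Rightarrow>\<^sub>C\<^sub>L 'b::chilbert_space"
  by (metis cinner_adj cinner_commute)

lemma adj_eqI: "(\<And>x y. cinner (T *\<^sub>V x) y = cinner x (S *\<^sub>V y)) \<Longrightarrow> T* = S"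
  by (metis cblinfun_eqI cinner_eqI_right cinner_adj)

lemma adj_adj [simp]: "(T*)* = T"
  by (rule adj_eqI) (rule cinner_adj_left)

lemma adj_comp [simp]: "(S o\<^sub>C\<^sub>L T)* = T* o\<^sub>C\<^sub>L S*"
  by (rule adj_eqI) (simp add: cinner_adj)

lemma adj_add [simp]: "(S + T)* = S* + T*"
  by (rule adj_eqI) (simp add: cinner_adj cinner_linear)

lemma adj_diff [simp]: "(S - T)* = S* - T*"
  by (rule adj_eqI) (simp add: cinner_adj cinner_linear)

lemma adj_scaleC [simp]: "(c *\<^sub>C T)* = cnj c *\<^sub>C T*"
  by (rule adj_eqI) (simp add: cinner_adj)

lemma adj_id [simp]: "id_op* = id_op"
  by (rule adj_eqI) simp

lemma norm_adj_le: "norm (T*) \<le> norm T"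
proof (rule norm_cblinfun_bound)
  fix x
  have "(norm (T* *\<^sub>V x))\<^sup>2 = Re (cinner x (T *\<^sub>V T* *\<^sub>V x))"
    by (simp add: norm_sq_cinner cinner_adj_left)
  also have "\<dots> \<le> norm x * norm (T *\<^sub>V T* *\<^sub>V x)"
    using complex_Re_le_cmod norm_cinner_le order_trans by blast
  also have "\<dots> \<le> norm x * (norm T * norm (T* *\<^sub>V x))"
    by (intro mult_left_mono norm_cblinfun) simp
  finally show "norm (T* *\<^sub>V x) \<le> norm T * norm x"
    by (cases "norm (T* *\<^sub>V x) = 0") (auto simp: power2_eq_square mult.commute)
qed simp

lemma norm_adj [simp]: "norm (T*) = norm T"
  using norm_adj_le[of T] norm_adj_le[of "T*"] by simp


subsection \<open>Inverses\<close>

lemma is_inverse_op_unique: "is_inverse_op T R \<Longrightarrow> is_inverse_op T R' \<Longrightarrow> R = R'"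
  unfolding is_inverse_op_def
  using comp_op_assoc[of R T R'] by simp

lemma inverse_op_eqI: "is_inverse_op T R \<Longrightarrow> inverse_op T = R"
  unfolding inverse_op_def by (rule the_equality) (auto dest: is_inverse_op_unique)

lemma is_inverse_inverse_op: "invertible_op T \<Longrightarrow> is_inverse_op T (inverse_op T)"
  using inverse_op_eqI by (auto simp: invertible_op_def)

lemma inverse_op_apply [simp]:
  assumes "invertible_op T"
  shows "inverse_op T *\<^sub>V T *\<^sub>V x = x" "T *\<^sub>V inverse_op T *\<^sub>V y = y"
  using is_inverse_inverse_op[OF assms] unfolding is_inverse_op_def
  by (metis comp_op_apply id_op_apply)+

lemma is_inverse_opI:
  "(\<And>x. R *\<^sub>V T *\<^sub>V x = x) \<Longrightarrow> (\<And>x. T *\<^sub>V R *\<^sub>V x = x) \<Longrightarrow> is_inverse_op T R"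
  unfolding is_inverse_op_def by (auto intro: cblinfun_eqI)

lemma invertible_opI:
  "(\<And>x. R *\<^sub>V T *\<^sub>V x = x) \<Longrightarrow> (\<And>x. T *\<^sub>V R *\<^sub>V x = x) \<Longrightarrow> invertible_op T"
  using is_inverse_opI invertible_op_def by blast

lemma invertible_inverse_op: "invertible_op T \<Longrightarrow> invertible_op (inverse_op T)"
  by (rule invertible_opI[of T]) simp_all

lemma invertible_comp_op: "invertible_op S \<Longrightarrow> invertible_op T \<Longrightarrow> invertible_op (S o\<^sub>C\<^sub>L T)"
  by (rule invertible_opI[of "inverse_op T o\<^sub>C\<^sub>L inverse_op S"]) simp_all

lemma invertible_scaleC: "c \<noteq> 0 \<Longrightarrow> invertible_op T \<Longrightarrow> invertible_op (c *\<^sub>C T)"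
  by (rule invertible_opI[of "inverse c *\<^sub>C inverse_op T"]) simp_all

lemma is_inverse_op_adj:
  assumes "is_inverse_op T R" shows "is_inverse_op (T*) (R*)"
  using assms adj_comp[of R T] adj_comp[of T R] by (simp add: is_inverse_op_def)

lemma invertible_adj:
  assumes "invertible_op T" shows "invertible_op (T*)"
  using is_inverse_op_adj[OF is_inverse_inverse_op[OF assms]] by (auto simp: invertible_op_def)

lemma invertible_id_minus:
  fixes B :: "'a::chilbert_space \<Rightarrow>\<^sub>C\<^sub>L 'a"
  assumes B: "norm B < 1"
  shows "invertible_op (id_op - B)"
proof -
  \<comment> \<open>\<open>p n\<close> is the n-th power of \<open>B\<close>; the sum of this
    Neumann series is the inverse.\<close>
  define p where "p n = ((\<lambda>X. B o\<^sub>C\<^sub>L X) ^^ n) id_op" for n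
  have p_Suc: "p (Suc n) = B o\<^sub>C\<^sub>L p n" "p (Suc n) = p n o\<^sub>C\<^sub>L B" for n
  proof -
    show "p (Suc n) = B o\<^sub>C\<^sub>L p n" for n
      by (simp add: p_def)
    then show "p (Suc n) = p n o\<^sub>C\<^sub>L B"
      by (induction n) (simp add: p_def, metis comp_op_assoc)
  qed
  have "norm (p n) \<le> norm B ^ n" for n
  proof (induction n)
    case (Suc n)
    have "norm (p (Suc n)) \<le> norm B * norm (p n)"
      unfolding p_Suc by (rule norm_comp_op_le)
    also have "\<dots> \<le> norm B * norm B ^ n"
      by (intro mult_left_mono Suc) simp
    finally show ?case
      by simp
  qed (simp add: p_def norm_id_op_le)
  then have "summable p"
    by (intro summable_comparison_test'[OF summable_geometric]) (use B in auto)
  then have p: "p sums (suminf p)"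
    by (rule summable_sums)
  have "p 0 = id_op"
    by (simp add: p_def)
  then have tail: "(\<lambda>n. p (Suc n)) sums (suminf p - id_op)"
    using p by (simp add: sums_Suc_iff)
  have 1: "B o\<^sub>C\<^sub>L suminf p = suminf p - id_op"
    using bounded_linear.sums[OF bounded_bilinear.bounded_linear_right[OF bounded_bilinear_comp_op] p, of B]
    unfolding p_Suc(1)[symmetric] by (rule sums_unique2[OF _ tail])
  have 2: "suminf p o\<^sub>C\<^sub>L B = suminf p - id_op"
    using bounded_linear.sums[OF bounded_bilinear.bounded_linear_left[OF bounded_bilinear_comp_op] p, of B]
    unfolding p_Suc(2)[symmetric] by (rule sums_unique2[OF _ tail])
  have "B *\<^sub>V suminf p *\<^sub>V x = suminf p *\<^sub>V x - x" "suminf p *\<^sub>V B *\<^sub>V x = suminf p *\<^sub>V x - x" for x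
    using arg_cong[OF 1, of "\<lambda>T. T *\<^sub>V x"] arg_cong[OF 2, of "\<lambda>T. T *\<^sub>V x"] by simp_all
  then show ?thesis
    by (intro invertible_opI[of "suminf p"]) (simp_all add: cblinfun_apply_linear)
qed

lemma invertible_id_plus: "norm B < 1 \<Longrightarrow> invertible_op (id_op + B)"
  for B :: "'a::chilbert_space \<Rightarrow>\<^sub>C\<^sub>L 'a"
  using invertible_id_minus[of "- B"] by simp

lemma invertible_perturbation:
  fixes S T :: "'a::chilbert_space \<Rightarrow>\<^sub>C\<^sub>L 'a"
  assumes S: "invertible_op S" and K: "norm (inverse_op S) \<le> K" and ST: "norm (S - T) < inverse K"
  shows "invertible_op T"
proof -
  have "0 < K"
    using le_less_trans[OF norm_ge_zero ST] by simp
  have "norm (inverse_op S o\<^sub>C\<^sub>L (S - T)) \<le> K * norm (S - T)"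
    by (rule order_trans[OF norm_comp_op_le mult_right_mono[OF K norm_ge_zero]])
  also have "\<dots> < 1"
    using ST \<open>0 < K\<close> by (simp add: field_simps)
  finally have "invertible_op (S o\<^sub>C\<^sub>L (id_op - inverse_op S o\<^sub>C\<^sub>L (S - T)))"
    by (intro invertible_comp_op S invertible_id_minus)
  moreover have "S o\<^sub>C\<^sub>L (id_op - inverse_op S o\<^sub>C\<^sub>L (S - T)) = T"
    by (rule cblinfun_eqI) (simp add: cblinfun_apply_linear S)
  ultimately show ?thesis
    by simp
qed

lemma norm_inverse_op_le:
  assumes "invertible_op T" "0 < K" "\<And>x. norm x \<le> K * norm (T *\<^sub>V x)"
  shows "norm (inverse_op T) \<le> K"
proof (rule norm_cblinfun_bound)
  show "norm (inverse_op T *\<^sub>V x) \<le> K * norm x" for x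
    using assms(3)[of "inverse_op T *\<^sub>V x"] assms(1) by simp
qed (use assms in simp)

lemma inverse_op_adj:
  assumes "invertible_op T" shows "inverse_op (T*) = (inverse_op T)*"
  by (rule inverse_op_eqI[OF is_inverse_op_adj[OF is_inverse_inverse_op[OF assms]]])

text \<open>In infinite dimension \<open>below\<close> alone gives only surjectivity of
  \<open>T t\<close>. But wherever \<open>T t\<close> is invertible, \<open>below\<close> bounds its
  inverse by 1, so the radius of invertibility does not shrink along the path and finitely many
  small steps reach the end.\<close>

lemma invertible_along_path:
  fixes T :: "real \<Rightarrow> 'a::chilbert_space \<Rightarrow>\<^sub>C\<^sub>L 'a"
  assumes cont: "continuous_on {0..1} T" and start: "invertible_op (T 0)"
    and below: "\<And>t x. t \<in> {0..1} \<Longrightarrow> norm x \<le> norm ((T t)* *\<^sub>V x)"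
  shows "invertible_op (T 1)"
proof -
  have "uniformly_continuous_on {0..1} T"
    by (rule compact_uniformly_continuous[OF cont]) simp
  then obtain d where d: "0 < d"
    "\<And>s t. s \<in> {0..1} \<Longrightarrow> t \<in> {0..1} \<Longrightarrow> dist t s < d \<Longrightarrow> dist (T t) (T s) < 1"
    by (rule uniformly_continuous_onE[OF _ zero_less_one]) blast
  have step: "invertible_op (T t)" if "s \<in> {0..1}" "t \<in> {0..1}" "\<bar>t - s\<bar> < d" "invertible_op (T s)" for s t
  proof (rule invertible_perturbation[OF that(4), of 1])
    have "norm (inverse_op ((T s)*)) \<le> 1"
      using below[OF that(1)] by (intro norm_inverse_op_le invertible_adj that(4)) auto
    then show "norm (inverse_op (T s)) \<le> 1"
      by (simp add: inverse_op_adj[OF that(4)])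
    show "norm (T s - T t) < inverse 1"
      using d(2)[OF that(1,2)] that(3) by (simp add: dist_norm norm_minus_commute)
  qed
  \<comment> \<open>Steps of length \<open>1 / n\<close> are shorter than the modulus
    \<open>d\<close> of uniform continuity.\<close>
  obtain n :: nat where n: "1 / d < n" "0 < n"
  proof -
    obtain n :: nat where n: "1 / d < n"
      using reals_Archimedean2 by blast
    moreover have "0 < 1 / d"
      using d(1) by simp
    ultimately have "0 < n"
      using less_trans of_nat_0_less_iff by blast
    with n show ?thesis
      using that by blast
  qed
  have "invertible_op (T (k / n))" if "k \<le> n" for k
    using that
  proof (induction k)
    case (Suc k)
    show ?case
    proof (rule step)
      have "1 / n < d"
        using n d(1) by (simp add: field_simps)
      then show "\<bar>real (Suc k) / n - k / n\<bar> < d"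
        by (simp add: diff_divide_distrib[symmetric])
    qed (use Suc n in \<open>auto simp: divide_simps\<close>)
  qed (simp add: start)
  from this[of n] show ?thesis
    using n by simp
qed


subsection \<open>Non-negative operators\<close>

lemma nonneg_op_iff: "nonneg_op T \<longleftrightarrow> (\<forall>x. cinner (T *\<^sub>V x) x \<in> \<real> \<and> 0 \<le> Re (cinner (T *\<^sub>V x) x))"
  unfolding nonneg_op_def by (auto simp: complex_nonneg_Reals_iff complex_is_Real_iff)

lemma Re_nonneg_op: "nonneg_op T \<Longrightarrow> 0 \<le> Re (cinner (T *\<^sub>V x) x)"
  by (simp add: nonneg_op_iff)

text \<open>Polarization over the complex scalars: expanding the form at \<open>x + y\<close> and at
  \<open>x + \<i> y\<close> isolates the sesquilinear form.\<close>

lemma cblinfun_eqI_quadratic: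
  fixes S T :: "'a::complex_inner \<Rightarrow>\<^sub>C\<^sub>L 'a"
  assumes "\<And>x. cinner (S *\<^sub>V x) x = cinner (T *\<^sub>V x) x"
  shows "S = T"
proof (rule cblinfun_eqI, rule cinner_eqI)
  fix x y
  define D where "D = S - T"
  have D: "cinner (D *\<^sub>V z) z = 0" for z
    using assms by (simp add: D_def cinner_linear)
  have "cinner (D *\<^sub>V x) y + cinner (D *\<^sub>V y) x = 0"
    using D[of "x + y"] by (simp add: cinner_linear cblinfun_apply_linear D add.commute)
  moreover have "cinner (D *\<^sub>V x) y - cinner (D *\<^sub>V y) x = 0"
    using D[of "x + \<i> *\<^sub>C y"] by (simp add: cinner_linear cblinfun_apply_linear D)
  ultimately have "cinner (D *\<^sub>V x) y = 0"
    by simp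
  then show "cinner (S *\<^sub>V x) y = cinner (T *\<^sub>V x) y"
    by (simp add: D_def cinner_linear)
qed

lemma nonneg_op_self_adjoint:
  assumes "nonneg_op T" shows "T* = T"
proof (rule cblinfun_eqI_quadratic)
  fix x
  have "cinner (T *\<^sub>V x) x \<in> \<real>"
    using assms by (simp add: nonneg_op_iff)
  then have "cnj (cinner (T *\<^sub>V x) x) = cinner (T *\<^sub>V x) x"
    by (simp add: complex_is_Real_iff complex_eq_iff)
  then show "cinner (T* *\<^sub>V x) x = cinner (T *\<^sub>V x) x"
    by (metis cinner_adj_left cinner_commute)
qed

lemma nonneg_opI:
  assumes "T* = T" "\<And>x. 0 \<le> Re (cinner (T *\<^sub>V x) x)"
  shows "nonneg_op T"
proof -
  have "cnj (cinner (T *\<^sub>V x) x) = cinner (T *\<^sub>V x) x" for x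
    by (metis assms(1) cinner_adj cinner_commute)
  then have "cinner (T *\<^sub>V x) x \<in> \<real>" for x
    by (metis Reals_cnj_iff)
  then show ?thesis
    using assms(2) by (simp add: nonneg_op_iff)
qed

text \<open>Evaluate the non-negative form at \<open>x - t T x\<close> with
  \<open>t = 1 / |T|\<close>. This is the operator inequality \<open>T^2 \<le> |T| T\<close>, by
  which the quadratic form controls norms.\<close>

lemma norm_apply_nonneg_op:
  assumes T: "nonneg_op T"
  shows "(norm (T *\<^sub>V x))\<^sup>2 \<le> norm T * Re (cinner (T *\<^sub>V x) x)"
proof (cases "norm T = 0")
  case False
  define t where "t = inverse (norm T)"
  have t: "0 < t" "t * norm T = 1"
    using False by (simp_all add: t_def)
  note sa = nonneg_op_self_adjoint[OF T]
  have *: "cinner (T *\<^sub>V T *\<^sub>V x) x = cinner (T *\<^sub>V x) (T *\<^sub>V x)"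
    by (metis cinner_adj sa)
  have "Re (cinner (T *\<^sub>V T *\<^sub>V x) (T *\<^sub>V x)) \<le> norm (T *\<^sub>V T *\<^sub>V x) * norm (T *\<^sub>V x)"
    by (rule order_trans[OF complex_Re_le_cmod norm_cinner_le])
  also have "\<dots> \<le> norm T * (norm (T *\<^sub>V x))\<^sup>2"
    using mult_right_mono[OF norm_cblinfun[of T "T *\<^sub>V x"], of "norm (T *\<^sub>V x)"]
    by (simp add: power2_eq_square mult.assoc)
  finally have "t\<^sup>2 * Re (cinner (T *\<^sub>V T *\<^sub>V x) (T *\<^sub>V x)) \<le> t\<^sup>2 * (norm T * (norm (T *\<^sub>V x))\<^sup>2)"
    by (intro mult_left_mono) auto
  also have "\<dots> = t * (norm (T *\<^sub>V x))\<^sup>2"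
    using t(2) by (simp add: power2_eq_square algebra_simps)
  finally have "t\<^sup>2 * Re (cinner (T *\<^sub>V T *\<^sub>V x) (T *\<^sub>V x)) \<le> t * (norm (T *\<^sub>V x))\<^sup>2" .
  moreover have "0 \<le> Re (cinner (T *\<^sub>V (x - of_real t *\<^sub>C (T *\<^sub>V x))) (x - of_real t *\<^sub>C (T *\<^sub>V x)))"
    by (rule Re_nonneg_op[OF T])
  ultimately have "t * (norm (T *\<^sub>V x))\<^sup>2 \<le> Re (cinner (T *\<^sub>V x) x)"
    unfolding norm_sq_cinner[of "T *\<^sub>V x"]
    by (simp add: cblinfun_apply_linear cinner_linear * power2_eq_square algebra_simps)
  then have "norm T * (t * (norm (T *\<^sub>V x))\<^sup>2) \<le> norm T * Re (cinner (T *\<^sub>V x) x)"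
    by (intro mult_left_mono) auto
  then show ?thesis
    using t(2) by (simp add: mult.assoc[symmetric] mult.commute)
qed simp

lemma nonneg_op_compress:
  fixes B :: "'b::chilbert_space \<Rightarrow>\<^sub>C\<^sub>L 'a::chilbert_space"
  shows "nonneg_op T \<Longrightarrow> nonneg_op (B* o\<^sub>C\<^sub>L T o\<^sub>C\<^sub>L B)"
  by (simp add: nonneg_op_def cinner_adj_left)

text \<open>For \<open>r = 1 / k\<close> with \<open>k \<ge> |T|\<close> one has
  \<open>|(I - r T) x|^2 \<le> |x|^2 - r <T x, x> \<le> (1 - r) |x|^2\<close>, so \<open>r T\<close>
  differs from the identity by a strict contraction. Adding 1 to the norm keeps \<open>k\<close>
  positive and \<open>1 - r\<close> non-negative.\<close>

lemma invertible_coercive: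
  fixes T :: "'a::chilbert_space \<Rightarrow>\<^sub>C\<^sub>L 'a"
  assumes T: "nonneg_op T" and c: "\<And>x. (norm x)\<^sup>2 \<le> Re (cinner (T *\<^sub>V x) x)"
  shows "invertible_op T"
proof -
  define k where "k = norm T + 1"
  define r where "r = inverse k"
  have k: "norm T \<le> k" "1 \<le> k"
    by (simp_all add: k_def)
  have "norm (id_op - of_real r *\<^sub>C T) \<le> sqrt (1 - r)"
  proof (rule norm_cblinfun_bound)
    show "0 \<le> sqrt (1 - r)"
      using k by (simp add: r_def field_simps)
    fix x
    have r: "0 < r" "r * k = 1" "0 \<le> 1 - r"
      using k by (auto simp: r_def field_simps)
    have "(norm (T *\<^sub>V x))\<^sup>2 \<le> k * Re (cinner (T *\<^sub>V x) x)"
      using norm_apply_nonneg_op[OF T, of x] mult_right_mono[OF k(1) Re_nonneg_op[OF T, of x]] by simp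
    then have "r\<^sup>2 * (norm (T *\<^sub>V x))\<^sup>2 \<le> r\<^sup>2 * (k * Re (cinner (T *\<^sub>V x) x))"
      by (intro mult_left_mono) auto
    also have "\<dots> = r * Re (cinner (T *\<^sub>V x) x)"
      using r by (simp add: power2_eq_square algebra_simps)
    finally have 1: "r\<^sup>2 * (norm (T *\<^sub>V x))\<^sup>2 \<le> r * Re (cinner (T *\<^sub>V x) x)" .
    have 2: "r * (norm x)\<^sup>2 \<le> r * Re (cinner (T *\<^sub>V x) x)"
      using c[of x] r by simp
    have "Re (cinner x (T *\<^sub>V x)) = Re (cinner (T *\<^sub>V x) x)"
      by (subst cinner_commute) simp
    then have "(norm ((id_op - of_real r *\<^sub>C T) *\<^sub>V x))\<^sup>2
        = (norm x)\<^sup>2 - 2 * r * Re (cinner (T *\<^sub>V x) x) + r\<^sup>2 * (norm (T *\<^sub>V x))\<^sup>2"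
      unfolding norm_sq_cinner by (simp add: cinner_linear power2_eq_square algebra_simps)
    also have "\<dots> \<le> (1 - r) * (norm x)\<^sup>2"
      using 1 2 by (simp add: algebra_simps)
    finally show "norm ((id_op - of_real r *\<^sub>C T) *\<^sub>V x) \<le> sqrt (1 - r) * norm x"
      using r by (metis abs_norm_cancel real_sqrt_abs real_sqrt_le_mono real_sqrt_mult)
  qed
  also have "sqrt (1 - r) < 1"
    using k by (simp add: r_def)
  finally have "invertible_op (id_op - (id_op - of_real r *\<^sub>C T))"
    by (rule invertible_id_minus)
  then have inv: "invertible_op (of_real r *\<^sub>C T)"
    by simp
  have "r \<noteq> 0"
    using k by (simp add: r_def)
  then show ?thesis
    using invertible_scaleC[OF _ inv, of "inverse (of_real r)"] by simp
qed


subsection \<open>Square roots\<close>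

text \<open>For \<open>B \<ge> 0\<close> with \<open>\<parallel>B\<parallel> \<le> 1\<close> these iterates increase to \<open>I - (I - B)\<^sup>1\<^sup>/\<^sup>2\<close>.  They are polynomials in \<open>B\<close>
  with non-negative coefficients, so the scalar case \<open>B = 1\<close> bounds their increments.\<close>

fun sqrt_iterate :: "'a::complex_normed_vector \<Rightarrow>\<^sub>C\<^sub>L 'a \<Rightarrow> nat \<Rightarrow> 'a \<Rightarrow>\<^sub>C\<^sub>L 'a" where
  "sqrt_iterate B 0 = 0"
| "sqrt_iterate B (Suc n) = (1/2) *\<^sub>R (B + sqrt_iterate B n o\<^sub>C\<^sub>L sqrt_iterate B n)"

fun sqrt_iterate_bound :: "nat \<Rightarrow> real" where
  "sqrt_iterate_bound 0 = 0"
| "sqrt_iterate_bound (Suc n) = (1 + (sqrt_iterate_bound n)\<^sup>2) / 2"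

lemma sqrt_iterate_bound_range: "0 \<le> sqrt_iterate_bound n" "sqrt_iterate_bound n \<le> 1"
  by (induction n) (auto simp: power_le_one)

lemma sqrt_iterate_bound_mono: "sqrt_iterate_bound n \<le> sqrt_iterate_bound (Suc n)"
proof -
  have "0 \<le> (1 - sqrt_iterate_bound n)\<^sup>2"
    by simp
  then show ?thesis
    by (simp add: power2_diff)
qed

lemma sqrt_iterate_commute: "B o\<^sub>C\<^sub>L Z = Z o\<^sub>C\<^sub>L B \<Longrightarrow> sqrt_iterate B n o\<^sub>C\<^sub>L Z = Z o\<^sub>C\<^sub>L sqrt_iterate B n"
proof (induction n)
  case (Suc n)
  then have "B *\<^sub>V Z *\<^sub>V x = Z *\<^sub>V B *\<^sub>V x" "sqrt_iterate B n *\<^sub>V Z *\<^sub>V x = Z *\<^sub>V sqrt_iterate B n *\<^sub>V x" for x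
    by (metis comp_op_apply)+
  then show ?case
    by (intro cblinfun_eqI) (simp add: cblinfun_apply_linear scaleR_scaleC)
qed (auto intro: cblinfun_eqI)

lemma norm_sqrt_iterate_le:
  assumes "norm B \<le> 1" shows "norm (sqrt_iterate B n) \<le> sqrt_iterate_bound n"
proof (induction n)
  case (Suc n)
  have "norm (sqrt_iterate B n o\<^sub>C\<^sub>L sqrt_iterate B n) \<le> (sqrt_iterate_bound n)\<^sup>2"
    using norm_comp_op_le[of "sqrt_iterate B n" "sqrt_iterate B n"] mult_mono[OF Suc Suc]
      sqrt_iterate_bound_range by (simp add: power2_eq_square)
  then show ?case
    using norm_triangle_ineq[of B "sqrt_iterate B n o\<^sub>C\<^sub>L sqrt_iterate B n"] assms by simp
qed simp

text \<open>Consecutive iterates \<open>X\<close>, \<open>Y\<close> commute, so the next difference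
  is half of \<open>(Y - X) (Y + X)\<close>. The scalar sequence satisfies the same factorization
  exactly, hence its increments dominate by induction.\<close>

lemma norm_sqrt_iterate_diff:
  assumes "norm B \<le> 1"
  shows "norm (sqrt_iterate B (Suc n) - sqrt_iterate B n) \<le> sqrt_iterate_bound (Suc n) - sqrt_iterate_bound n"
proof (induction n)
  case 0
  then show ?case
    using assms by (simp add: bounded_bilinear.zero_left[OF bounded_bilinear_comp_op])
next
  case (Suc n)
  let ?X = "sqrt_iterate B n" and ?Y = "sqrt_iterate B (Suc n)"
  let ?x = "sqrt_iterate_bound n" and ?y = "sqrt_iterate_bound (Suc n)"
  have "?X o\<^sub>C\<^sub>L ?Y = ?Y o\<^sub>C\<^sub>L ?X"
    by (rule sqrt_iterate_commute) (rule sqrt_iterate_commute[OF refl, symmetric])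
  then have "?X *\<^sub>V ?Y *\<^sub>V x = ?Y *\<^sub>V ?X *\<^sub>V x" for x
    by (metis comp_op_apply)
  then have "sqrt_iterate B (Suc (Suc n)) - ?Y = (1/2) *\<^sub>R ((?Y - ?X) o\<^sub>C\<^sub>L (?Y + ?X))"
    unfolding sqrt_iterate.simps(2)[of B "Suc n"]
    by (subst (3) sqrt_iterate.simps(2), intro cblinfun_eqI)
      (simp add: cblinfun_apply_add[of ?X] cblinfun_apply_add[of ?Y] algebra_simps del: sqrt_iterate.simps)
  then have "norm (sqrt_iterate B (Suc (Suc n)) - ?Y) \<le> (norm (?Y - ?X) * norm (?Y + ?X)) / 2"
    using norm_comp_op_le[of "?Y - ?X" "?Y + ?X"] by (simp del: sqrt_iterate.simps)
  also have "\<dots> \<le> ((?y - ?x) * (?y + ?x)) / 2"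
    using norm_triangle_ineq[of ?Y ?X] norm_sqrt_iterate_le[OF assms, of n]
      norm_sqrt_iterate_le[OF assms, of "Suc n"] sqrt_iterate_bound_range[of n] sqrt_iterate_bound_mono[of n]
    by (intro divide_right_mono mult_mono Suc) (auto simp del: sqrt_iterate.simps sqrt_iterate_bound.simps)
  also have "\<dots> = sqrt_iterate_bound (Suc (Suc n)) - ?y"
  proof -
    have "(?y - ?x) * (?y + ?x) = ?y\<^sup>2 - ?x\<^sup>2"
      by (simp only: power2_eq_square) algebra
    moreover have "sqrt_iterate_bound (Suc (Suc n)) = (1 + ?y\<^sup>2) / 2" "?y = (1 + ?x\<^sup>2) / 2"
      by (rule sqrt_iterate_bound.simps)+
    ultimately show ?thesis
      by argo
  qed
  finally show ?case .
qed

text \<open>The scalar increments telescope to a convergent monotone sequence, so the operator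
  increments are summable. The limit equation says \<open>(I - X)^2 = I - B\<close>.\<close>

lemma sqrt_iterate_limit:
  fixes B :: "'a::chilbert_space \<Rightarrow>\<^sub>C\<^sub>L 'a"
  assumes "norm B \<le> 1"
  obtains X where "sqrt_iterate B \<longlonglongrightarrow> X" "norm X \<le> 1" "2 *\<^sub>R X = B + X o\<^sub>C\<^sub>L X"
proof -
  have "convergent sqrt_iterate_bound"
    by (rule Bseq_monoseq_convergent)
      (use sqrt_iterate_bound_range sqrt_iterate_bound_mono in
        \<open>auto intro!: BseqI'[of _ 1] mono_SucI1 simp del: sqrt_iterate_bound.simps\<close>)
  then obtain l where "sqrt_iterate_bound \<longlonglongrightarrow> l"
    by (auto simp: convergent_def)
  then have "summable (\<lambda>n. sqrt_iterate_bound (Suc n) - sqrt_iterate_bound n)"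
    by (rule telescope_summable)
  then have "summable (\<lambda>n. sqrt_iterate B (Suc n) - sqrt_iterate B n)"
    by (rule summable_comparison_test'[where N = 0]) (rule norm_sqrt_iterate_diff[OF assms])
  then have "convergent (\<lambda>n. \<Sum>k<n. sqrt_iterate B (Suc k) - sqrt_iterate B k)"
    by (simp only: summable_iff_convergent)
  then have "convergent (sqrt_iterate B)"
    by (simp only: sum_lessThan_telescope) simp
  then obtain X where X: "sqrt_iterate B \<longlonglongrightarrow> X"
    by (auto simp: convergent_def)
  have "norm X \<le> 1"
    by (rule Lim_bounded[OF tendsto_norm[OF X], of 0])
      (use order_trans[OF norm_sqrt_iterate_le[OF assms] sqrt_iterate_bound_range(2)] in simp)
  moreover have "X = (1/2) *\<^sub>R (B + X o\<^sub>C\<^sub>L X)"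
  proof (rule LIMSEQ_unique)
    show "(\<lambda>n. sqrt_iterate B (Suc n)) \<longlonglongrightarrow> X"
      using X by (simp only: filterlim_sequentially_Suc)
    show "(\<lambda>n. sqrt_iterate B (Suc n)) \<longlonglongrightarrow> (1/2) *\<^sub>R (B + X o\<^sub>C\<^sub>L X)"
      unfolding sqrt_iterate.simps by (intro tendsto_intros tendsto_comp_op X)
  qed
  then have "2 *\<^sub>R X = 2 *\<^sub>R ((1/2) *\<^sub>R (B + X o\<^sub>C\<^sub>L X))"
    by (rule arg_cong)
  ultimately show ?thesis
    using X that by simp
qed


lemma comp_op_eq_apply: "S o\<^sub>C\<^sub>L T = S' o\<^sub>C\<^sub>L T' \<Longrightarrow> S *\<^sub>V T *\<^sub>V x = S' *\<^sub>V T' *\<^sub>V x"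
  by (drule arg_cong[of _ _ "\<lambda>T. T *\<^sub>V x"]) simp

lemma csubspace_diff:
  assumes "csubspace M" "x \<in> M" "y \<in> M" shows "x - y \<in> M"
proof -
  have "(- 1) *\<^sub>C y \<in> M"
    using assms by (simp only: csubspace_def)
  then have "x + (- 1) *\<^sub>C y \<in> M"
    using assms by (simp only: csubspace_def)
  then show ?thesis
    by (simp add: scaleC_minus_left)
qed

lemma bounded_linear_adj: "bounded_linear (\<lambda>T :: 'a::chilbert_space \<Rightarrow>\<^sub>C\<^sub>L 'b::chilbert_space. T*)"
  by (rule bounded_linear_intro[where K = 1]) (simp_all add: scaleR_scaleC)

text \<open>Scale to \<open>B = I - T / |T|\<close>, a contraction by
  \<open>norm_apply_nonneg_op\<close>, and rescale \<open>I - X\<close> by the square root of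
  \<open>|T|\<close>. The commutation clause serves uniqueness: a second root commutes with
  \<open>T\<close>, hence with this one.\<close>

lemma nonneg_op_sqrt_exists:
  fixes T :: "'a::chilbert_space \<Rightarrow>\<^sub>C\<^sub>L 'a"
  assumes T: "nonneg_op T"
  shows "\<exists>S. nonneg_op S \<and> S o\<^sub>C\<^sub>L S = T \<and> (\<forall>Z. T o\<^sub>C\<^sub>L Z = Z o\<^sub>C\<^sub>L T \<longrightarrow> S o\<^sub>C\<^sub>L Z = Z o\<^sub>C\<^sub>L S)"
proof (cases "T = 0")
  case True
  have "nonneg_op (0 :: 'a \<Rightarrow>\<^sub>C\<^sub>L 'a)"
    by (simp add: nonneg_op_def)
  then show ?thesis
    by (intro exI[of _ 0]) (auto intro: cblinfun_eqI simp: True)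
next
  case False
  define r where "r = inverse (norm T)"
  have r: "0 < r" "r * norm T = 1"
    using False by (simp_all add: r_def)
  define B where "B = id_op - of_real r *\<^sub>C T"
  have Bsa: "B* = B"
    by (simp add: B_def nonneg_op_self_adjoint[OF T])
  have "norm B \<le> 1"
  proof (rule norm_cblinfun_bound)
    fix x
    have "r\<^sup>2 * (norm (T *\<^sub>V x))\<^sup>2 \<le> r\<^sup>2 * (norm T * Re (cinner (T *\<^sub>V x) x))"
      by (intro mult_left_mono norm_apply_nonneg_op T) simp
    also have "\<dots> = (r * norm T) * (r * Re (cinner (T *\<^sub>V x) x))"
      by (simp add: power2_eq_square)
    also have "\<dots> \<le> 2 * r * Re (cinner (T *\<^sub>V x) x)"
      using r Re_nonneg_op[OF T, of x] by simp
    finally have "r\<^sup>2 * (norm (T *\<^sub>V x))\<^sup>2 \<le> 2 * r * Re (cinner (T *\<^sub>V x) x)" .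
    moreover have "Re (cinner x (T *\<^sub>V x)) = Re (cinner (T *\<^sub>V x) x)"
      by (subst cinner_commute) simp
    ultimately have "(norm (B *\<^sub>V x))\<^sup>2 \<le> (norm x)\<^sup>2"
      unfolding norm_sq_cinner
      by (simp add: B_def cinner_linear power2_eq_square algebra_simps)
    then show "norm (B *\<^sub>V x) \<le> 1 * norm x"
      by (simp add: power2_le_iff_abs_le)
  qed simp
  then obtain X where X: "sqrt_iterate B \<longlonglongrightarrow> X" "norm X \<le> 1" "2 *\<^sub>R X = B + X o\<^sub>C\<^sub>L X"
    by (rule sqrt_iterate_limit)
  have "(sqrt_iterate B n)* = sqrt_iterate B n" for n
    by (induction n) (simp_all add: Bsa scaleR_scaleC adj_eqI)
  then have Xsa: "X* = X"
    using LIMSEQ_unique[OF bounded_linear.tendsto[OF bounded_linear_adj X(1)]] X(1) by simp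
  define c where "c = sqrt (norm T)"
  have c: "0 \<le> c" "c * c = norm T"
    by (simp_all add: c_def)
  define S where "S = of_real c *\<^sub>C (id_op - X)"
  have "X *\<^sub>V X *\<^sub>V x = 2 *\<^sub>R (X *\<^sub>V x) - B *\<^sub>V x" for x
    using arg_cong[OF X(3), of "\<lambda>T. T *\<^sub>V x"] by simp
  then have "(id_op - X) *\<^sub>V (id_op - X) *\<^sub>V x = of_real r *\<^sub>C (T *\<^sub>V x)" for x
    by (simp add: cblinfun_apply_linear B_def scaleR_2)
  then have "S *\<^sub>V S *\<^sub>V x = of_real (c * c * r) *\<^sub>C (T *\<^sub>V x)" for x
    unfolding S_def scaleC_cblinfun_apply cblinfun_apply_scaleC by (simp add: mult.assoc)
  then have SS: "S o\<^sub>C\<^sub>L S = T"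
    using c r(2) by (intro cblinfun_eqI) (simp add: mult.commute)
  have "nonneg_op (id_op - X)"
  proof (rule nonneg_opI)
    fix x
    have "Re (cinner (X *\<^sub>V x) x) \<le> norm (X *\<^sub>V x) * norm x"
      by (rule order_trans[OF complex_Re_le_cmod norm_cinner_le])
    also have "\<dots> \<le> (norm x)\<^sup>2"
      using mult_right_mono[OF norm_cblinfun_le[OF X(2), of x], of "norm x"]
      by (simp add: power2_eq_square)
    finally show "0 \<le> Re (cinner ((id_op - X) *\<^sub>V x) x)"
      by (simp add: cinner_linear cinner_same)
  qed (simp add: Xsa)
  then have pos: "nonneg_op S"
    using c(1) by (simp add: nonneg_op_def S_def complex_nonneg_Reals_iff)
  have comm: "S o\<^sub>C\<^sub>L Z = Z o\<^sub>C\<^sub>L S" if Z: "T o\<^sub>C\<^sub>L Z = Z o\<^sub>C\<^sub>L T" for Z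
  proof -
    have "T *\<^sub>V Z *\<^sub>V x = Z *\<^sub>V T *\<^sub>V x" for x
      by (rule comp_op_eq_apply[OF Z])
    then have "B o\<^sub>C\<^sub>L Z = Z o\<^sub>C\<^sub>L B"
      by (intro cblinfun_eqI) (simp add: B_def cblinfun_apply_linear)
    then have "X o\<^sub>C\<^sub>L Z = Z o\<^sub>C\<^sub>L X"
      using tendsto_comp_op[OF X(1) tendsto_const[of Z]] tendsto_comp_op[OF tendsto_const[of Z] X(1)]
      by (simp add: sqrt_iterate_commute LIMSEQ_unique)
    then have "X *\<^sub>V Z *\<^sub>V x = Z *\<^sub>V X *\<^sub>V x" for x
      by (rule comp_op_eq_apply)
    then show ?thesis
      by (intro cblinfun_eqI) (simp add: S_def cblinfun_apply_linear)
  qed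
  show ?thesis
    by (intro exI[of _ S] conjI allI impI pos SS comm)
qed

text \<open>As \<open>sqrt_op\<close> is a definite description, uniqueness has to be proved. Two
  commuting roots satisfy \<open>D (S + S') = 0\<close> for \<open>D = S - S'\<close>, so the
  non-negative forms of \<open>S\<close> and \<open>S'\<close> at \<open>D x\<close> add up to zero.
  Then \<open>S D x = 0\<close>, and \<open>S\<close> is injective because \<open>T\<close>
  is.\<close>

lemma sqrt_op_strictly_positive:
  fixes T :: "'a::chilbert_space \<Rightarrow>\<^sub>C\<^sub>L 'a"
  assumes T: "strictly_positive_op T"
  shows "strictly_positive_op (sqrt_op T)" "sqrt_op T o\<^sub>C\<^sub>L sqrt_op T = T"
proof -
  have pos: "nonneg_op T" and inv: "invertible_op T"
    using T by (auto simp: strictly_positive_op_def)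
  obtain S where S_all: "nonneg_op S \<and> S o\<^sub>C\<^sub>L S = T \<and> (\<forall>Z. T o\<^sub>C\<^sub>L Z = Z o\<^sub>C\<^sub>L T \<longrightarrow> S o\<^sub>C\<^sub>L Z = Z o\<^sub>C\<^sub>L S)"
    using nonneg_op_sqrt_exists[OF pos] by (rule exE)
  note S = conjunct1[OF S_all] conjunct1[OF conjunct2[OF S_all]] conjunct2[OF conjunct2[OF S_all]]
  have SS: "T *\<^sub>V x = S *\<^sub>V S *\<^sub>V x" for x
    using arg_cong[OF S(2), of "\<lambda>T. T *\<^sub>V x"] by simp
  have inj: "x = 0" if "S *\<^sub>V x = 0" for x
    using that inverse_op_apply(1)[OF inv, of x] by (simp add: SS)
  have unique: "S' = S" if S': "nonneg_op S'" "S' o\<^sub>C\<^sub>L S' = T" for S'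
  proof (rule cblinfun_eqI)
    fix x
    define D where "D = S - S'"
    have Dsa: "D* = D"
      by (simp add: D_def nonneg_op_self_adjoint S(1) S'(1))
    have "S o\<^sub>C\<^sub>L S' = S' o\<^sub>C\<^sub>L S"
      by (rule S(3)[rule_format]) (simp add: comp_op_assoc S'(2)[symmetric])
    then have "S *\<^sub>V S' *\<^sub>V y = S' *\<^sub>V S *\<^sub>V y" for y
      by (rule comp_op_eq_apply)
    moreover have "S' *\<^sub>V S' *\<^sub>V y = S *\<^sub>V S *\<^sub>V y" for y
      by (rule comp_op_eq_apply) (simp add: S(2) S'(2))
    ultimately have D0: "D *\<^sub>V (S *\<^sub>V y + S' *\<^sub>V y) = 0" for y
      by (simp add: D_def cblinfun_apply_add)
    have "cinner (S *\<^sub>V D *\<^sub>V x) (D *\<^sub>V x) + cinner (S' *\<^sub>V D *\<^sub>V x) (D *\<^sub>V x) = 0"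
      using cinner_adj_left[of D "S *\<^sub>V D *\<^sub>V x + S' *\<^sub>V D *\<^sub>V x" x] D0[of "D *\<^sub>V x"]
      by (simp add: Dsa cinner_add_left)
    from arg_cong[OF this, of Re]
    have "Re (cinner (S *\<^sub>V D *\<^sub>V x) (D *\<^sub>V x)) + Re (cinner (S' *\<^sub>V D *\<^sub>V x) (D *\<^sub>V x)) = 0"
      by simp
    then have "Re (cinner (S *\<^sub>V D *\<^sub>V x) (D *\<^sub>V x)) = 0"
      using Re_nonneg_op[OF S(1), of "D *\<^sub>V x"] Re_nonneg_op[OF S'(1), of "D *\<^sub>V x"] by linarith
    then have "S *\<^sub>V D *\<^sub>V x = 0"
      using norm_apply_nonneg_op[OF S(1), of "D *\<^sub>V x"] by simp
    then have "D *\<^sub>V x = 0"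
      by (rule inj)
    then show "S' *\<^sub>V x = S *\<^sub>V x"
      by (simp add: D_def)
  qed
  have sqrt: "sqrt_op T = S"
    unfolding sqrt_op_def
  proof (rule the_equality)
    show "nonneg_op S \<and> S o\<^sub>C\<^sub>L S = T"
      by (rule conjI[OF S(1,2)])
    show "S' = S" if "nonneg_op S' \<and> S' o\<^sub>C\<^sub>L S' = T" for S'
      by (rule unique) (use that in simp_all)
  qed
  \<comment> \<open>The inverse of \<open>S\<close> is \<open>S T^-1\<close>. It is a right inverse
    because \<open>S S = T\<close>; that it is a left inverse follows by cancelling the injective
    \<open>S\<close>.\<close>
  have "S *\<^sub>V inverse_op T *\<^sub>V S *\<^sub>V x = x" for x
  proof -
    have "S *\<^sub>V (S *\<^sub>V inverse_op T *\<^sub>V S *\<^sub>V x - x) = 0"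
      using inverse_op_apply(2)[OF inv, of "S *\<^sub>V x"] by (simp add: SS cblinfun_apply_linear)
    from inj[OF this] show ?thesis
      by simp
  qed
  moreover have "S *\<^sub>V S *\<^sub>V inverse_op T *\<^sub>V x = x" for x
    using inverse_op_apply(2)[OF inv, of x] by (simp add: SS)
  ultimately have "invertible_op S"
    by (intro invertible_opI[of "S o\<^sub>C\<^sub>L inverse_op T"]) simp_all
  then show "strictly_positive_op (sqrt_op T)" "sqrt_op T o\<^sub>C\<^sub>L sqrt_op T = T"
    using S(1,2) by (simp_all add: sqrt strictly_positive_op_def)
qed

lemma strictly_positive_inverse_op:
  fixes T :: "'a::chilbert_space \<Rightarrow>\<^sub>C\<^sub>L 'a"
  assumes "strictly_positive_op T" shows "strictly_positive_op (inverse_op T)"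
proof -
  have T: "nonneg_op T" "invertible_op T"
    using assms by (auto simp: strictly_positive_op_def)
  have "cinner (inverse_op T *\<^sub>V x) x = cinner (T *\<^sub>V inverse_op T *\<^sub>V x) (inverse_op T *\<^sub>V x)" for x
    using cinner_adj[of T "inverse_op T *\<^sub>V x" "inverse_op T *\<^sub>V x"] T
    by (simp add: nonneg_op_self_adjoint)
  then have "nonneg_op (inverse_op T)"
    using T(1) by (simp add: nonneg_op_def)
  then show ?thesis
    by (simp add: strictly_positive_op_def invertible_inverse_op T)
qed

lemma inv_sqrt_op:
  fixes T :: "'a::chilbert_space \<Rightarrow>\<^sub>C\<^sub>L 'a"
  assumes T: "strictly_positive_op T"
  shows "strictly_positive_op (inv_sqrt_op T)"
    and "inv_sqrt_op T *\<^sub>V sqrt_op T *\<^sub>V x = x" "sqrt_op T *\<^sub>V inv_sqrt_op T *\<^sub>V x = x"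
    and "sqrt_op T *\<^sub>V sqrt_op T *\<^sub>V x = T *\<^sub>V x"
    and "(sqrt_op T)* = sqrt_op T" "(inv_sqrt_op T)* = inv_sqrt_op T"
proof -
  note s = sqrt_op_strictly_positive[OF T]
  show p: "strictly_positive_op (inv_sqrt_op T)"
    unfolding inv_sqrt_op_def by (rule strictly_positive_inverse_op[OF s(1)])
  show "inv_sqrt_op T *\<^sub>V sqrt_op T *\<^sub>V x = x" "sqrt_op T *\<^sub>V inv_sqrt_op T *\<^sub>V x = x"
    using s(1) by (simp_all add: inv_sqrt_op_def strictly_positive_op_def)
  show "sqrt_op T *\<^sub>V sqrt_op T *\<^sub>V x = T *\<^sub>V x"
    using arg_cong[OF s(2), of "\<lambda>T. T *\<^sub>V x"] by simp
  show "(sqrt_op T)* = sqrt_op T" "(inv_sqrt_op T)* = inv_sqrt_op T"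
    using s(1) p by (simp_all add: strictly_positive_op_def nonneg_op_self_adjoint)
qed


subsection \<open>Projections and factorization\<close>

lemma proj_properties:
  fixes M :: "'a::chilbert_space set"
  assumes M: "closed_csubspace M"
  shows "proj M *\<^sub>V x \<in> M" "x - proj M *\<^sub>V x \<in> orth_complement M"
proof -
  have "\<exists>P :: 'a \<Rightarrow>\<^sub>C\<^sub>L 'a. (\<forall>x. P *\<^sub>V x \<in> closure M) \<and> (\<forall>m\<in>M. \<forall>x. cinner m x = cinner m (P *\<^sub>V x)) \<and> norm P \<le> 1"
    by (rule bounded_form_operator)
      (use M in \<open>simp_all add: closed_csubspace_def cinner_linear norm_cinner_le\<close>)
  then obtain P :: "'a \<Rightarrow>\<^sub>C\<^sub>L 'a" where P_all: "(\<forall>x. P *\<^sub>V x \<in> closure M)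
      \<and> (\<forall>m\<in>M. \<forall>x. cinner m x = cinner m (P *\<^sub>V x)) \<and> norm P \<le> 1"
    by (rule exE)
  have "closure M = M"
    using M by (simp add: closed_csubspace_def closure_closed)
  with conjunct1[OF P_all] have P: "P *\<^sub>V x \<in> M" for x
    by simp
  have orth': "cinner m (x - P *\<^sub>V x) = 0" if "m \<in> M" for m x
    using conjunct1[OF conjunct2[OF P_all], THEN bspec, OF that, THEN spec, of x]
    unfolding cinner_diff_right by (simp only: diff_self)
  have orth: "x - P *\<^sub>V x \<in> orth_complement M" for x
    unfolding orth_complement_def using orth' by (simp add: cinner_commute[of "x - P *\<^sub>V x"])
  have "proj M = P"
    unfolding proj_def
  proof (rule the_equality)
    show "\<forall>x. P *\<^sub>V x \<in> M \<and> x - P *\<^sub>V x \<in> orth_complement M"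
      by (simp add: P orth)
    fix P'
    assume P': "\<forall>x. P' *\<^sub>V x \<in> M \<and> x - P' *\<^sub>V x \<in> orth_complement M"
    show "P' = P"
    proof (rule cblinfun_eqI)
      fix x
      have "P' *\<^sub>V x - P *\<^sub>V x = 0"
      proof (rule orthogonal_closure_zero[of _ M])
        have "P' *\<^sub>V x - P *\<^sub>V x \<in> M"
          using P' P M by (simp add: closed_csubspace_def csubspace_diff)
        then show "P' *\<^sub>V x - P *\<^sub>V x \<in> closure M"
          using closure_subset by blast
        fix m
        assume m: "m \<in> M"
        then have "cinner (x - P' *\<^sub>V x) m = 0"
          using P' by (auto simp: orth_complement_def)
        then have "cinner m (x - P' *\<^sub>V x) = 0"
          by (metis cinner_commute complex_cnj_zero)
        then show "cinner m (P' *\<^sub>V x - P *\<^sub>V x) = 0"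
          using orth'[OF m, of x] by (simp add: cinner_linear)
      qed
      then show "P' *\<^sub>V x = P *\<^sub>V x"
        by simp
    qed
  qed
  then show "proj M *\<^sub>V x \<in> M" "x - proj M *\<^sub>V x \<in> orth_complement M"
    by (simp_all add: P orth)
qed

lemma proj_apply_eq:
  fixes M :: "'a::chilbert_space set"
  assumes M: "closed_csubspace M" and y: "y \<in> M" and xy: "x - y \<in> orth_complement M"
  shows "proj M *\<^sub>V x = y"
proof -
  have "proj M *\<^sub>V x - y \<in> M"
    using proj_properties(1)[OF M] y M by (simp add: closed_csubspace_def csubspace_diff)
  then have "cinner (x - y) (proj M *\<^sub>V x - y) = 0" "cinner (x - proj M *\<^sub>V x) (proj M *\<^sub>V x - y) = 0"
    using xy proj_properties(2)[OF M, of x] by (auto simp: orth_complement_def)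
  then have "cinner (proj M *\<^sub>V x - y) (proj M *\<^sub>V x - y) = 0"
    using cinner_diff_left[of "x - y" "x - proj M *\<^sub>V x" "proj M *\<^sub>V x - y"] by simp
  then show ?thesis
    by (simp add: cinner_same)
qed

lemma proj_idem: 
  fixes M :: "'a::chilbert_space set"
  assumes "closed_csubspace M" "x \<in> M"
  shows "proj M *\<^sub>V x = x"
  by (rule proj_apply_eq) (use assms in \<open>simp_all add: orth_complement_def\<close>)

lemma proj_self_adjoint [simp]:
  fixes M :: "'a::chilbert_space set"
  assumes "closed_csubspace M"
  shows "(proj M)* = proj M"
proof (rule adj_eqI)
  fix x y
  have *: "cinner (z - proj M *\<^sub>V z) (proj M *\<^sub>V w) = 0" for z w
    using proj_properties[OF assms] by (auto simp: orth_complement_def)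
  then have "cinner (proj M *\<^sub>V w) (z - proj M *\<^sub>V z) = 0" for z w
    by (metis cinner_commute complex_cnj_zero)
  then show "cinner (proj M *\<^sub>V x) y = cinner x (proj M *\<^sub>V y)"
    using * by (simp add: cinner_linear)
qed

text \<open>Sending \<open>P f\<close> to \<open>R f\<close> is a contraction on the range of
  \<open>P\<close>, and \<open>V\<close> is its adjoint. The weak form of the conclusion avoids
  extending that map to the closure of the range.\<close>

lemma factorization_contraction:
  fixes P :: "'z::complex_normed_vector \<Rightarrow>\<^sub>C\<^sub>L 'a::chilbert_space" and R :: "'z \<Rightarrow>\<^sub>C\<^sub>L 'b::chilbert_space"
  assumes le: "\<And>f. norm (R *\<^sub>V f) \<le> norm (P *\<^sub>V f)"
  shows "\<exists>V :: 'b \<Rightarrow>\<^sub>C\<^sub>L 'a. norm V \<le> 1 \<and> (\<forall>f k. cinner (R *\<^sub>V f) k = cinner (P *\<^sub>V f) (V *\<^sub>V k))"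
proof -
  \<comment> \<open>Any preimage will do: two of them differ by a vector in the kernel of
    \<open>P\<close>, which \<open>le\<close> forces into the kernel of \<open>R\<close>.\<close>
  define s where "s m = R *\<^sub>V (SOME f. P *\<^sub>V f = m)" for m
  have s: "s (P *\<^sub>V f) = R *\<^sub>V f" for f
  proof -
    have "P *\<^sub>V (SOME g. P *\<^sub>V g = P *\<^sub>V f) = P *\<^sub>V f"
      by (rule someI) (rule refl)
    then have "norm (R *\<^sub>V ((SOME g. P *\<^sub>V g = P *\<^sub>V f) - f)) \<le> 0"
      using le[of "(SOME g. P *\<^sub>V g = P *\<^sub>V f) - f"] by (simp add: cblinfun_apply_linear)
    then show ?thesis
      by (simp add: s_def cblinfun_apply_linear)
  qed
  have s_add: "s (P *\<^sub>V f + P *\<^sub>V g) = R *\<^sub>V f + R *\<^sub>V g" for f g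
    using s[of "f + g"] by (simp add: cblinfun_apply_linear)
  have s_scale: "s (c *\<^sub>C (P *\<^sub>V f)) = c *\<^sub>C (R *\<^sub>V f)" for c f
    using s[of "c *\<^sub>C f"] by simp
  have "csubspace (range (cblinfun_apply P))"
    unfolding csubspace_def
  proof (intro conjI ballI allI)
    show "0 \<in> range (cblinfun_apply P)"
      using rangeI[of "cblinfun_apply P" 0] by simp
    show "x + y \<in> range (cblinfun_apply P)"
      if "x \<in> range (cblinfun_apply P)" "y \<in> range (cblinfun_apply P)" for x y
      using that by (auto simp flip: cblinfun_apply_add)
    show "c *\<^sub>C x \<in> range (cblinfun_apply P)" if "x \<in> range (cblinfun_apply P)" for c x
      using that by (auto simp flip: cblinfun_apply_scaleC)
  qed
  moreover have "cmod (cinner (s m) k) \<le> 1 * norm m * norm k" if m: "m \<in> range (cblinfun_apply P)" for m k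
  proof -
    obtain f where f: "m = P *\<^sub>V f"
      using m by blast
    show ?thesis
      using norm_cinner_le[of "R *\<^sub>V f" k] mult_right_mono[OF le[of f], of "norm k"]
      by (simp add: f s)
  qed
  ultimately have "\<exists>V :: 'b \<Rightarrow>\<^sub>C\<^sub>L 'a. (\<forall>k. V *\<^sub>V k \<in> closure (range (cblinfun_apply P)))
      \<and> (\<forall>m\<in>range (cblinfun_apply P). \<forall>k. cinner (s m) k = cinner m (V *\<^sub>V k)) \<and> norm V \<le> 1"
    by (intro bounded_form_operator) (auto simp: s s_add s_scale cinner_linear)
  then obtain V :: "'b \<Rightarrow>\<^sub>C\<^sub>L 'a" where V1: "norm V \<le> 1"
    and V: "\<forall>m\<in>range (cblinfun_apply P). \<forall>k. cinner (s m) k = cinner m (V *\<^sub>V k)"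
    by blast
  have "cinner (R *\<^sub>V f) k = cinner (P *\<^sub>V f) (V *\<^sub>V k)" for f k
    using bspec[OF V rangeI[of "cblinfun_apply P" f]] unfolding s by (rule spec)
  with V1 show ?thesis
    by (intro exI[of _ V] conjI allI)
qed

section \<open>Direct sums of Hilbert spaces\<close>

instantiation prod :: (complex_inner, complex_inner) complex_inner
begin

definition scaleC_prod :: "complex \<Rightarrow> 'a \<times> 'b \<Rightarrow> 'a \<times> 'b" where
  "scaleC_prod c p = (c *\<^sub>C fst p, c *\<^sub>C snd p)"

definition cinner_prod :: "'a \<times> 'b \<Rightarrow> 'a \<times> 'b \<Rightarrow> complex" where
  "cinner_prod p q = cinner (fst p) (fst q) + cinner (snd p) (snd q)"

instance
proof
  fix x y z :: "'a \<times> 'b" and a b :: complex and r :: real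
  show "a *\<^sub>C (x + y) = a *\<^sub>C x + a *\<^sub>C y" "(a + b) *\<^sub>C x = a *\<^sub>C x + b *\<^sub>C x"
    "a *\<^sub>C b *\<^sub>C x = (a * b) *\<^sub>C x"
    by (simp_all add: scaleC_prod_def scaleC_add_left scaleC_add_right)
  show "r *\<^sub>R x = complex_of_real r *\<^sub>C x"
    by (simp add: scaleC_prod_def scaleR_prod_def scaleR_scaleC)
  show "cinner x y = cnj (cinner y x)"
    unfolding cinner_prod_def complex_cnj_add by (simp flip: cinner_commute)
  show "cinner (x + y) z = cinner x z + cinner y z"
    by (simp add: cinner_prod_def cinner_add_left)
  show "cinner (a *\<^sub>C x) y = a * cinner x y"
    by (simp add: cinner_prod_def scaleC_prod_def distrib_left)
  show "Re (cinner x y) = inner x y"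
    by (simp add: cinner_prod_def inner_prod_def Re_cinner)
qed

end

instance prod :: (chilbert_space, chilbert_space) chilbert_space ..

lemma scaleC_Pair [simp]: "c *\<^sub>C (x, y) = (c *\<^sub>C x, c *\<^sub>C y)"
  by (simp add: scaleC_prod_def)

lemma cinner_Pair [simp]: "cinner (x, y) (x', y') = cinner x x' + cinner y y'"
  by (simp add: cinner_prod_def)

definition pair_op :: "'a::complex_normed_vector \<Rightarrow>\<^sub>C\<^sub>L 'b::complex_inner \<Rightarrow> 'a \<Rightarrow>\<^sub>C\<^sub>L 'c::complex_inner \<Rightarrow> 'a \<Rightarrow>\<^sub>C\<^sub>L ('b \<times> 'c)" where
  "pair_op S T = CBlinfun (\<lambda>x. (S *\<^sub>V x, T *\<^sub>V x))"

definition fst_op :: "('a::complex_inner \<times> 'b::complex_inner) \<Rightarrow>\<^sub>C\<^sub>L 'a" where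
  "fst_op = CBlinfun fst"

definition snd_op :: "('a::complex_inner \<times> 'b::complex_inner) \<Rightarrow>\<^sub>C\<^sub>L 'b" where
  "snd_op = CBlinfun snd"

lemma pair_op_apply [simp]: "pair_op S T *\<^sub>V x = (S *\<^sub>V x, T *\<^sub>V x)"
  unfolding pair_op_def
  by (rule CBlinfun_apply) (simp_all add: bounded_linear_Pair bounded_linear_cblinfun_apply)

lemma fst_op_apply [simp]: "fst_op *\<^sub>V p = fst p" and snd_op_apply [simp]: "snd_op *\<^sub>V p = snd p"
  unfolding fst_op_def snd_op_def
  by (simp_all add: CBlinfun_apply bounded_linear_fst bounded_linear_snd scaleC_prod_def)


section \<open>Sequence spaces and point evaluations\<close>

lemma ell2_nth_simps [simp]:
  "ell2_nth (0 :: 'a::complex_inner ell2) n = 0"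
  "ell2_nth (x + y) n = ell2_nth x n + ell2_nth y n"
  "ell2_nth (x - y) n = ell2_nth x n - ell2_nth y n"
  "ell2_nth (c *\<^sub>C x) n = c *\<^sub>C ell2_nth x n" for x y :: "'a::complex_inner ell2"
  by (simp_all add: zero_ell2.rep_eq plus_ell2.rep_eq minus_ell2.rep_eq scaleC_ell2.rep_eq)

declare embed0_nth [simp]

lemma shift_nth_simps [simp]: "ell2_nth (shift *\<^sub>V x) 0 = 0" "ell2_nth (shift *\<^sub>V x) (Suc n) = ell2_nth x n"
  by (simp_all add: shift_nth)

text \<open>Shifted copies of \<open>embed0 v\<close> read off coordinates under the inner product;
  the adjoints of \<open>embed0\<close> and \<open>shift\<close> are computed from this.\<close>

lemma cinner_shift_power:
  "cinner (((\<lambda>x. shift *\<^sub>V x) ^^ n) (embed0 *\<^sub>V v)) y = cinner v (ell2_nth y n)"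
  for v :: "'a::chilbert_space"
proof -
  have nth: "ell2_nth (((\<lambda>x. shift *\<^sub>V x) ^^ n) (embed0 *\<^sub>V v)) k = (if k = n then v else 0)" for n k
  proof (induction n arbitrary: k)
    case (Suc n)
    then show ?case
      by (cases k) simp_all
  qed simp
  have "(\<lambda>k. cinner (if k = n then v else 0) (ell2_nth y k)) sums cinner v (ell2_nth y n)"
    using sums_single[of n "\<lambda>k. cinner v (ell2_nth y k)"]
    by (rule sums_cong[THEN iffD1, rotated]) simp
  then show ?thesis
    unfolding cinner_ell2_def nth by (rule sums_unique[symmetric])
qed

lemma adj_embed0 [simp]: "embed0* *\<^sub>V x = ell2_nth x 0" for x :: "'a::chilbert_space ell2"
  by (rule cinner_eqI_right) (simp flip: cinner_adj add: cinner_shift_power[of 0, simplified])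

lemma adj_shift_nth [simp]: "ell2_nth (shift* *\<^sub>V x) n = ell2_nth x (Suc n)" for x :: "'a::chilbert_space ell2"
proof (rule cinner_eqI_right)
  fix v
  have "cinner v (ell2_nth (shift* *\<^sub>V x) n) = cinner (shift *\<^sub>V ((\<lambda>x. shift *\<^sub>V x) ^^ n) (embed0 *\<^sub>V v)) x"
    unfolding cinner_adj[of shift] by (rule cinner_shift_power[symmetric])
  also have "\<dots> = cinner v (ell2_nth x (Suc n))"
    using cinner_shift_power[of "Suc n" v x] by simp
  finally show "cinner v (ell2_nth (shift* *\<^sub>V x) n) = cinner v (ell2_nth x (Suc n))" .
qed

lemma adj_shift_shift [simp]: "shift* *\<^sub>V shift *\<^sub>V x = x"
  and adj_shift_embed0 [simp]: "shift* *\<^sub>V embed0 *\<^sub>V v = 0"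
  by (rule ell2_eqI; simp)+

lemma ell2_decompose: "embed0 *\<^sub>V ell2_nth x 0 + shift *\<^sub>V shift* *\<^sub>V x = x"
proof (rule ell2_eqI)
  show "ell2_nth (embed0 *\<^sub>V ell2_nth x 0 + shift *\<^sub>V shift* *\<^sub>V x) n = ell2_nth x n" for n
    by (cases n) simp_all
qed

lemma norm_adj_shift_le: "norm (shift* *\<^sub>V x) \<le> norm x"
proof -
  have "norm (shift *\<^sub>V x) = norm x" for x :: "'a ell2"
  proof -
    have "(norm (shift *\<^sub>V x))\<^sup>2 = (norm x)\<^sup>2"
      unfolding norm_sq_cinner cinner_adj by simp
    then show ?thesis
      by simp
  qed
  then have "norm (shift :: 'a ell2 \<Rightarrow>\<^sub>C\<^sub>L 'a ell2) \<le> 1"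
    by (intro norm_cblinfun_bound) simp_all
  then show ?thesis
    using norm_cblinfun_le[of "shift*" 1 x] by simp
qed

text \<open>Evaluation at \<open>z\<close> of the power series with coefficients
  \<open>ell2_nth x n\<close>. The adjoint sends \<open>y\<close> to the Szego kernel function,
  whose n-th coefficient is \<open>cnj z ^ n\<close> times \<open>y\<close>.\<close>

definition point_eval :: "complex \<Rightarrow> 'a::chilbert_space ell2 \<Rightarrow>\<^sub>C\<^sub>L 'a" where
  "point_eval z = embed0* o\<^sub>C\<^sub>L inverse_op (id_op - z *\<^sub>C shift*)"

lemma invertible_resolvent:
  assumes "cmod z < 1" shows "invertible_op (id_op - z *\<^sub>C shift*)"
proof (rule invertible_id_minus)
  have "norm (z *\<^sub>C (shift* :: 'a ell2 \<Rightarrow>\<^sub>C\<^sub>L 'a ell2)) \<le> cmod z"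
    by (rule norm_cblinfun_bound) (simp_all add: norm_scaleC mult_left_mono norm_adj_shift_le)
  with assms show "norm (z *\<^sub>C (shift* :: 'a ell2 \<Rightarrow>\<^sub>C\<^sub>L 'a ell2)) < 1"
    by simp
qed

lemma point_eval_rec:
  assumes "cmod z < 1"
  shows "point_eval z *\<^sub>V x = ell2_nth x 0 + z *\<^sub>C (point_eval z *\<^sub>V shift* *\<^sub>V x)"
proof -
  have "x - z *\<^sub>C (shift* *\<^sub>V x) = (id_op - z *\<^sub>C shift*) *\<^sub>V x"
    by simp
  then have "inverse_op (id_op - z *\<^sub>C shift*) *\<^sub>V (x - z *\<^sub>C (shift* *\<^sub>V x)) = x"
    by (simp only: inverse_op_apply invertible_resolvent[OF assms])
  then have "inverse_op (id_op - z *\<^sub>C shift*) *\<^sub>V x = x + z *\<^sub>C (inverse_op (id_op - z *\<^sub>C shift*) *\<^sub>V shift* *\<^sub>V x)"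
    by (simp add: cblinfun_apply_diff algebra_simps)
  then show ?thesis
    unfolding point_eval_def comp_op_apply by (simp add: cblinfun_apply_add)
qed

lemma point_eval_zero [simp]: "point_eval 0 *\<^sub>V x = ell2_nth x 0"
  by (subst point_eval_rec) simp_all

lemma point_eval_embed0 [simp]: "cmod z < 1 \<Longrightarrow> point_eval z *\<^sub>V embed0 *\<^sub>V v = v"
  by (subst point_eval_rec) simp_all

lemma point_eval_shift: "cmod z < 1 \<Longrightarrow> point_eval z *\<^sub>V shift *\<^sub>V x = z *\<^sub>C (point_eval z *\<^sub>V x)"
  by (subst point_eval_rec) simp_all

text \<open>Kernel functions are eigenvectors of the backward shift. Paired between the kernels at
  \<open>w\<close> and \<open>z\<close>, a displacement \<open>N - S N S*\<close> therefore becomes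
  multiplication by \<open>1 - z * cnj w\<close>.\<close>

lemma adj_shift_kernel:
  assumes "cmod z < 1" shows "shift* *\<^sub>V (point_eval z)* *\<^sub>V y = cnj z *\<^sub>C ((point_eval z)* *\<^sub>V y)"
  by (rule cinner_eqI_right) (simp flip: cinner_adj add: point_eval_shift[OF assms])

lemma kernel_nth_0: "cmod z < 1 \<Longrightarrow> ell2_nth ((point_eval z)* *\<^sub>V y) 0 = y"
  by (rule cinner_eqI_right) (simp flip: cinner_adj adj_embed0)

lemma point_eval_kernel:
  assumes "cmod z < 1" "cmod w < 1"
  shows "(1 - z * cnj w) *\<^sub>C (point_eval z *\<^sub>V (point_eval w)* *\<^sub>V y) = y"
proof -
  have "point_eval z *\<^sub>V (point_eval w)* *\<^sub>V y = y + (z * cnj w) *\<^sub>C (point_eval z *\<^sub>V (point_eval w)* *\<^sub>V y)"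
    by (subst point_eval_rec[OF assms(1)]) (simp add: adj_shift_kernel kernel_nth_0 assms(2))
  then show ?thesis
    by (simp add: scaleC_diff_left algebra_simps)
qed

lemma cinner_kernels:
  fixes y y' :: "'a::chilbert_space"
  assumes "cmod w < 1" "cmod z < 1"
  shows "(1 - z * cnj w) * cinner ((point_eval w)* *\<^sub>V y) ((point_eval z)* *\<^sub>V y') = cinner y y'"
proof -
  have "cinner y y' = cinner ((1 - z * cnj w) *\<^sub>C (point_eval z *\<^sub>V (point_eval w)* *\<^sub>V y)) y'"
    by (simp only: point_eval_kernel[OF assms(2,1)])
  then show ?thesis
    by (simp add: cinner_adj)
qed

lemma norm_kernel:
  assumes z: "cmod z < 1"
  shows "(1 - (cmod z)\<^sup>2) * (norm ((point_eval z)* *\<^sub>V b))\<^sup>2 = (norm b)\<^sup>2"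
proof -
  have "of_real (1 - (cmod z)\<^sup>2) = 1 - z * cnj z"
    by (simp flip: complex_norm_square)
  then have "of_real (1 - (cmod z)\<^sup>2) * cinner (point_eval z *\<^sub>V (point_eval z)* *\<^sub>V b) b = cinner b b"
    by (simp only: cinner_scaleC_left[symmetric] point_eval_kernel[OF z z])
  from arg_cong[OF this, of Re] show ?thesis
    unfolding norm_sq_cinner by (simp add: cinner_adj)
qed

lemma point_eval_sums:
  assumes z: "cmod z < 1"
  shows "(\<lambda>n. z ^ n *\<^sub>C ell2_nth x n) sums (point_eval z *\<^sub>V x)"
proof -
  define s where "s = ((\<lambda>x. shift* *\<^sub>V x) :: 'a ell2 \<Rightarrow> 'a ell2)"
  have s_nth: "ell2_nth ((s ^^ n) x) k = ell2_nth x (n + k)" for n k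
    by (induction n arbitrary: k) (simp_all add: s_def)
  have s_norm: "norm ((s ^^ n) x) \<le> norm x" for n
    by (induction n) (use norm_adj_shift_le order_trans in \<open>auto simp: s_def\<close>)
  \<comment> \<open>\<open>point_eval_rec\<close> unfolded n times; the remainder is
    \<open>z ^ n\<close> times a bounded quantity because the backward shift is a
    contraction.\<close>
  have partial: "point_eval z *\<^sub>V x = (\<Sum>k<n. z ^ k *\<^sub>C ell2_nth x k) + z ^ n *\<^sub>C (point_eval z *\<^sub>V (s ^^ n) x)" for n
  proof (induction n)
    case (Suc n)
    have "point_eval z *\<^sub>V (s ^^ n) x = ell2_nth x n + z *\<^sub>C (point_eval z *\<^sub>V (s ^^ Suc n) x)"
      by (subst point_eval_rec[OF z]) (simp add: s_nth, simp add: s_def)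
    then show ?case
      by (subst Suc.IH) (simp add: scaleC_add_right mult.commute del: funpow.simps)
  qed simp
  have "(\<lambda>n. z ^ n *\<^sub>C (point_eval z *\<^sub>V (s ^^ n) x)) \<longlonglongrightarrow> 0"
  proof (rule Lim_null_comparison)
    show "\<forall>\<^sub>F n in sequentially. norm (z ^ n *\<^sub>C (point_eval z *\<^sub>V (s ^^ n) x))
        \<le> cmod z ^ n * (norm (point_eval z :: 'a ell2 \<Rightarrow>\<^sub>C\<^sub>L 'a) * norm x)"
      by (intro always_eventually allI)
        (simp add: norm_scaleC norm_power mult_left_mono
          order_trans[OF norm_cblinfun mult_left_mono[OF s_norm norm_ge_zero]])
    show "(\<lambda>n. cmod z ^ n * (norm (point_eval z :: 'a ell2 \<Rightarrow>\<^sub>C\<^sub>L 'a) * norm x)) \<longlonglongrightarrow> 0"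
      by (rule tendsto_mult_left_zero) (use z in \<open>simp add: LIMSEQ_realpow_zero\<close>)
  qed
  then have "(\<lambda>n. point_eval z *\<^sub>V x - z ^ n *\<^sub>C (point_eval z *\<^sub>V (s ^^ n) x)) \<longlonglongrightarrow> point_eval z *\<^sub>V x - 0"
    by (intro tendsto_diff tendsto_const)
  moreover have "(\<Sum>k<n. z ^ k *\<^sub>C ell2_nth x k) = point_eval z *\<^sub>V x - z ^ n *\<^sub>C (point_eval z *\<^sub>V (s ^^ n) x)" for n
    using partial[of n] by (simp only: add_diff_cancel_right')
  ultimately show ?thesis
    unfolding sums_def by simp
qed

text \<open>Leaving out \<open>z = 0\<close> keeps the hypothesis stable under the induction, which
  drops the vanishing constant term and divides the series by \<open>z\<close>.\<close>

lemma scalar_power_series_zero: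
  fixes a :: "nat \<Rightarrow> complex"
  assumes "\<And>z. z \<noteq> 0 \<Longrightarrow> cmod z < 1 \<Longrightarrow> (\<lambda>n. a n * z ^ n) sums 0"
  shows "a n = 0"
  using assms
proof (induction n arbitrary: a)
  case 0
  have "((\<lambda>_. 0) \<longlongrightarrow> a 0) (at (0::complex))"
    by (rule powser_limit_0_strong[where s = 1 and a = a and f = "\<lambda>_. 0"]) (use 0 in simp_all)
  then show ?case
    by (simp add: tendsto_const_iff)
next
  case (Suc n)
  have "((\<lambda>_. 0) \<longlongrightarrow> a 0) (at (0::complex))"
    by (rule powser_limit_0_strong[where s = 1 and a = a and f = "\<lambda>_. 0"]) (use Suc.prems in simp_all)
  then have a0: "a 0 = 0"
    by (simp add: tendsto_const_iff)
  have "(\<lambda>n. a (Suc n) * z ^ n) sums 0" if z: "z \<noteq> 0" "cmod z < 1" for z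
  proof -
    have "(\<lambda>n. a (Suc n) * z ^ Suc n) sums 0"
      using Suc.prems[OF z] sums_Suc_iff[of "\<lambda>n. a n * z ^ n" 0] by (simp add: a0)
    from sums_mult[OF this, of "inverse z"] show ?thesis
      using z(1) by (simp add: field_simps)
  qed
  then show ?case
    by (rule Suc.IH)
qed

lemma power_series_zero:
  fixes a :: "nat \<Rightarrow> 'a::complex_inner"
  assumes "\<And>z. cmod z < 1 \<Longrightarrow> (\<lambda>n. z ^ n *\<^sub>C a n) sums 0"
  shows "a n = 0"
proof (rule cinner_eqI)
  fix y
  have "(\<lambda>n. cinner (a n) y * z ^ n) sums 0" if "cmod z < 1" for z
    using bounded_linear.sums[OF bounded_linear_cinner_left assms[OF that], of y]
    by (simp add: mult.commute)
  then show "cinner (a n) y = cinner 0 y"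
    using scalar_power_series_zero[of "\<lambda>n. cinner (a n) y"] by simp
qed

lemma point_eval_inject:
  fixes x :: "'a::chilbert_space ell2"
  assumes "\<And>z. cmod z < 1 \<Longrightarrow> point_eval z *\<^sub>V x = 0"
  shows "x = 0"
proof (rule ell2_eqI)
  fix n
  show "ell2_nth x n = ell2_nth 0 n"
    using power_series_zero[of "ell2_nth x"] point_eval_sums[of _ x] assms by simp
qed


section \<open>Analytic operator functions on the disc\<close>

definition has_op_derivative ::
    "(complex \<Rightarrow> 'a::complex_normed_vector \<Rightarrow>\<^sub>C\<^sub>L 'b::complex_normed_vector) \<Rightarrow> ('a \<Rightarrow>\<^sub>C\<^sub>L 'b) \<Rightarrow> complex \<Rightarrow> bool" where
  "has_op_derivative F F' z \<longleftrightarrow> ((\<lambda>w. inverse (w - z) *\<^sub>C (F w - F z)) \<longlongrightarrow> F') (at z)"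

lemma analytic_on_disc_iff: "analytic_on_disc F \<longleftrightarrow> (\<forall>z. cmod z < 1 \<longrightarrow> (\<exists>F'. has_op_derivative F F' z))"
  by (auto simp: analytic_on_disc_def has_op_derivative_def)

lemma has_op_derivative_continuous:
  assumes "has_op_derivative F F' z" shows "(F \<longlongrightarrow> F z) (at z)"
proof -
  have "((\<lambda>w. (w - z) *\<^sub>C (inverse (w - z) *\<^sub>C (F w - F z)) + F z) \<longlongrightarrow> (z - z) *\<^sub>C F' + F z) (at z)"
    using assms unfolding has_op_derivative_def by (intro tendsto_intros tendsto_scaleC)
  then show ?thesis
    by (rule filterlim_cong[THEN iffD1, rotated 3])
      (auto simp: eventually_at_filter simp del: scaleC_cblinfun_apply)
qed

lemma analytic_on_disc_cong:
  assumes "analytic_on_disc G" "\<And>z. cmod z < 1 \<Longrightarrow> F z = G z"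
  shows "analytic_on_disc F"
  unfolding analytic_on_disc_iff
proof (intro allI impI)
  fix z :: complex
  assume z: "cmod z < 1"
  then obtain G' where G': "has_op_derivative G G' z"
    using assms(1) by (auto simp: analytic_on_disc_iff)
  have "\<forall>\<^sub>F w in at z. w \<in> ball 0 1"
    using z by (intro eventually_at_in_open') auto
  then have "\<forall>\<^sub>F w in at z. inverse (w - z) *\<^sub>C (F w - F z) = inverse (w - z) *\<^sub>C (G w - G z)"
    by eventually_elim (simp add: assms(2) z)
  then have "has_op_derivative F G' z"
    using G' unfolding has_op_derivative_def by (simp cong: filterlim_cong)
  then show "\<exists>F'. has_op_derivative F F' z" ..
qed

lemma analytic_const: "analytic_on_disc (\<lambda>z. T)"
  by (auto simp: analytic_on_disc_def)

lemma analytic_add: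
  assumes "analytic_on_disc F" "analytic_on_disc G" shows "analytic_on_disc (\<lambda>z. F z + G z)"
  unfolding analytic_on_disc_iff
proof (intro allI impI)
  fix z :: complex
  assume "cmod z < 1"
  then obtain F' where "has_op_derivative F F' z"
    using assms(1) by (auto simp: analytic_on_disc_iff)
  moreover obtain G' where "has_op_derivative G G' z"
    using assms(2) \<open>cmod z < 1\<close> by (auto simp: analytic_on_disc_iff)
  ultimately have "((\<lambda>w. inverse (w - z) *\<^sub>C (F w - F z) + inverse (w - z) *\<^sub>C (G w - G z)) \<longlongrightarrow> F' + G') (at z)"
    unfolding has_op_derivative_def by (rule tendsto_add)
  then show "\<exists>D. has_op_derivative (\<lambda>z. F z + G z) D z"
    unfolding has_op_derivative_def
    by (intro exI[of _ "F' + G'"]) (simp add: scaleC_add_right scaleC_diff_right algebra_simps)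
qed

lemma analytic_scaleC_ident:
  assumes "analytic_on_disc F" shows "analytic_on_disc (\<lambda>z. z *\<^sub>C F z)"
  unfolding analytic_on_disc_iff
proof (intro allI impI)
  fix z :: complex
  assume "cmod z < 1"
  then obtain F' where F': "has_op_derivative F F' z"
    using assms by (auto simp: analytic_on_disc_iff)
  have "((\<lambda>w. F w + z *\<^sub>C (inverse (w - z) *\<^sub>C (F w - F z))) \<longlongrightarrow> F z + z *\<^sub>C F') (at z)"
    using F' has_op_derivative_continuous[OF F'] unfolding has_op_derivative_def
    by (intro tendsto_intros tendsto_scaleC)
  then have "has_op_derivative (\<lambda>z. z *\<^sub>C F z) (F z + z *\<^sub>C F') z"
    unfolding has_op_derivative_def
  proof (rule filterlim_cong[THEN iffD1, rotated 3])
    have "F w + z *\<^sub>C (inverse (w - z) *\<^sub>C (F w - F z)) = inverse (w - z) *\<^sub>C (w *\<^sub>C F w - z *\<^sub>C F z)"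
      if "w \<noteq> z" for w
    proof -
      have "F w = inverse (w - z) *\<^sub>C ((w - z) *\<^sub>C F w)"
        using that by (simp del: scaleC_cblinfun_apply)
      then show ?thesis
        by (simp add: scaleC_diff_left scaleC_diff_right mult.commute algebra_simps)
    qed
    then show "\<forall>\<^sub>F w in at z. F w + z *\<^sub>C (inverse (w - z) *\<^sub>C (F w - F z))
        = inverse (w - z) *\<^sub>C (w *\<^sub>C F w - z *\<^sub>C F z)"
      by (simp add: eventually_at_filter)
  qed simp_all
  then show "\<exists>D. has_op_derivative (\<lambda>z. z *\<^sub>C F z) D z" ..
qed

lemma analytic_comp_op:
  assumes "analytic_on_disc F" "analytic_on_disc G" shows "analytic_on_disc (\<lambda>z. F z o\<^sub>C\<^sub>L G z)"
  unfolding analytic_on_disc_iff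
proof (intro allI impI)
  fix z :: complex
  assume "cmod z < 1"
  then obtain F' where F': "has_op_derivative F F' z"
    using assms(1) by (auto simp: analytic_on_disc_iff)
  obtain G' where G': "has_op_derivative G G' z"
    using assms(2) \<open>cmod z < 1\<close> by (auto simp: analytic_on_disc_iff)
  have "((\<lambda>w. (inverse (w - z) *\<^sub>C (F w - F z)) o\<^sub>C\<^sub>L G w + F z o\<^sub>C\<^sub>L (inverse (w - z) *\<^sub>C (G w - G z)))
      \<longlongrightarrow> F' o\<^sub>C\<^sub>L G z + F z o\<^sub>C\<^sub>L G') (at z)"
    using F' G' has_op_derivative_continuous[OF G'] unfolding has_op_derivative_def
    by (intro tendsto_add tendsto_comp_op tendsto_const)
  moreover have "(inverse (w - z) *\<^sub>C (F w - F z)) o\<^sub>C\<^sub>L G w + F z o\<^sub>C\<^sub>L (inverse (w - z) *\<^sub>C (G w - G z))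
      = inverse (w - z) *\<^sub>C (F w o\<^sub>C\<^sub>L G w - F z o\<^sub>C\<^sub>L G z)" for w
    by (rule cblinfun_eqI) (simp add: cblinfun_apply_linear scaleC_diff_right)
  ultimately show "\<exists>D. has_op_derivative (\<lambda>z. F z o\<^sub>C\<^sub>L G z) D z"
    unfolding has_op_derivative_def by auto
qed

text \<open>The inverses near \<open>z\<close> have to be bounded before they can be shown
  continuous. The difference quotient is then minus the quotient of \<open>F\<close> between the
  inverses at \<open>w\<close> and at \<open>z\<close>.\<close>

lemma analytic_inverse_op:
  fixes F :: "complex \<Rightarrow> 'a::complex_normed_vector \<Rightarrow>\<^sub>C\<^sub>L 'b::complex_normed_vector"
  assumes F: "analytic_on_disc F" and inv: "\<And>z. cmod z < 1 \<Longrightarrow> invertible_op (F z)"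
  shows "analytic_on_disc (\<lambda>z. inverse_op (F z))"
  unfolding analytic_on_disc_iff
proof (intro allI impI)
  fix z :: complex
  assume z: "cmod z < 1"
  then obtain F' where F': "has_op_derivative F F' z"
    using F by (auto simp: analytic_on_disc_iff)
  note cont = has_op_derivative_continuous[OF F']
  define K where "K = norm (inverse_op (F z)) + 1"
  have K: "0 < K" "norm (inverse_op (F z)) \<le> K"
    by (simp_all add: K_def add_nonneg_pos)
  have ball: "\<forall>\<^sub>F w in at z. cmod w < 1"
    using eventually_at_in_open'[of "ball 0 1" z] z by simp
  \<comment> \<open>The radius \<open>1 / (2 * K)\<close> gives
    \<open>|x| \<le> K |F w x| + |x| / 2\<close>, hence the bound \<open>2 * K\<close> for the
    inverse.\<close>
  have "\<forall>\<^sub>F w in at z. norm (F w - F z) < 1 / (2 * K)"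
    using tendstoD[OF cont, of "1 / (2 * K)"] K by (simp add: dist_norm)
  with ball have bound: "\<forall>\<^sub>F w in at z. norm (inverse_op (F w)) \<le> 2 * K"
  proof eventually_elim
    case (elim w)
    show ?case
    proof (rule norm_inverse_op_le[OF inv[OF elim(1)]])
      fix x
      have "norm x = norm (inverse_op (F z) *\<^sub>V F z *\<^sub>V x)"
        by (simp add: inv z)
      also have "\<dots> \<le> K * norm (F z *\<^sub>V x)"
        by (rule norm_cblinfun_le[OF K(2)])
      also have "norm (F z *\<^sub>V x) \<le> norm (F w *\<^sub>V x) + norm ((F w - F z) *\<^sub>V x)"
        using norm_triangle_sub[of "F z *\<^sub>V x" "F w *\<^sub>V x"] by (simp add: norm_minus_commute)
      also have "norm ((F w - F z) *\<^sub>V x) \<le> 1 / (2 * K) * norm x"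
        by (rule norm_cblinfun_le) (use elim(2) in simp)
      finally show "norm x \<le> 2 * K * norm (F w *\<^sub>V x)"
        using K(1) by (simp add: field_simps)
    qed (use K in simp)
  qed
  have diff: "\<forall>\<^sub>F w in at z. inverse_op (F w) - inverse_op (F z) = - (inverse_op (F w) o\<^sub>C\<^sub>L (F w - F z) o\<^sub>C\<^sub>L inverse_op (F z))"
    using ball by eventually_elim (intro cblinfun_eqI, simp add: inv z cblinfun_apply_linear)
  have "((\<lambda>w. inverse_op (F w) - inverse_op (F z)) \<longlongrightarrow> 0) (at z)"
  proof (rule Lim_null_comparison)
    show "\<forall>\<^sub>F w in at z. norm (inverse_op (F w) - inverse_op (F z)) \<le> 2 * K * norm (F w - F z) * K"
      using diff bound
    proof eventually_elim
      case (elim w)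
      have "norm (inverse_op (F w) o\<^sub>C\<^sub>L (F w - F z) o\<^sub>C\<^sub>L inverse_op (F z))
          \<le> norm (inverse_op (F w) o\<^sub>C\<^sub>L (F w - F z)) * norm (inverse_op (F z))"
        by (rule norm_comp_op_le)
      also have "\<dots> \<le> (norm (inverse_op (F w)) * norm (F w - F z)) * norm (inverse_op (F z))"
        by (intro mult_right_mono norm_comp_op_le norm_ge_zero)
      also have "\<dots> \<le> 2 * K * norm (F w - F z) * K"
        using K elim(2) by (intro mult_mono) auto
      finally show ?case
        by (simp add: elim(1))
    qed
    have "((\<lambda>w. norm (F w - F z)) \<longlongrightarrow> 0) (at z)"
      using cont by (simp add: LIM_zero tendsto_norm_zero)
    then show "((\<lambda>w. 2 * K * norm (F w - F z) * K) \<longlongrightarrow> 0) (at z)"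
      by (intro tendsto_mult_left_zero tendsto_mult_right_zero)
  qed
  then have cont_inv: "((\<lambda>w. inverse_op (F w)) \<longlongrightarrow> inverse_op (F z)) (at z)"
    by (rule LIM_zero_cancel)
  have "((\<lambda>w. - (inverse_op (F w) o\<^sub>C\<^sub>L (inverse (w - z) *\<^sub>C (F w - F z)) o\<^sub>C\<^sub>L inverse_op (F z)))
      \<longlongrightarrow> - (inverse_op (F z) o\<^sub>C\<^sub>L F' o\<^sub>C\<^sub>L inverse_op (F z))) (at z)"
    using F' unfolding has_op_derivative_def
    by (intro tendsto_minus tendsto_comp_op tendsto_const cont_inv)
  moreover have "\<forall>\<^sub>F w in at z. - (inverse_op (F w) o\<^sub>C\<^sub>L (inverse (w - z) *\<^sub>C (F w - F z)) o\<^sub>C\<^sub>L inverse_op (F z))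
      = inverse (w - z) *\<^sub>C (inverse_op (F w) - inverse_op (F z))"
    using diff
  proof eventually_elim
    case (elim w)
    show ?case
      unfolding elim by (rule cblinfun_eqI) (simp add: scaleC_minus_right)
  qed
  ultimately have "has_op_derivative (\<lambda>z. inverse_op (F z)) (- (inverse_op (F z) o\<^sub>C\<^sub>L F' o\<^sub>C\<^sub>L inverse_op (F z))) z"
    unfolding has_op_derivative_def by (simp cong: filterlim_cong)
  then show "\<exists>D. has_op_derivative (\<lambda>z. inverse_op (F z)) D z" ..
qed

lemma analytic_diff:
  assumes "analytic_on_disc F" "analytic_on_disc G" shows "analytic_on_disc (\<lambda>z. F z - G z)"
proof (rule analytic_on_disc_cong)
  show "analytic_on_disc (\<lambda>z. F z + (- id_op) o\<^sub>C\<^sub>L G z)"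
    by (intro analytic_add analytic_comp_op analytic_const assms)
qed (auto intro: cblinfun_eqI)

lemma analytic_point_eval: "analytic_on_disc (point_eval :: complex \<Rightarrow> 'a::chilbert_space ell2 \<Rightarrow>\<^sub>C\<^sub>L 'a)"
  unfolding point_eval_def[abs_def]
  by (intro analytic_comp_op analytic_const analytic_inverse_op analytic_diff analytic_scaleC_ident
      invertible_resolvent)


section \<open>Toeplitz operators of Schur class functions\<close>

lemma schur_class_bound: "schur_class F \<Longrightarrow> cmod z < 1 \<Longrightarrow> norm (F z) \<le> 1"
  by (simp add: schur_class_def)

lemma schur_class_holomorphic:
  fixes F :: "complex \<Rightarrow> 'a::complex_normed_vector \<Rightarrow>\<^sub>C\<^sub>L 'b::complex_inner"
  assumes "schur_class F"
  shows "(\<lambda>z. cinner (F z *\<^sub>V u) y) holomorphic_on ball 0 1"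
  unfolding holomorphic_on_open[OF open_ball]
proof (intro ballI)
  fix z :: complex
  assume "z \<in> ball 0 1"
  then obtain F' where "has_op_derivative F F' z"
    using assms by (auto simp: schur_class_def analytic_on_disc_iff)
  then have "((\<lambda>w. cinner ((inverse (w - z) *\<^sub>C (F w - F z)) *\<^sub>V u) y) \<longlongrightarrow> cinner (F' *\<^sub>V u) y) (at z)"
    unfolding has_op_derivative_def by (intro tendsto_cinner_left tendsto_cblinfun_apply_left)
  then have "((\<lambda>z. cinner (F z *\<^sub>V u) y) has_field_derivative cinner (F' *\<^sub>V u) y) (at z)"
    unfolding has_field_derivative_iff by (simp add: cinner_linear divide_inverse mult.commute)
  then show "\<exists>f'. ((\<lambda>z. cinner (F z *\<^sub>V u) y) has_field_derivative f') (at z)" ..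
qed

text \<open>The coefficients are obtained weakly, from Cauchy's estimates for the scalar functions
  \<open>\<langle>F(z) u, y\<rangle>\<close>.\<close>

lemma schur_class_taylor_exists:
  fixes F :: "complex \<Rightarrow> 'a::chilbert_space \<Rightarrow>\<^sub>C\<^sub>L 'b::chilbert_space"
  assumes F: "schur_class F"
  shows "\<exists>a. (\<forall>n. norm (a n) \<le> 1) \<and> (\<forall>z. cmod z < 1 \<longrightarrow> (\<lambda>n. z ^ n *\<^sub>C a n) sums F z)"
proof -
  define c where "c n u y = (deriv ^^ n) (\<lambda>z. cinner (F z *\<^sub>V u) y) 0 / fact n" for n u y
  have c_sums: "(\<lambda>n. c n u y * z ^ n) sums cinner (F z *\<^sub>V u) y" if "cmod z < 1" for u y z
    using holomorphic_power_series[OF schur_class_holomorphic[OF F, of u y], of z] that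
    by (simp add: c_def)
  have c_bound: "cmod (c n u y) \<le> norm u * norm y" for n u y
  proof -
    \<comment> \<open>Cauchy's estimate needs a circle inside the disc; the factor
      \<open>r ^ n\<close> disappears as \<open>r\<close> tends to 1.\<close>
    have le: "cmod (c n u y) * r ^ n \<le> norm u * norm y" if r: "0 < r" "r < 1" for r
    proof -
      have "cmod ((deriv ^^ n) (\<lambda>z. cinner (F z *\<^sub>V u) y) 0) \<le> fact n * (norm u * norm y) / r ^ n"
      proof (rule Cauchy_inequality[OF _ _ r(1)])
        have sub: "cball 0 r \<subseteq> ball 0 (1::real)" "ball 0 r \<subseteq> ball (0::complex) 1"
          using r by auto
        show "(\<lambda>z. cinner (F z *\<^sub>V u) y) holomorphic_on ball 0 r"
          by (rule holomorphic_on_subset[OF schur_class_holomorphic[OF F] sub(2)])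
        show "continuous_on (cball 0 r) (\<lambda>z. cinner (F z *\<^sub>V u) y)"
          by (rule continuous_on_subset[OF holomorphic_on_imp_continuous_on[OF schur_class_holomorphic[OF F]]])
            (use r in auto)
        show "cmod (cinner (F z *\<^sub>V u) y) \<le> norm u * norm y" if "cmod (0 - z) = r" for z
        proof -
          have "norm (F z *\<^sub>V u) \<le> 1 * norm u"
            by (rule norm_cblinfun_le[OF schur_class_bound[OF F]]) (use that r in simp)
          then show ?thesis
            by (intro order_trans[OF norm_cinner_le mult_right_mono]) simp_all
        qed
      qed
      then show ?thesis
        using r by (simp add: c_def norm_divide field_simps)
    qed
    have "((\<lambda>r. cmod (c n u y) * r ^ n) \<longlongrightarrow> cmod (c n u y) * 1 ^ n) (at_left 1)"
      by (intro tendsto_intros)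
    moreover have "\<forall>\<^sub>F r in at_left 1. cmod (c n u y) * r ^ n \<le> norm u * norm y"
      by (rule eventually_mono[OF eventually_at_left_real[OF zero_less_one]]) (auto intro: le)
    ultimately have "cmod (c n u y) * 1 ^ n \<le> norm u * norm y"
      by (rule tendsto_upperbound) simp
    then show ?thesis
      by simp
  qed
  \<comment> \<open>The coefficients inherit sesquilinearity from the function because a convergent
    series determines them.\<close>
  have unique: "a n = b n"
    if "\<And>z. cmod z < 1 \<Longrightarrow> (\<lambda>n. a n * z ^ n) sums f z" "\<And>z. cmod z < 1 \<Longrightarrow> (\<lambda>n. b n * z ^ n) sums f z"
    for a b :: "nat \<Rightarrow> complex" and f n
  proof -
    have "(\<lambda>n. (a n - b n) * z ^ n) sums 0" if z: "cmod z < 1" for z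
      using sums_diff[OF \<open>cmod z < 1 \<Longrightarrow> (\<lambda>n. a n * z ^ n) sums f z\<close>[OF z]
          \<open>cmod z < 1 \<Longrightarrow> (\<lambda>n. b n * z ^ n) sums f z\<close>[OF z]]
      by (simp add: left_diff_distrib)
    then have "a n - b n = 0"
      by (rule scalar_power_series_zero)
    then show ?thesis
      by simp
  qed
  have c_linear: "c n (u + u') y = c n u y + c n u' y" "c n (k *\<^sub>C u) y = k * c n u y"
    "c n u (y + y') = c n u y + c n u y'" "c n u (k *\<^sub>C y) = cnj k * c n u y" for n u u' y y' k
  proof -
    show "c n (u + u') y = c n u y + c n u' y"
      by (rule unique[OF c_sums])
        (simp_all add: distrib_right cblinfun_apply_add cinner_add_left sums_add c_sums)
    show "c n u (y + y') = c n u y + c n u y'"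
      by (rule unique[OF c_sums]) (simp_all add: distrib_right cinner_add_right sums_add c_sums)
    show "c n (k *\<^sub>C u) y = k * c n u y" "c n u (k *\<^sub>C y) = cnj k * c n u y"
      by (rule unique[OF c_sums]; simp add: mult.assoc sums_mult c_sums)+
  qed
  have "\<exists>a. \<forall>n. (\<forall>u y. c n u y = cinner (a n *\<^sub>V u) y) \<and> norm (a n) \<le> 1"
  proof (rule choice, rule allI)
    fix n
    \<comment> \<open>\<open>bounded_form_operator\<close> asks for a form linear in
      \<open>y\<close> and conjugate linear in \<open>u\<close>, hence the conjugate of
      \<open>c\<close>.\<close>
    have "\<exists>T :: 'a \<Rightarrow>\<^sub>C\<^sub>L 'b. (\<forall>u. T *\<^sub>V u \<in> closure UNIV)
        \<and> (\<forall>y\<in>UNIV. \<forall>u. cnj (c n u y) = cinner y (T *\<^sub>V u)) \<and> norm T \<le> 1"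
      by (rule bounded_form_operator)
        (use c_bound in \<open>simp_all add: csubspace_def c_linear mult.commute\<close>)
    then obtain T :: "'a \<Rightarrow>\<^sub>C\<^sub>L 'b" where T: "\<forall>y u. cnj (c n u y) = cinner y (T *\<^sub>V u)" "norm T \<le> 1"
      by auto
    have "c n u y = cinner (T *\<^sub>V u) y" for u y
      using arg_cong[OF T(1)[rule_format, of u y], of cnj] by (simp flip: cinner_commute)
    then show "\<exists>a. (\<forall>u y. c n u y = cinner (a *\<^sub>V u) y) \<and> norm a \<le> 1"
      using T(2) by blast
  qed
  then obtain a where a: "\<And>n u y. c n u y = cinner (a n *\<^sub>V u) y" "\<And>n. norm (a n) \<le> 1"
    by blast
  have "(\<lambda>n. z ^ n *\<^sub>C a n) sums F z" if z: "cmod z < 1" for z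
  proof -
    have "summable (\<lambda>n. z ^ n *\<^sub>C a n)"
    proof (rule summable_comparison_test')
      show "summable (\<lambda>n. cmod z ^ n)"
        using z by (simp add: summable_geometric)
      show "norm (z ^ n *\<^sub>C a n) \<le> cmod z ^ n" for n
        using mult_left_mono[OF a(2)[of n], of "cmod z ^ n"] by (simp add: norm_scaleC norm_power)
    qed
    then obtain G where G: "(\<lambda>n. z ^ n *\<^sub>C a n) sums G"
      by (auto simp: summable_def)
    have "G = F z"
    proof (rule cblinfun_eqI, rule cinner_eqI)
      fix u y
      have "(\<lambda>n. cinner ((z ^ n *\<^sub>C a n) *\<^sub>V u) y) sums cinner (G *\<^sub>V u) y"
        by (intro bounded_linear.sums[OF bounded_linear_cinner_left]
            bounded_linear.sums[OF bounded_linear_apply_arg] G)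
      moreover have "cinner ((z ^ n *\<^sub>C a n) *\<^sub>V u) y = c n u y * z ^ n" for n
        by (simp add: a(1))
      ultimately have "(\<lambda>n. c n u y * z ^ n) sums cinner (G *\<^sub>V u) y"
        by (simp only:)
      then show "cinner (G *\<^sub>V u) y = cinner (F z *\<^sub>V u) y"
        by (rule sums_unique2[OF _ c_sums[OF z]])
    qed
    then show ?thesis
      using G by simp
  qed
  then show ?thesis
    using a(2) by blast
qed

lemma taylor_coeffs:
  fixes F :: "complex \<Rightarrow> 'a::chilbert_space \<Rightarrow>\<^sub>C\<^sub>L 'b::chilbert_space"
  assumes F: "schur_class F"
  shows "norm (taylor_coeffs F n) \<le> 1"
    and "cmod z < 1 \<Longrightarrow> (\<lambda>n. z ^ n *\<^sub>C taylor_coeffs F n) sums F z"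
proof -
  obtain a where a: "\<And>n. norm (a n) \<le> 1" "\<And>z. cmod z < 1 \<Longrightarrow> (\<lambda>n. z ^ n *\<^sub>C a n) sums F z"
    using schur_class_taylor_exists[OF F] by blast
  have "taylor_coeffs F = a"
    unfolding taylor_coeffs_def
  proof (rule the_equality)
    show "\<forall>z\<in>ball 0 1. (\<lambda>n. z ^ n *\<^sub>C a n) sums F z"
      by (simp add: a(2))
    fix b
    assume b: "\<forall>z\<in>ball 0 1. (\<lambda>n. z ^ n *\<^sub>C b n) sums F z"
    show "b = a"
    proof (rule ext, rule cblinfun_eqI)
      fix n u
      have "(\<lambda>n. z ^ n *\<^sub>C (b n *\<^sub>V u - a n *\<^sub>V u)) sums 0" if z: "cmod z < 1" for z
      proof -
        have "(\<lambda>n. z ^ n *\<^sub>C b n) sums F z"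
          using b z by simp
        from bounded_linear.sums[OF bounded_linear_apply_arg[of u] sums_diff[OF this a(2)[OF z]]]
        show ?thesis
          by (simp add: scaleC_diff_right)
      qed
      then have "b n *\<^sub>V u - a n *\<^sub>V u = 0"
        by (rule power_series_zero)
      then show "b n *\<^sub>V u = a n *\<^sub>V u"
        by simp
    qed
  qed
  then show "norm (taylor_coeffs F n) \<le> 1"
    and "cmod z < 1 \<Longrightarrow> (\<lambda>n. z ^ n *\<^sub>C taylor_coeffs F n) sums F z"
    using a by simp_all
qed

text \<open>Orthogonality of the characters of the cyclic group of order \<open>M\<close>: the
  geometric sum over the roots vanishes unless \<open>m = m'\<close>. This takes the place of an
  integral over the circle.\<close>

lemma parseval_roots_of_unity:
  fixes g :: "nat \<Rightarrow> 'a::complex_inner"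
  assumes M: "0 < M"
  shows "(\<Sum>j<M. (norm (\<Sum>m<M. cis (2 * pi * real j / real M) ^ m *\<^sub>C g m))\<^sup>2) = real M * (\<Sum>m<M. (norm (g m))\<^sup>2)"
proof -
  define \<zeta> where "\<zeta> m = cis (2 * pi * real m / real M)" for m
  \<comment> \<open>Exchanging base and exponent turns the sum over the sample points
    \<open>j\<close> into a geometric sum whose ratio does not depend on \<open>j\<close>.\<close>
  have pow: "\<zeta> j ^ m = \<zeta> m ^ j" for j m
  proof -
    have "real m * (2 * pi * real j / real M) = real j * (2 * pi * real m / real M)"
      by simp
    then show ?thesis
      unfolding \<zeta>_def Complex.DeMoivre by (simp only:)
  qed
  have unity: "\<zeta> m ^ M = 1" for m
    using M by (simp add: \<zeta>_def Complex.DeMoivre cis_multiple_2pi)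
  have norm_zeta: "\<zeta> m * cnj (\<zeta> m) = 1" for m
    by (simp add: \<zeta>_def cis_cnj cis_mult)
  have inj: "m = m'" if "\<zeta> m * cnj (\<zeta> m') = 1" "m < M" "m' < M" for m m'
  proof -
    have "\<zeta> m = \<zeta> m * cnj (\<zeta> m') * \<zeta> m'"
      using norm_zeta[of m'] by (simp add: mult_ac)
    then have "\<zeta> m = \<zeta> m'"
      by (simp add: that(1))
    then show ?thesis
      using bij_betw_imp_inj_on[OF Complex.bij_betw_roots_unity[OF M]] that(2,3)
      unfolding \<zeta>_def inj_on_def by auto
  qed
  have geom: "(\<Sum>j<M. (\<zeta> m * cnj (\<zeta> m')) ^ j) = (if m = m' then of_nat M else 0)" if "m < M" "m' < M" for m m'
  proof (cases "m = m'")
    case False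
    then have "\<zeta> m * cnj (\<zeta> m') \<noteq> 1"
      using inj that by blast
    then have "(\<Sum>j<M. (\<zeta> m * cnj (\<zeta> m')) ^ j) = ((\<zeta> m * cnj (\<zeta> m')) ^ M - 1) / (\<zeta> m * cnj (\<zeta> m') - 1)"
      by (rule geometric_sum)
    also have "(\<zeta> m * cnj (\<zeta> m')) ^ M = 1"
      by (simp only: power_mult_distrib complex_cnj_power[symmetric] unity complex_cnj_one mult_1)
    finally show ?thesis
      using False by simp
  qed (simp add: norm_zeta)
  have sum_left: "cinner (\<Sum>i\<in>I. f i) y = (\<Sum>i\<in>I. cinner (f i) y)"
    and sum_right: "cinner y (\<Sum>i\<in>I. f i) = (\<Sum>i\<in>I. cinner y (f i))" for f :: "nat \<Rightarrow> 'a" and y I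
    by (induction I rule: infinite_finite_induct) (simp_all add: cinner_linear)
  have "(\<Sum>j<M. cinner (\<Sum>m<M. \<zeta> j ^ m *\<^sub>C g m) (\<Sum>m<M. \<zeta> j ^ m *\<^sub>C g m))
      = (\<Sum>j<M. \<Sum>m<M. \<Sum>m'<M. (\<zeta> m * cnj (\<zeta> m')) ^ j * cinner (g m) (g m'))"
  proof (rule sum.cong[OF refl])
    fix j
    have "cinner (\<zeta> j ^ m *\<^sub>C g m) (\<zeta> j ^ m' *\<^sub>C g m') = (\<zeta> m * cnj (\<zeta> m')) ^ j * cinner (g m) (g m')" for m m'
      unfolding pow[of j m] pow[of j m'] by (simp add: power_mult_distrib mult_ac)
    then show "cinner (\<Sum>m<M. \<zeta> j ^ m *\<^sub>C g m) (\<Sum>m<M. \<zeta> j ^ m *\<^sub>C g m)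
        = (\<Sum>m<M. \<Sum>m'<M. (\<zeta> m * cnj (\<zeta> m')) ^ j * cinner (g m) (g m'))"
      by (simp only: sum_left, simp only: sum_right)
  qed
  also have "\<dots> = (\<Sum>m<M. \<Sum>m'<M. (\<Sum>j<M. (\<zeta> m * cnj (\<zeta> m')) ^ j) * cinner (g m) (g m'))"
    unfolding sum_distrib_right
    by (subst sum.swap) (rule sum.cong[OF refl], rule sum.swap)
  also have "\<dots> = (\<Sum>m<M. \<Sum>m'<M. if m' = m then of_nat M * cinner (g m) (g m') else 0)"
    by (intro sum.cong refl) (simp add: geom)
  also have "\<dots> = of_nat M * (\<Sum>m<M. cinner (g m) (g m))"
    by (simp add: sum.delta sum_distrib_left)
  finally have "complex_of_real (\<Sum>j<M. (norm (\<Sum>m<M. \<zeta> j ^ m *\<^sub>C g m))\<^sup>2)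
      = complex_of_real (real M * (\<Sum>m<M. (norm (g m))\<^sup>2))"
    by (simp add: cinner_same)
  then show ?thesis
    unfolding of_real_eq_iff \<zeta>_def .
qed

text \<open>Truncating the input after \<open>K\<close> terms makes it a polynomial, and averaging over the \<open>M\<close>-th roots of
  unity on the circle of radius \<open>r\<close> is exact up to the tail of the output beyond \<open>M\<close>.\<close>

lemma toeplitz_contraction:
  fixes F :: "complex \<Rightarrow> 'a::chilbert_space \<Rightarrow>\<^sub>C\<^sub>L 'b::chilbert_space"
  assumes F: "schur_class F"
  shows "(\<Sum>n<K. (norm (\<Sum>k\<le>n. taylor_coeffs F (n - k) *\<^sub>V x k))\<^sup>2) \<le> (\<Sum>k<K. (norm (x k))\<^sup>2)"
proof -
  define a where "a = taylor_coeffs F"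
  have a: "norm (a n) \<le> 1" "cmod z < 1 \<Longrightarrow> (\<lambda>n. z ^ n *\<^sub>C a n) sums F z" for n z
    using taylor_coeffs[OF F] by (simp_all add: a_def)
  \<comment> \<open>Zero padding, so that the truncated input can be sampled at any number
    \<open>M \<ge> K\<close> of points.\<close>
  define X where "X k = (if k < K then x k else 0)" for k
  define f where "f z = (\<Sum>k<K. z ^ k *\<^sub>C x k)" for z
  \<comment> \<open>Taylor coefficients of \<open>F f\<close>, possibly infinitely many; below index
    \<open>K\<close> they agree with the Toeplitz output for the untruncated input.\<close>
  define g where "g n = (\<Sum>k<K. if k \<le> n then a (n - k) *\<^sub>V x k else 0)" for n
  define c where "c = (\<Sum>k<K. norm (x k))"
  have c0: "0 \<le> c"
    by (simp add: c_def sum_nonneg)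
  have f_le: "norm (f z) \<le> c" if "cmod z < 1" for z
    unfolding f_def c_def
  proof (rule sum_norm_le)
    show "norm (z ^ k *\<^sub>C x k) \<le> norm (x k)" for k
      using that by (simp add: norm_scaleC norm_power power_le_one mult_left_le_one_le)
  qed
  have g_le: "norm (g n) \<le> c" for n
    unfolding g_def c_def
  proof (rule sum_norm_le)
    show "norm (if k \<le> n then a (n - k) *\<^sub>V x k else 0) \<le> norm (x k)" for k
      using norm_cblinfun_le[OF a(1), of "n - k" "x k"] by simp
  qed
  have g_sums: "(\<lambda>n. z ^ n *\<^sub>C g n) sums (F z *\<^sub>V f z)" if z: "cmod z < 1" for z
  proof -
    have "(\<lambda>n. if k \<le> n then z ^ n *\<^sub>C (a (n - k) *\<^sub>V x k) else 0) sums (z ^ k *\<^sub>C (F z *\<^sub>V x k))" for k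
    proof -
      have "(\<lambda>n. z ^ k *\<^sub>C ((z ^ n *\<^sub>C a n) *\<^sub>V x k)) sums (z ^ k *\<^sub>C (F z *\<^sub>V x k))"
        by (intro bounded_linear.sums[OF bounded_linear_scaleC]
            bounded_linear.sums[OF bounded_linear_apply_arg] a(2) z)
      then have "(\<lambda>n. if k \<le> n + k then z ^ (n + k) *\<^sub>C (a (n + k - k) *\<^sub>V x k) else 0) sums (z ^ k *\<^sub>C (F z *\<^sub>V x k))"
        by (simp add: power_add mult.commute)
      then show ?thesis
        by (subst (asm) sums_iff_shift) simp
    qed
    then have "(\<lambda>n. \<Sum>k<K. if k \<le> n then z ^ n *\<^sub>C (a (n - k) *\<^sub>V x k) else 0) sums (\<Sum>k<K. z ^ k *\<^sub>C (F z *\<^sub>V x k))"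
      by (rule sums_sum)
    moreover have "(\<Sum>k<K. z ^ k *\<^sub>C (F z *\<^sub>V x k)) = F z *\<^sub>V f z"
      by (simp add: f_def cblinfun_apply_sum)
    moreover have "(\<Sum>k<K. if k \<le> n then z ^ n *\<^sub>C (a (n - k) *\<^sub>V x k) else 0) = z ^ n *\<^sub>C g n" for n
      by (auto simp: g_def scaleC_sum_right intro!: sum.cong)
    ultimately show ?thesis
      by simp
  qed
  have r_bound: "(\<Sum>n<K. (r ^ n * norm (g n))\<^sup>2) \<le> (\<Sum>k<K. (norm (x k))\<^sup>2)" if r: "0 < r" "r < 1" for r :: real
  proof -
    \<comment> \<open>Geometric majorant, on the circle of radius \<open>r\<close>, of the output
      terms from index \<open>M\<close> on.\<close>
    define \<tau> where "\<tau> M = c * (r ^ M / (1 - r))" for M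
    have tau0: "0 \<le> \<tau> M" for M
      using r c0 by (simp add: \<tau>_def)
    have partial: "norm (\<Sum>n<M. z ^ n *\<^sub>C g n) \<le> norm (f z) + \<tau> M" if z: "cmod z = r" for z M
    proof -
      have z1: "cmod z < 1"
        using z r by simp
      have tail: "(\<lambda>n. z ^ (n + M) *\<^sub>C g (n + M)) sums (F z *\<^sub>V f z - (\<Sum>n<M. z ^ n *\<^sub>C g n))"
        using g_sums[OF z1] by (rule sums_split_initial_segment)
      have geo: "(\<lambda>n. c * (r ^ M * r ^ n)) sums \<tau> M"
        unfolding \<tau>_def using geometric_sums[of r] r
        by (intro sums_mult) (simp add: sums_mult[of "\<lambda>n. r ^ n" "1 / (1 - r)" "r ^ M", simplified])
      have "norm (F z *\<^sub>V f z - (\<Sum>n<M. z ^ n *\<^sub>C g n)) \<le> \<tau> M"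
        unfolding sums_unique[OF tail] sums_unique[OF geo]
      proof (rule norm_suminf_le)
        show "norm (z ^ (n + M) *\<^sub>C g (n + M)) \<le> c * (r ^ M * r ^ n)" for n
          using mult_left_mono[OF g_le[of "n + M"], of "r ^ (n + M)"] r
          by (simp add: norm_scaleC norm_mult norm_power z power_add mult_ac)
        show "summable (\<lambda>n. c * (r ^ M * r ^ n))"
          by (rule sums_summable[OF geo])
      qed
      moreover have "norm (F z *\<^sub>V f z) \<le> 1 * norm (f z)"
        by (rule norm_cblinfun_le[OF schur_class_bound[OF F z1]])
      ultimately show ?thesis
        using norm_triangle_sub[of "\<Sum>n<M. z ^ n *\<^sub>C g n" "F z *\<^sub>V f z"] by (simp add: norm_minus_commute)
    qed
    \<comment> \<open>The error is the excess of \<open>(|f| + \<tau>)^2\<close> over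
      \<open>|f|^2\<close>, estimated with \<open>|f| \<le> c\<close>; it vanishes as
      \<open>M\<close> grows.\<close>
    have M_bound: "(\<Sum>n<K. (r ^ n * norm (g n))\<^sup>2) \<le> (\<Sum>k<K. (norm (x k))\<^sup>2) + (2 * c * \<tau> M + (\<tau> M)\<^sup>2)"
      if M: "K \<le> M" "0 < M" for M
    proof -
      define z where "z j = of_real r * cis (2 * pi * real j / real M)" for j
      have z: "cmod (z j) = r" "cmod (z j) < 1" for j
        using r by (simp_all add: z_def norm_mult)
      have z_pow: "z j ^ m *\<^sub>C v = cis (2 * pi * real j / real M) ^ m *\<^sub>C (of_real (r ^ m) *\<^sub>C v)"
        for j m and v :: "'w::complex_vector"
        by (simp add: z_def power_mult_distrib mult.commute)
      have "real M * (\<Sum>n<M. (r ^ n * norm (g n))\<^sup>2) = (\<Sum>j<M. (norm (\<Sum>n<M. z j ^ n *\<^sub>C g n))\<^sup>2)"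
        unfolding z_pow parseval_roots_of_unity[OF M(2)] using r
        by (simp add: norm_scaleC norm_power)
      also have "\<dots> \<le> (\<Sum>j<M. (norm (f (z j)))\<^sup>2 + (2 * c * \<tau> M + (\<tau> M)\<^sup>2))"
      proof (rule sum_mono)
        fix j
        have "(norm (\<Sum>n<M. z j ^ n *\<^sub>C g n))\<^sup>2 \<le> (norm (f (z j)) + \<tau> M)\<^sup>2"
          by (intro power_mono partial z norm_ge_zero)
        also have "\<dots> \<le> (norm (f (z j)))\<^sup>2 + (2 * c * \<tau> M + (\<tau> M)\<^sup>2)"
          using mult_right_mono[OF f_le[OF z(2)] tau0] by (simp add: power2_sum)
        finally show "(norm (\<Sum>n<M. z j ^ n *\<^sub>C g n))\<^sup>2 \<le> (norm (f (z j)))\<^sup>2 + (2 * c * \<tau> M + (\<tau> M)\<^sup>2)" .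
      qed
      also have "\<dots> = (\<Sum>j<M. (norm (\<Sum>k<M. z j ^ k *\<^sub>C X k))\<^sup>2) + real M * (2 * c * \<tau> M + (\<tau> M)\<^sup>2)"
      proof -
        have "f (z j) = (\<Sum>k<M. z j ^ k *\<^sub>C X k)" for j
          unfolding f_def using M(1) by (intro sum.mono_neutral_cong_left) (auto simp: X_def)
        then show ?thesis
          by (simp add: sum.distrib)
      qed
      also have "(\<Sum>j<M. (norm (\<Sum>k<M. z j ^ k *\<^sub>C X k))\<^sup>2) = real M * (\<Sum>k<M. (r ^ k * norm (X k))\<^sup>2)"
        unfolding z_pow parseval_roots_of_unity[OF M(2)] using r
        by (simp add: norm_scaleC norm_power)
      also have "(\<Sum>k<M. (r ^ k * norm (X k))\<^sup>2) \<le> (\<Sum>k<K. (norm (x k))\<^sup>2)"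
      proof -
        have "(\<Sum>k<M. (r ^ k * norm (X k))\<^sup>2) = (\<Sum>k<K. (r ^ k * norm (x k))\<^sup>2)"
          using M(1) by (intro sum.mono_neutral_cong_right) (auto simp: X_def)
        also have "\<dots> \<le> (\<Sum>k<K. (norm (x k))\<^sup>2)"
          using r by (intro sum_mono power_mono mult_left_le_one_le) (auto simp: power_le_one)
        finally show ?thesis .
      qed
      finally have "(\<Sum>n<M. (r ^ n * norm (g n))\<^sup>2) \<le> (\<Sum>k<K. (norm (x k))\<^sup>2) + (2 * c * \<tau> M + (\<tau> M)\<^sup>2)"
        using M(2) by (simp flip: distrib_left)
      moreover have "(\<Sum>n<K. (r ^ n * norm (g n))\<^sup>2) \<le> (\<Sum>n<M. (r ^ n * norm (g n))\<^sup>2)"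
        using M(1) by (intro sum_mono2) auto
      ultimately show ?thesis
        by linarith
    qed
    have "\<tau> \<longlonglongrightarrow> 0"
      unfolding \<tau>_def using r by (intro tendsto_mult_right_zero tendsto_divide_zero LIMSEQ_realpow_zero) auto
    then have "(\<lambda>M. (\<Sum>k<K. (norm (x k))\<^sup>2) + (2 * c * \<tau> M + (\<tau> M)\<^sup>2)) \<longlonglongrightarrow> (\<Sum>k<K. (norm (x k))\<^sup>2) + (2 * c * 0 + 0\<^sup>2)"
      by (intro tendsto_intros)
    then have "(\<Sum>n<K. (r ^ n * norm (g n))\<^sup>2) \<le> (\<Sum>k<K. (norm (x k))\<^sup>2) + (2 * c * 0 + 0\<^sup>2)"
      by (rule LIMSEQ_le_const) (auto intro!: exI[of _ "Suc K"] M_bound)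
    then show ?thesis
      by simp
  qed
  have "((\<lambda>r::real. \<Sum>n<K. (r ^ n * norm (g n))\<^sup>2) \<longlongrightarrow> (\<Sum>n<K. (1 ^ n * norm (g n))\<^sup>2)) (at_left 1)"
    by (intro tendsto_intros)
  moreover have "\<forall>\<^sub>F r in at_left (1::real). (\<Sum>n<K. (r ^ n * norm (g n))\<^sup>2) \<le> (\<Sum>k<K. (norm (x k))\<^sup>2)"
    by (rule eventually_mono[OF eventually_at_left_real[OF zero_less_one]]) (auto intro: r_bound)
  ultimately have "(\<Sum>n<K. (1 ^ n * norm (g n))\<^sup>2) \<le> (\<Sum>k<K. (norm (x k))\<^sup>2)"
    by (rule tendsto_upperbound) simp
  moreover have "g n = (\<Sum>k\<le>n. a (n - k) *\<^sub>V x k)" if "n < K" for n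
    unfolding g_def using that by (intro sum.mono_neutral_cong_right) auto
  ultimately show ?thesis
    by (simp add: a_def)
qed

lemma toeplitz_properties:
  fixes F :: "complex \<Rightarrow> 'a::chilbert_space \<Rightarrow>\<^sub>C\<^sub>L 'b::chilbert_space"
  assumes F: "schur_class F"
  shows toeplitz_nth: "ell2_nth (toeplitz F *\<^sub>V x) n = (\<Sum>k\<le>n. taylor_coeffs F (n - k) *\<^sub>V ell2_nth x k)"
    and norm_toeplitz_le: "norm (toeplitz F) \<le> 1"
proof -
  define t where "t x = Abs_ell2 (\<lambda>n. \<Sum>k\<le>n. taylor_coeffs F (n - k) *\<^sub>V ell2_nth x k)" for x
  have bound: "(\<Sum>n<K. (norm (\<Sum>k\<le>n. taylor_coeffs F (n - k) *\<^sub>V ell2_nth x k))\<^sup>2) \<le> (norm x)\<^sup>2" for K x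
  proof -
    have "(\<Sum>k<K. (norm (ell2_nth x k))\<^sup>2) \<le> (norm x)\<^sup>2"
      unfolding norm_ell2_def by (simp add: sum_le_suminf suminf_nonneg summable_ell2)
    with toeplitz_contraction[OF F, where x = "ell2_nth x" and K = K] show ?thesis
      by (rule order_trans)
  qed
  have summable: "summable (\<lambda>n. (norm (\<Sum>k\<le>n. taylor_coeffs F (n - k) *\<^sub>V ell2_nth x k))\<^sup>2)" for x
    by (rule bounded_imp_summable[where B = "(norm x)\<^sup>2"])
      (simp, subst lessThan_Suc_atMost[symmetric], rule bound)
  have t: "ell2_nth (t x) n = (\<Sum>k\<le>n. taylor_coeffs F (n - k) *\<^sub>V ell2_nth x k)" for x n
    unfolding t_def using summable[of x] by (simp add: Abs_ell2_inverse)
  have t_norm: "norm (t x) \<le> norm x" for x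
    unfolding norm_ell2_def[of "t x"] t
    by (intro real_le_lsqrt suminf_le_const[OF summable bound]) (simp_all add: suminf_nonneg summable)
  have t_scale: "t (c *\<^sub>C x) = c *\<^sub>C t x" for c x
    by (rule ell2_eqI) (simp add: t scaleC_sum_right)
  have "bounded_linear t"
  proof (rule bounded_linear_intro[where K = 1])
    show "t (x + y) = t x + t y" for x y
      by (rule ell2_eqI) (simp add: t cblinfun_apply_add sum.distrib)
  qed (simp_all add: t_norm t_scale scaleR_scaleC)
  then have T: "CBlinfun t *\<^sub>V x = t x" for x
    by (rule CBlinfun_apply) (rule t_scale)
  have "toeplitz F = CBlinfun t"
    unfolding toeplitz_def
    by (rule the_equality) (auto simp: T t intro!: cblinfun_eqI ell2_eqI)
  then show "ell2_nth (toeplitz F *\<^sub>V x) n = (\<Sum>k\<le>n. taylor_coeffs F (n - k) *\<^sub>V ell2_nth x k)"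
    and "norm (toeplitz F) \<le> 1"
    by (auto simp: T t t_norm intro: norm_cblinfun_bound)
qed

lemma toeplitz_shift:
  assumes "schur_class F" shows "toeplitz F *\<^sub>V shift *\<^sub>V x = shift *\<^sub>V toeplitz F *\<^sub>V x"
proof (rule ell2_eqI)
  show "ell2_nth (toeplitz F *\<^sub>V shift *\<^sub>V x) n = ell2_nth (shift *\<^sub>V toeplitz F *\<^sub>V x) n" for n
    by (cases n) (simp_all add: toeplitz_nth[OF assms] sum.atMost_Suc_shift del: sum.atMost_Suc)
qed

text \<open>The difference \<open>D\<close> of the two sides kills constants and satisfies
  \<open>D S = z D\<close>, so \<open>D = z D S*\<close>. Hence \<open>|D| \<le> |z| |D|\<close>,
  which forces \<open>D = 0\<close>.\<close>

lemma point_eval_toeplitz: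
  fixes F :: "complex \<Rightarrow> 'a::chilbert_space \<Rightarrow>\<^sub>C\<^sub>L 'b::chilbert_space"
  assumes F: "schur_class F" and z: "cmod z < 1"
  shows "point_eval z *\<^sub>V toeplitz F *\<^sub>V x = F z *\<^sub>V point_eval z *\<^sub>V x"
proof -
  define D where "D = point_eval z o\<^sub>C\<^sub>L toeplitz F - F z o\<^sub>C\<^sub>L point_eval z"
  have "ell2_nth (toeplitz F *\<^sub>V embed0 *\<^sub>V u) n = taylor_coeffs F n *\<^sub>V u" for u n
  proof -
    have "ell2_nth (toeplitz F *\<^sub>V embed0 *\<^sub>V u) n = (\<Sum>k\<le>n. if k = 0 then taylor_coeffs F n *\<^sub>V u else 0)"
      unfolding toeplitz_nth[OF F] by (intro sum.cong) auto
    then show ?thesis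
      by simp
  qed
  then have "point_eval z *\<^sub>V toeplitz F *\<^sub>V embed0 *\<^sub>V u = F z *\<^sub>V u" for u
    using point_eval_sums[OF z, of "toeplitz F *\<^sub>V embed0 *\<^sub>V u"]
      bounded_linear.sums[OF bounded_linear_apply_arg[of u] taylor_coeffs(2)[OF F z]]
    by (simp add: sums_unique2)
  then have D_embed0: "D *\<^sub>V embed0 *\<^sub>V u = 0" for u
    by (simp add: D_def z)
  have "norm (D *\<^sub>V x) \<le> cmod z * norm D * norm x" for x
  proof -
    have "D *\<^sub>V shift *\<^sub>V y = z *\<^sub>C (D *\<^sub>V y)" for y
      by (simp add: D_def toeplitz_shift[OF F] point_eval_shift[OF z] scaleC_diff_right)
    then have "D *\<^sub>V x = z *\<^sub>C (D *\<^sub>V shift* *\<^sub>V x)"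
      using arg_cong[OF ell2_decompose[of x], of "cblinfun_apply D"]
      by (simp add: cblinfun_apply_add D_embed0)
    moreover have "norm (D *\<^sub>V shift* *\<^sub>V x) \<le> norm D * norm x"
      by (rule order_trans[OF norm_cblinfun mult_left_mono[OF norm_adj_shift_le norm_ge_zero]])
    ultimately show ?thesis
      by (simp add: norm_scaleC mult.assoc mult_left_mono)
  qed
  then have "norm D \<le> cmod z * norm D"
    by (intro norm_cblinfun_bound) simp_all
  then have "D = 0"
    using z by (metis mult_le_cancel_right1 norm_le_zero_iff not_le)
  then show ?thesis
    by (metis D_def comp_op_apply eq_iff_diff_eq_0)
qed


section \<open>The state space identities\<close>

locale lifting_problem =
  fixes H :: "'y::chilbert_space ell2 set"
    and A :: "'u::chilbert_space ell2 \<Rightarrow>\<^sub>C\<^sub>L 'y ell2"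
    and \<Theta> :: "complex \<Rightarrow> 'e::chilbert_space \<Rightarrow>\<^sub>C\<^sub>L 'y"
    and C :: "'y ell2 \<Rightarrow>\<^sub>C\<^sub>L 'e"
    and Q :: "'e \<Rightarrow>\<^sub>C\<^sub>L 'e" and R :: "'u \<Rightarrow>\<^sub>C\<^sub>L 'u"
  assumes data: "commutant_lifting_data H A"
    and strict: "norm A < 1"
    and \<Theta>_inner: "inner_function \<Theta>"
    and \<Theta>_range: "orth_complement H = range (cblinfun_apply (toeplitz \<Theta>))"
    and C_eq: "C = embed0* o\<^sub>C\<^sub>L (toeplitz \<Theta>)* o\<^sub>C\<^sub>L shift o\<^sub>C\<^sub>L proj H"
    and Q_eq: "Q = inv_sqrt_op (id_op + C o\<^sub>C\<^sub>L A o\<^sub>C\<^sub>L inverse_op (id_op - A* o\<^sub>C\<^sub>L A) o\<^sub>C\<^sub>L A* o\<^sub>C\<^sub>L C*)"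
    and R_eq: "R = inv_sqrt_op (embed0* o\<^sub>C\<^sub>L inverse_op (id_op - A* o\<^sub>C\<^sub>L A) o\<^sub>C\<^sub>L embed0)"
begin

section \<open>Relations between \<open>A\<close>, \<open>\<Theta>\<close> and the shift\<close>

abbreviation "P \<equiv> proj H"
abbreviation "T \<equiv> toeplitz \<Theta>"
definition "\<Omega> = id_op - A* o\<^sub>C\<^sub>L A"
definition "\<Delta> = inverse_op \<Omega>"
definition "W = A* o\<^sub>C\<^sub>L C*"
definition "Qinv = sqrt_op (id_op + W* o\<^sub>C\<^sub>L \<Delta> o\<^sub>C\<^sub>L W)"
definition "Rinv = sqrt_op (embed0* o\<^sub>C\<^sub>L \<Delta> o\<^sub>C\<^sub>L embed0)"

lemma \<Theta>_schur: "schur_class \<Theta>"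
  using \<Theta>_inner by (simp add: inner_function_def)

lemma H_closed: "closed_csubspace H"
  using data by (simp add: commutant_lifting_data_def)

lemmas P_adj [simp] = proj_self_adjoint[OF H_closed]

lemma T_adj_T [simp]: "T* *\<^sub>V T *\<^sub>V x = x"
proof -
  have "T* o\<^sub>C\<^sub>L T = id_op"
  proof (rule cblinfun_eqI_quadratic)
    fix x
    have "norm (T *\<^sub>V x) = norm x"
      using \<Theta>_inner by (simp add: inner_function_def isometry_op_def)
    then show "cinner ((T* o\<^sub>C\<^sub>L T) *\<^sub>V x) x = cinner (id_op *\<^sub>V x) x"
      by (simp add: cinner_adj_left cinner_same)
  qed
  from arg_cong[OF this, of "\<lambda>S. S *\<^sub>V x"] show ?thesis
    by simp
qed

lemma P_T [simp]: "P *\<^sub>V T *\<^sub>V x = 0"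
proof (rule proj_apply_eq[OF H_closed])
  show "0 \<in> H"
    using H_closed by (simp add: closed_csubspace_def csubspace_def)
  show "T *\<^sub>V x - 0 \<in> orth_complement H"
    by (simp add: \<Theta>_range)
qed

lemma T_adj_P [simp]: "T* *\<^sub>V P *\<^sub>V x = 0"
  by (rule cinner_eqI) (simp add: cinner_adj_left cinner_adj[of P])

lemma P_plus_T: "P *\<^sub>V x + T *\<^sub>V T* *\<^sub>V x = x"
proof -
  have "x - P *\<^sub>V x \<in> range (cblinfun_apply T)"
    using proj_properties(2)[OF H_closed] by (simp add: \<Theta>_range)
  then obtain y where y: "x - P *\<^sub>V x = T *\<^sub>V y"
    by blast
  from arg_cong[OF this, of "cblinfun_apply (T*)"] have "y = T* *\<^sub>V x"
    by (simp add: cblinfun_apply_diff)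
  with y show ?thesis
    by (simp add: algebra_simps)
qed

lemma P_A [simp]: "P *\<^sub>V A *\<^sub>V x = A *\<^sub>V x"
  using data by (intro proj_idem[OF H_closed]) (auto simp: commutant_lifting_data_def)

lemma A_adj_P [simp]: "A* *\<^sub>V P *\<^sub>V x = A* *\<^sub>V x"
  by (rule cinner_eqI) (simp add: cinner_adj_left cinner_adj[of P])

lemma T_adj_A [simp]: "T* *\<^sub>V A *\<^sub>V x = 0"
  using T_adj_P[of "A *\<^sub>V x"] by simp

lemma shift_adj_T_adj: "shift* *\<^sub>V T* *\<^sub>V x = T* *\<^sub>V shift* *\<^sub>V x"
  by (rule cinner_eqI) (simp add: cinner_adj_left toeplitz_shift[OF \<Theta>_schur])

text \<open>\<open>T*\<close> commutes with the backward shift and therefore annihilates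
  \<open>S* T E u\<close>. So this vector lies in \<open>H\<close>, where the definition of
  \<open>C\<close> applies.\<close>

lemma shift_adj_T_embed0: "shift* *\<^sub>V T *\<^sub>V embed0 *\<^sub>V u = C* *\<^sub>V u"
proof -
  have "T* *\<^sub>V shift* *\<^sub>V T *\<^sub>V embed0 *\<^sub>V u = 0"
    by (simp flip: shift_adj_T_adj)
  then show ?thesis
    using P_plus_T[of "shift* *\<^sub>V T *\<^sub>V embed0 *\<^sub>V u"] by (simp add: C_eq)
qed

lemma T_embed0: "T *\<^sub>V embed0 *\<^sub>V u = embed0 *\<^sub>V \<Theta> 0 *\<^sub>V u + shift *\<^sub>V C* *\<^sub>V u"
  using ell2_decompose[of "T *\<^sub>V embed0 *\<^sub>V u"] point_eval_toeplitz[OF \<Theta>_schur, of 0 "embed0 *\<^sub>V u"]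
  by (simp add: shift_adj_T_embed0)

lemma W_adj: "W* *\<^sub>V x = C *\<^sub>V A *\<^sub>V x"
  by (simp add: W_def)

lemma C_A: "C *\<^sub>V A *\<^sub>V x = ell2_nth (T* *\<^sub>V shift *\<^sub>V A *\<^sub>V x) 0"
  by (simp add: C_eq)

text \<open>\<open>A S\<close> is the part of \<open>S A\<close> in \<open>H\<close>. The
  complementary part \<open>T T* S A x\<close> comes from a constant sequence, since
  \<open>S* T* S A x = T* A x = 0\<close>. Thus \<open>W*\<close> measures how far \<open>A\<close>
  is from commuting with the shifts.\<close>

lemma A_shift: "A *\<^sub>V shift *\<^sub>V x = shift *\<^sub>V A *\<^sub>V x - T *\<^sub>V embed0 *\<^sub>V W* *\<^sub>V x"
proof -
  have "A o\<^sub>C\<^sub>L shift = P o\<^sub>C\<^sub>L shift o\<^sub>C\<^sub>L P o\<^sub>C\<^sub>L A"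
    using data by (simp add: commutant_lifting_data_def compressed_shift_def)
  from arg_cong[OF this, of "\<lambda>S. S *\<^sub>V x"] have "A *\<^sub>V shift *\<^sub>V x = P *\<^sub>V shift *\<^sub>V A *\<^sub>V x"
    by simp
  moreover have "T* *\<^sub>V shift *\<^sub>V A *\<^sub>V x = embed0 *\<^sub>V W* *\<^sub>V x"
    using ell2_decompose[of "T* *\<^sub>V shift *\<^sub>V A *\<^sub>V x"] by (simp add: shift_adj_T_adj W_adj C_A)
  ultimately show ?thesis
    using P_plus_T[of "shift *\<^sub>V A *\<^sub>V x"] by (simp add: eq_diff_eq)
qed

lemma A_adj_shift_adj: "A* *\<^sub>V shift* *\<^sub>V x = shift* *\<^sub>V A* *\<^sub>V x + W *\<^sub>V ell2_nth (T* *\<^sub>V x) 0"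
proof (rule cinner_eqI_right)
  fix y
  have "cinner y (A* *\<^sub>V shift* *\<^sub>V x) = cinner (shift *\<^sub>V A *\<^sub>V y) x"
    by (simp add: cinner_adj)
  also have "\<dots> = cinner (A *\<^sub>V shift *\<^sub>V y) x + cinner (T *\<^sub>V embed0 *\<^sub>V W* *\<^sub>V y) x"
    by (simp add: A_shift cinner_linear)
  also have "\<dots> = cinner y (shift* *\<^sub>V A* *\<^sub>V x + W *\<^sub>V ell2_nth (T* *\<^sub>V x) 0)"
    by (simp add: cinner_adj cinner_adj_left cinner_add_right del: adj_embed0 flip: adj_embed0)
  finally show "cinner y (A* *\<^sub>V shift* *\<^sub>V x) = cinner y (shift* *\<^sub>V A* *\<^sub>V x + W *\<^sub>V ell2_nth (T* *\<^sub>V x) 0)" .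
qed

section \<open>The operator \<open>I - A* A\<close> and its inverse\<close>

lemma \<Omega>_apply: "\<Omega> *\<^sub>V x = x - A* *\<^sub>V A *\<^sub>V x"
  by (simp add: \<Omega>_def)

lemma \<Omega>_invertible: "invertible_op \<Omega>"
  unfolding \<Omega>_def
proof (rule invertible_id_minus)
  have "norm (A* o\<^sub>C\<^sub>L A) \<le> norm A * norm A"
    using norm_comp_op_le[of "A*" A] by simp
  also have "\<dots> < 1"
    using strict mult_left_le[of "norm A" "norm A"] by simp
  finally show "norm (A* o\<^sub>C\<^sub>L A) < 1" .
qed

lemma \<Omega>_\<Delta> [simp]: "\<Omega> *\<^sub>V \<Delta> *\<^sub>V x = x" "\<Delta> *\<^sub>V \<Omega> *\<^sub>V x = x"
  by (simp_all add: \<Delta>_def \<Omega>_invertible)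

lemma \<Delta>_adj [simp]: "\<Delta>* = \<Delta>"
  unfolding \<Delta>_def inverse_op_adj[OF \<Omega>_invertible, symmetric] by (simp add: \<Omega>_def)

lemma \<Delta>_eq: "\<Delta> *\<^sub>V x = x + A* *\<^sub>V A *\<^sub>V \<Delta> *\<^sub>V x" "\<Delta> *\<^sub>V x = x + \<Delta> *\<^sub>V A* *\<^sub>V A *\<^sub>V x"
  using \<Omega>_\<Delta>[of x] by (simp_all add: \<Omega>_apply cblinfun_apply_diff diff_eq_eq)

lemma cinner_\<Omega>: "cinner (\<Omega> *\<^sub>V w) w = cinner w w - cinner (A *\<^sub>V w) (A *\<^sub>V w)"
  by (simp add: \<Omega>_apply cinner_linear cinner_adj_left)

text \<open>With \<open>w\<close> and \<open>g\<close> as below,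
  \<open>|v|^2 - |h|^2 = (|w|^2 - |A w|^2) - (|g|^2 - |A* g|^2)\<close>, and the last bracket is
  non-negative. The case \<open>h = 0\<close> is \<open>\<Delta> \<ge> I\<close>; the general case
  compares \<open>pform\<close> with the form of \<open>J\<close>.\<close>

lemma \<Delta>_lower_bound:
  "(norm v)\<^sup>2 - (norm h)\<^sup>2 \<le> Re (cinner (\<Delta> *\<^sub>V (A* *\<^sub>V h + v)) (A* *\<^sub>V h + v))"
proof -
  define w where "w = \<Delta> *\<^sub>V (A* *\<^sub>V h + v)"
  define g where "g = A *\<^sub>V w + h"
  have p: "A* *\<^sub>V h + v = \<Omega> *\<^sub>V w"
    by (simp add: w_def)
  have v: "v = w - A* *\<^sub>V g" and h: "h = g - A *\<^sub>V w"
    using p by (simp_all add: g_def \<Omega>_apply cblinfun_apply_add algebra_simps)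
  have "Re (cinner (A* *\<^sub>V g) w) = Re (cinner w (A* *\<^sub>V g))" "Re (cinner (A *\<^sub>V w) g) = Re (cinner g (A *\<^sub>V w))"
    by (subst cinner_commute, simp)+
  moreover have "cinner w (A* *\<^sub>V g) = cinner (A *\<^sub>V w) g"
    by (simp add: cinner_adj)
  ultimately have "(norm v)\<^sup>2 - (norm h)\<^sup>2 = (norm w)\<^sup>2 - (norm (A *\<^sub>V w))\<^sup>2 + ((norm (A* *\<^sub>V g))\<^sup>2 - (norm g)\<^sup>2)"
    unfolding v h norm_sq_cinner by (simp add: cinner_linear)
  also have "(norm (A* *\<^sub>V g))\<^sup>2 \<le> (norm g)\<^sup>2"
    using norm_cblinfun_le[of "A*" 1 g] strict by (intro power_mono) simp_all
  finally have "(norm v)\<^sup>2 - (norm h)\<^sup>2 \<le> Re (cinner (\<Omega> *\<^sub>V w) w)"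
    unfolding cinner_\<Omega> by (simp add: cinner_same)
  moreover have "cinner (\<Omega> *\<^sub>V w) w = cinner w (\<Omega> *\<^sub>V w)"
    using cinner_adj[of \<Omega> w w] by (simp add: \<Omega>_def)
  ultimately show ?thesis
    by (simp add: p)
qed

lemma \<Delta>_ge_id: "(norm x)\<^sup>2 \<le> Re (cinner (\<Delta> *\<^sub>V x) x)"
  using \<Delta>_lower_bound[of x 0] by simp

lemma \<Delta>_nonneg: "nonneg_op \<Delta>"
  by (rule nonneg_opI) (simp, rule order_trans[OF zero_le_power2 \<Delta>_ge_id])

lemma strictly_positive_M: "strictly_positive_op (id_op + W* o\<^sub>C\<^sub>L \<Delta> o\<^sub>C\<^sub>L W)"
proof -
  have nn: "nonneg_op (W* o\<^sub>C\<^sub>L \<Delta> o\<^sub>C\<^sub>L W)"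
    by (rule nonneg_op_compress[OF \<Delta>_nonneg])
  have lower: "(norm x)\<^sup>2 \<le> Re (cinner ((id_op + W* o\<^sub>C\<^sub>L \<Delta> o\<^sub>C\<^sub>L W) *\<^sub>V x) x)" for x
    using Re_nonneg_op[OF nn, of x] by (simp add: cinner_add_left cinner_same)
  have nn': "nonneg_op (id_op + W* o\<^sub>C\<^sub>L \<Delta> o\<^sub>C\<^sub>L W)"
    by (rule nonneg_opI) (simp add: comp_op_assoc, rule order_trans[OF zero_le_power2 lower])
  show ?thesis
    unfolding strictly_positive_op_def using nn' invertible_coercive[OF nn' lower] by (rule conjI)
qed

lemma strictly_positive_B: "strictly_positive_op (embed0* o\<^sub>C\<^sub>L \<Delta> o\<^sub>C\<^sub>L embed0)"
proof -
  have nn: "nonneg_op (embed0* o\<^sub>C\<^sub>L \<Delta> o\<^sub>C\<^sub>L embed0)"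
    by (rule nonneg_op_compress[OF \<Delta>_nonneg])
  have lower: "(norm x)\<^sup>2 \<le> Re (cinner ((embed0* o\<^sub>C\<^sub>L \<Delta> o\<^sub>C\<^sub>L embed0) *\<^sub>V x) x)" for x
  proof -
    have "(norm (embed0 *\<^sub>V x))\<^sup>2 = (norm x)\<^sup>2"
      unfolding norm_sq_cinner cinner_adj by simp
    then show ?thesis
      using \<Delta>_ge_id[of "embed0 *\<^sub>V x"] by (simp add: cinner_adj_left del: adj_embed0)
  qed
  show ?thesis
    unfolding strictly_positive_op_def using nn invertible_coercive[OF nn lower] by (rule conjI)
qed

lemma Q_inv_sqrt: "Q = inv_sqrt_op (id_op + W* o\<^sub>C\<^sub>L \<Delta> o\<^sub>C\<^sub>L W)"
  unfolding Q_eq W_def \<Delta>_def \<Omega>_def by (simp add: comp_op_assoc)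

lemma R_inv_sqrt: "R = inv_sqrt_op (embed0* o\<^sub>C\<^sub>L \<Delta> o\<^sub>C\<^sub>L embed0)"
  unfolding R_eq \<Delta>_def \<Omega>_def ..

lemma Q_simps [simp]: "Q *\<^sub>V Qinv *\<^sub>V x = x" "Qinv *\<^sub>V Q *\<^sub>V x = x" "Q* = Q" "Qinv* = Qinv"
  and Qinv_Qinv: "Qinv *\<^sub>V Qinv *\<^sub>V x = x + W* *\<^sub>V \<Delta> *\<^sub>V W *\<^sub>V x"
  and Q_pos: "strictly_positive_op Q"
  unfolding Q_inv_sqrt Qinv_def by (simp_all add: inv_sqrt_op[OF strictly_positive_M])

lemma R_simps [simp]: "R *\<^sub>V Rinv *\<^sub>V x = x" "Rinv *\<^sub>V R *\<^sub>V x = x" "R* = R"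
  and Rinv_Rinv: "Rinv *\<^sub>V Rinv *\<^sub>V x = ell2_nth (\<Delta> *\<^sub>V embed0 *\<^sub>V x) 0"
  and R_pos: "strictly_positive_op R"
  unfolding R_inv_sqrt Rinv_def by (simp_all add: inv_sqrt_op[OF strictly_positive_B])

text \<open>By \<open>A_shift\<close>, \<open>S A x\<close> splits orthogonally into
  \<open>A S x\<close> in \<open>H\<close> and \<open>T E W* x\<close> in its complement, so
  \<open>|A S x|^2 = |A x|^2 - |W* x|^2\<close>.\<close>

lemma shift_adj_\<Omega>_shift: "shift* *\<^sub>V \<Omega> *\<^sub>V shift *\<^sub>V x = \<Omega> *\<^sub>V x + W *\<^sub>V W* *\<^sub>V x"
proof -
  have "shift* *\<^sub>V A* *\<^sub>V A *\<^sub>V shift *\<^sub>V x = A* *\<^sub>V shift* *\<^sub>V A *\<^sub>V shift *\<^sub>V x - W *\<^sub>V ell2_nth (T* *\<^sub>V A *\<^sub>V shift *\<^sub>V x) 0"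
    by (simp only: A_adj_shift_adj add_diff_cancel_right')
  also have "\<dots> = A* *\<^sub>V A *\<^sub>V x - A* *\<^sub>V C* *\<^sub>V W* *\<^sub>V x"
    by (simp only: T_adj_A)
      (simp add: A_shift cblinfun_apply_diff shift_adj_T_embed0)
  finally show ?thesis
    by (simp add: \<Omega>_apply cblinfun_apply_diff W_def)
qed

text \<open>Block inversion of \<open>\<Omega>\<close> along the constants and the range of the
  shift: \<open>R R\<close> inverts the corner \<open>E* \<Delta> E\<close>, and \<open>Q Q\<close>
  appears on inverting the compression \<open>S* \<Omega> S = \<Omega> + W W*\<close>.\<close>

lemma \<Delta>_displacement:
  "\<Delta> *\<^sub>V x - shift *\<^sub>V \<Delta> *\<^sub>V shift* *\<^sub>V x
    = \<Delta> *\<^sub>V embed0 *\<^sub>V R *\<^sub>V R *\<^sub>V ell2_nth (\<Delta> *\<^sub>V x) 0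
      - shift *\<^sub>V \<Delta> *\<^sub>V W *\<^sub>V Q *\<^sub>V Q *\<^sub>V W* *\<^sub>V \<Delta> *\<^sub>V shift* *\<^sub>V x"
proof -
  define w where "w = \<Delta> *\<^sub>V x"
  \<comment> \<open>\<open>u\<close> is chosen so that \<open>\<Delta> E u\<close> has the zeroth
    coordinate of \<open>w\<close>. What remains of \<open>w\<close> is a shift \<open>S v\<close>,
    and \<open>S*\<close> kills the contribution \<open>E u\<close> of the first part to
    \<open>\<Omega> w\<close>.\<close>
  define u where "u = R *\<^sub>V R *\<^sub>V ell2_nth w 0"
  define v where "v = shift* *\<^sub>V (w - \<Delta> *\<^sub>V embed0 *\<^sub>V u)"
  have "ell2_nth (\<Delta> *\<^sub>V embed0 *\<^sub>V u) 0 = ell2_nth w 0"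
    unfolding Rinv_Rinv[symmetric] by (simp add: u_def)
  then have w: "w = \<Delta> *\<^sub>V embed0 *\<^sub>V u + shift *\<^sub>V v"
    using ell2_decompose[of "w - \<Delta> *\<^sub>V embed0 *\<^sub>V u"] by (simp add: v_def)
  have "x = \<Omega> *\<^sub>V w"
    by (simp add: w_def)
  then have x: "shift* *\<^sub>V x = \<Omega> *\<^sub>V v + W *\<^sub>V W* *\<^sub>V v"
    by (subst (asm) w) (simp add: cblinfun_apply_add shift_adj_\<Omega>_shift)
  have "Q *\<^sub>V Q *\<^sub>V W* *\<^sub>V \<Delta> *\<^sub>V shift* *\<^sub>V x = Q *\<^sub>V Q *\<^sub>V Qinv *\<^sub>V Qinv *\<^sub>V W* *\<^sub>V v"
    unfolding x Qinv_Qinv by (simp add: cblinfun_apply_add)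
  then have 1: "Q *\<^sub>V Q *\<^sub>V W* *\<^sub>V \<Delta> *\<^sub>V shift* *\<^sub>V x = W* *\<^sub>V v"
    by simp
  have 2: "shift *\<^sub>V \<Delta> *\<^sub>V shift* *\<^sub>V x = shift *\<^sub>V v + shift *\<^sub>V \<Delta> *\<^sub>V W *\<^sub>V W* *\<^sub>V v"
    unfolding x by (simp add: cblinfun_apply_add)
  have 3: "\<Delta> *\<^sub>V x = \<Delta> *\<^sub>V embed0 *\<^sub>V u + shift *\<^sub>V v"
    unfolding w_def[symmetric] by (rule w)
  have 4: "R *\<^sub>V R *\<^sub>V ell2_nth (\<Delta> *\<^sub>V x) 0 = u"
    by (simp add: u_def w_def)
  show ?thesis
    unfolding 1 2 4 unfolding 3 by simp
qed

text \<open>In this form the columns visibly lie in \<open>M\<close>: \<open>P Y11 = A Y21\<close>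
  and \<open>Y12 = A Y22\<close>. \<open>Y11_apply\<close> recovers the shape used in the
  theorem.\<close>

definition "Y11 = T o\<^sub>C\<^sub>L embed0 o\<^sub>C\<^sub>L Qinv + A o\<^sub>C\<^sub>L shift o\<^sub>C\<^sub>L \<Delta> o\<^sub>C\<^sub>L W o\<^sub>C\<^sub>L Q"
definition "Y12 = A o\<^sub>C\<^sub>L \<Delta> o\<^sub>C\<^sub>L embed0 o\<^sub>C\<^sub>L R"
definition "Y21 = shift o\<^sub>C\<^sub>L \<Delta> o\<^sub>C\<^sub>L W o\<^sub>C\<^sub>L Q"
definition "Y22 = \<Delta> o\<^sub>C\<^sub>L embed0 o\<^sub>C\<^sub>L R"

text \<open>The form \<open>\<langle>\<Pi>J (x, v), (x, v)\<rangle>\<close>, since \<open>\<Pi>J = T\<^sub>\<Theta> T\<^sub>\<Theta>* - (A, I) \<Delta> (A, I)*\<close>.\<close>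

definition pform :: "'y ell2 \<Rightarrow> 'u ell2 \<Rightarrow> complex" where
  "pform x v = cinner (T* *\<^sub>V x) (T* *\<^sub>V x) - cinner (\<Delta> *\<^sub>V (A* *\<^sub>V x + v)) (A* *\<^sub>V x + v)"

text \<open>Passing from \<open>x\<close> to \<open>S* x\<close> removes the zeroth coordinate
  \<open>t\<close> of \<open>T* x\<close> and, because \<open>A*\<close> commutes with
  \<open>S*\<close> only up to \<open>W\<close>, moves \<open>A* x + v\<close> to
  \<open>q + W t\<close>. Completing the square in \<open>t\<close> and \<open>w\<close> gives the
  first square; \<open>\<Delta>_displacement\<close> gives the second.\<close>

lemma pform_displacement:
  "pform x v - pform (shift* *\<^sub>V x) (shift* *\<^sub>V v)
    = cinner (Y11* *\<^sub>V x + Y21* *\<^sub>V v) (Y11* *\<^sub>V x + Y21* *\<^sub>V v)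
      - cinner (Y12* *\<^sub>V x + Y22* *\<^sub>V v) (Y12* *\<^sub>V x + Y22* *\<^sub>V v)"
proof -
  define t where "t = ell2_nth (T* *\<^sub>V x) 0"
  define p where "p = A* *\<^sub>V x + v"
  define q where "q = shift* *\<^sub>V p"
  define w where "w = W* *\<^sub>V \<Delta> *\<^sub>V q"
  have tt: "cinner (T* *\<^sub>V x) (T* *\<^sub>V x) = cinner t t + cinner (T* *\<^sub>V shift* *\<^sub>V x) (T* *\<^sub>V shift* *\<^sub>V x)"
  proof -
    have "cinner (T* *\<^sub>V x) (T* *\<^sub>V x) = cinner (embed0 *\<^sub>V t + shift *\<^sub>V shift* *\<^sub>V T* *\<^sub>V x) (T* *\<^sub>V x)"
      using ell2_decompose[of "T* *\<^sub>V x"] by (simp add: t_def)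
    also have "\<dots> = cinner t t + cinner (shift* *\<^sub>V T* *\<^sub>V x) (shift* *\<^sub>V T* *\<^sub>V x)"
      by (simp add: cinner_add_left cinner_adj t_def)
    finally show ?thesis
      by (simp add: shift_adj_T_adj)
  qed
  have p': "A* *\<^sub>V shift* *\<^sub>V x + shift* *\<^sub>V v = q + W *\<^sub>V t"
    by (simp add: A_adj_shift_adj q_def p_def t_def cblinfun_apply_add)
  have y1: "Y11* *\<^sub>V x + Y21* *\<^sub>V v = Qinv *\<^sub>V t + Q *\<^sub>V w"
    by (simp add: Y11_def Y21_def t_def w_def q_def p_def cblinfun_apply_add)
  have y2: "Y12* *\<^sub>V x + Y22* *\<^sub>V v = R *\<^sub>V ell2_nth (\<Delta> *\<^sub>V p) 0"
    by (simp add: Y12_def Y22_def p_def cblinfun_apply_add)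
  have "cinner (\<Delta> *\<^sub>V p - shift *\<^sub>V \<Delta> *\<^sub>V q) p
      = cinner (\<Delta> *\<^sub>V embed0 *\<^sub>V R *\<^sub>V R *\<^sub>V ell2_nth (\<Delta> *\<^sub>V p) 0 - shift *\<^sub>V \<Delta> *\<^sub>V W *\<^sub>V Q *\<^sub>V Q *\<^sub>V w) p"
    unfolding q_def w_def \<Delta>_displacement ..
  moreover have "cinner (shift *\<^sub>V y) p = cinner y q" for y
    by (simp add: cinner_adj q_def)
  moreover have "cinner (\<Delta> *\<^sub>V W *\<^sub>V y) q = cinner y w" for y
    by (simp add: cinner_adj w_def)
  moreover have "cinner (\<Delta> *\<^sub>V embed0 *\<^sub>V y) p = cinner y (ell2_nth (\<Delta> *\<^sub>V p) 0)" for y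
    by (simp add: cinner_adj)
  moreover have "cinner (R *\<^sub>V R *\<^sub>V y) y = cinner (R *\<^sub>V y) (R *\<^sub>V y)"
    "cinner (Q *\<^sub>V Q *\<^sub>V y') y' = cinner (Q *\<^sub>V y') (Q *\<^sub>V y')" for y y'
    using cinner_adj[of R "R *\<^sub>V y" y] cinner_adj[of Q "Q *\<^sub>V y'" y'] by simp_all
  ultimately have star: "cinner (\<Delta> *\<^sub>V p) p - cinner (\<Delta> *\<^sub>V q) q
      = cinner (R *\<^sub>V ell2_nth (\<Delta> *\<^sub>V p) 0) (R *\<^sub>V ell2_nth (\<Delta> *\<^sub>V p) 0) - cinner (Q *\<^sub>V w) (Q *\<^sub>V w)"
    by (simp add: cinner_diff_left)
  have "cinner (\<Delta> *\<^sub>V (q + W *\<^sub>V t)) (q + W *\<^sub>V t)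
      = cinner (\<Delta> *\<^sub>V q) q + cinner w t + cinner t w + cinner (W* *\<^sub>V \<Delta> *\<^sub>V W *\<^sub>V t) t"
  proof -
    have "cinner (\<Delta> *\<^sub>V q) (W *\<^sub>V t) = cinner w t"
      by (simp add: w_def cinner_adj_left)
    moreover have "cinner (\<Delta> *\<^sub>V W *\<^sub>V t) q = cinner t w"
      by (simp add: cinner_adj w_def)
    moreover have "cinner (\<Delta> *\<^sub>V W *\<^sub>V t) (W *\<^sub>V t) = cinner (W* *\<^sub>V \<Delta> *\<^sub>V W *\<^sub>V t) t"
      by (simp add: cinner_adj_left)
    ultimately show ?thesis
      by (simp add: cblinfun_apply_add cinner_linear)
  qed
  \<comment> \<open>The cross terms come from \<open>Qinv Q = I\<close>, the terms in
    \<open>t\<close> alone from \<open>Qinv Qinv = I + W* \<Delta> W\<close>.\<close>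
  moreover have "cinner (Qinv *\<^sub>V t + Q *\<^sub>V w) (Qinv *\<^sub>V t + Q *\<^sub>V w)
      = cinner t t + cinner (W* *\<^sub>V \<Delta> *\<^sub>V W *\<^sub>V t) t + cinner w t + cinner t w + cinner (Q *\<^sub>V w) (Q *\<^sub>V w)"
  proof -
    have "cinner (Qinv *\<^sub>V t) (Qinv *\<^sub>V t) = cinner t t + cinner (W* *\<^sub>V \<Delta> *\<^sub>V W *\<^sub>V t) t"
      using cinner_adj[of Qinv "Qinv *\<^sub>V t" t] by (simp add: Qinv_Qinv cinner_add_left)
    moreover have "cinner (Qinv *\<^sub>V t) (Q *\<^sub>V w) = cinner t w" "cinner (Q *\<^sub>V w) (Qinv *\<^sub>V t) = cinner w t"
      by (simp_all add: cinner_adj)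
    ultimately show ?thesis
      by (simp add: cinner_linear)
  qed
  ultimately show ?thesis
    unfolding pform_def p' y1 y2 tt p_def[symmetric] using star by (simp add: algebra_simps)
qed

text \<open>The \<open>J\<close>-orthogonal complement of \<open>M\<close> consists of the vectors
  \<open>(h, A* h)\<close> with \<open>h\<close> in \<open>H\<close>, on which \<open>J\<close> is
  non-negative. In coordinates this is \<open>\<Delta>_lower_bound\<close> with
  \<open>h = P x\<close>.\<close>

lemma Re_pform_le: "Re (pform x v) \<le> (norm x)\<^sup>2 - (norm v)\<^sup>2"
proof -
  have "cinner x x = cinner (P *\<^sub>V x) x + cinner (T *\<^sub>V T* *\<^sub>V x) x"
    by (simp add: P_plus_T flip: cinner_add_left)
  moreover have "cinner (P *\<^sub>V x) x = cinner (P *\<^sub>V x) (P *\<^sub>V x)"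
  proof -
    have "P *\<^sub>V P *\<^sub>V x = P *\<^sub>V x"
      by (rule proj_idem[OF H_closed proj_properties(1)[OF H_closed]])
    then show ?thesis
      using cinner_adj[of P "P *\<^sub>V x" x] by simp
  qed
  ultimately have "Re (cinner (T* *\<^sub>V x) (T* *\<^sub>V x)) = (norm x)\<^sup>2 - (norm (P *\<^sub>V x))\<^sup>2"
    by (simp add: cinner_adj norm_sq_cinner)
  then show ?thesis
    using \<Delta>_lower_bound[of v "P *\<^sub>V x"] by (simp add: pform_def)
qed

section \<open>The coefficients at points of the disc\<close>

definition "U11 z = point_eval z o\<^sub>C\<^sub>L Y11"
definition "U12 z = point_eval z o\<^sub>C\<^sub>L Y12"
definition "U21 z = point_eval z o\<^sub>C\<^sub>L Y21"
definition "U22 z = point_eval z o\<^sub>C\<^sub>L Y22"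

text \<open>On the kernel functions at \<open>z\<close> the displacement is multiplication by
  \<open>1 - |z|^2\<close>, and the same factor turns the squared norms of the kernels into those of
  \<open>y\<close> and \<open>u\<close>. So \<open>Re_pform_le\<close> becomes a pointwise
  inequality.\<close>

lemma kernel_inequality:
  assumes z: "cmod z < 1"
  shows "(norm ((U11 z)* *\<^sub>V y + (U21 z)* *\<^sub>V u))\<^sup>2 - (norm ((U12 z)* *\<^sub>V y + (U22 z)* *\<^sub>V u))\<^sup>2
    \<le> (norm y)\<^sup>2 - (norm u)\<^sup>2"
proof -
  define x where "x = (point_eval z)* *\<^sub>V y"
  define v where "v = (point_eval z)* *\<^sub>V u"
  define s where "s = 1 - (cmod z)\<^sup>2"
  have s: "0 < s" "1 - z * cnj z = of_real s"
    using z by (simp_all add: s_def abs_square_less_1 flip: complex_norm_square)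
  have "pform (shift* *\<^sub>V x) (shift* *\<^sub>V v) = z * cnj z * pform x v"
    unfolding x_def v_def adj_shift_kernel[OF z] pform_def
    by (simp add: right_diff_distrib flip: scaleC_add_right)
  then have "of_real s * pform x v = pform x v - pform (shift* *\<^sub>V x) (shift* *\<^sub>V v)"
    by (simp add: algebra_simps flip: s(2))
  then have "of_real s * pform x v = of_real ((norm ((U11 z)* *\<^sub>V y + (U21 z)* *\<^sub>V u))\<^sup>2
      - (norm ((U12 z)* *\<^sub>V y + (U22 z)* *\<^sub>V u))\<^sup>2)"
    unfolding pform_displacement by (simp add: U11_def U12_def U21_def U22_def x_def v_def cinner_same)
  from arg_cong[OF this, of Re]
  have "(norm ((U11 z)* *\<^sub>V y + (U21 z)* *\<^sub>V u))\<^sup>2 - (norm ((U12 z)* *\<^sub>V y + (U22 z)* *\<^sub>V u))\<^sup>2 = s * Re (pform x v)"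
    by simp
  also have "\<dots> \<le> s * ((norm x)\<^sup>2 - (norm v)\<^sup>2)"
    using s(1) Re_pform_le by (intro mult_left_mono) auto
  also have "\<dots> = (norm y)\<^sup>2 - (norm u)\<^sup>2"
    unfolding s_def x_def v_def right_diff_distrib norm_kernel[OF z] ..
  finally show ?thesis .
qed

lemma analytic_U: "analytic_on_disc U11" "analytic_on_disc U12" "analytic_on_disc U21" "analytic_on_disc U22"
  unfolding U11_def[abs_def] U12_def[abs_def] U21_def[abs_def] U22_def[abs_def]
  by (intro analytic_comp_op analytic_point_eval analytic_const)+

text \<open>\<open>kernel_inequality\<close> with \<open>y = 0\<close> bounds the adjoint below,
  which yields surjectivity only. Invertibility comes from the origin and is carried along the
  segment to \<open>z\<close>.\<close>

lemma U22_invertible: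
  assumes z: "cmod z < 1" shows "invertible_op (U22 z)"
proof -
  have cont: "isCont U22 w" if w: "cmod w < 1" for w
  proof -
    obtain D where "has_op_derivative U22 D w"
      using analytic_U(4) w unfolding analytic_on_disc_iff by blast
    then show ?thesis
      unfolding isCont_def by (rule has_op_derivative_continuous)
  qed
  have disc: "cmod (of_real t * z) < 1" if "t \<in> {0..1}" for t :: real
    using that z mult_left_le_one_le[of "cmod z" t] by (auto simp: norm_mult)
  have "isCont (\<lambda>t::real. U22 (of_real t * z)) t" if "t \<in> {0..1}" for t
    by (rule isCont_o2[where f = "\<lambda>t. of_real t * z" and g = U22]) (intro continuous_intros, rule cont[OF disc[OF that]])
  then have "continuous_on {0..1} (\<lambda>t::real. U22 (of_real t * z))"
    by (intro continuous_at_imp_continuous_on ballI)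
  \<comment> \<open>The value at the origin is \<open>E* \<Delta> E R\<close>, and
    \<open>E* \<Delta> E\<close> is the square of \<open>Rinv\<close>.\<close>
  moreover have "U22 (of_real 0 * z) = Rinv"
    by (intro cblinfun_eqI) (simp add: U22_def Y22_def flip: Rinv_Rinv)
  then have "invertible_op (U22 (of_real 0 * z))"
    by (auto intro: invertible_opI[of R])
  moreover have "norm x \<le> norm ((U22 (of_real t * z))* *\<^sub>V x)" if "t \<in> {0..1}" for t :: real and x
  proof -
    from kernel_inequality[OF disc[OF that], of 0 x]
    have "(norm ((U21 (of_real t * z))* *\<^sub>V x))\<^sup>2 - (norm ((U22 (of_real t * z))* *\<^sub>V x))\<^sup>2 \<le> - (norm x)\<^sup>2"
      by simp
    then have "(norm x)\<^sup>2 \<le> (norm ((U22 (of_real t * z))* *\<^sub>V x))\<^sup>2"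
      using zero_le_power2[of "norm ((U21 (of_real t * z))* *\<^sub>V x)"] by linarith
    then show ?thesis
      by (rule power2_le_imp_le) simp
  qed
  ultimately have "invertible_op (U22 (of_real 1 * z))"
    by (rule invertible_along_path[where T = "\<lambda>t. U22 (of_real t * z)"])
  then show ?thesis
    by simp
qed

end


section \<open>Contractive multipliers and linear fractional maps\<close>

text \<open>Setting \<open>y = 0\<close> makes \<open>d^-1 c\<close> a strict contraction, so
  \<open>c X + d = d (I + d^-1 c X)\<close> is invertible. Setting \<open>u = - F* y\<close> makes
  the vector under the second norm equal to \<open>- X*\<close> applied to the one under the first,
  so the left side is non-negative and \<open>F*\<close> is contractive.\<close>

lemma linear_fractional_contraction:
  fixes a :: "'e::chilbert_space \<Rightarrow>\<^sub>C\<^sub>L 'y::chilbert_space" and b :: "'u::chilbert_space \<Rightarrow>\<^sub>C\<^sub>L 'y"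
    and c :: "'e \<Rightarrow>\<^sub>C\<^sub>L 'u" and d :: "'u \<Rightarrow>\<^sub>C\<^sub>L 'u"
  assumes le: "\<And>y u. (norm (a* *\<^sub>V y + c* *\<^sub>V u))\<^sup>2 - (norm (b* *\<^sub>V y + d* *\<^sub>V u))\<^sup>2 \<le> (norm y)\<^sup>2 - (norm u)\<^sup>2"
    and d: "invertible_op d" and X: "norm X \<le> 1"
  shows "invertible_op (c o\<^sub>C\<^sub>L X + d)"
    and "norm ((a o\<^sub>C\<^sub>L X + b) o\<^sub>C\<^sub>L inverse_op (c o\<^sub>C\<^sub>L X + d)) \<le> 1"
proof -
  \<comment> \<open>Since \<open>|d* u|^2 \<le> k |u|^2\<close>, the gain \<open>|u|^2\<close> is a
    fixed fraction of \<open>|d* u|^2\<close>, which makes the contraction strict.\<close>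
  define k where "k = (norm d)\<^sup>2 + 1"
  have k: "1 \<le> k" "0 < k"
    by (simp_all add: k_def add_nonneg_pos)
  have "norm (c* o\<^sub>C\<^sub>L inverse_op (d*)) \<le> sqrt (1 - 1 / k)"
  proof (rule norm_cblinfun_bound)
    show "0 \<le> sqrt (1 - 1 / k)"
      using k by simp
    fix v
    define u where "u = inverse_op (d*) *\<^sub>V v"
    have v: "v = d* *\<^sub>V u"
      by (simp add: u_def invertible_adj[OF d])
    have "(norm v)\<^sup>2 \<le> (norm d * norm u)\<^sup>2"
      unfolding v using norm_cblinfun[of "d*" u] by (intro power_mono) simp_all
    also have "\<dots> \<le> k * (norm u)\<^sup>2"
      by (simp add: k_def power_mult_distrib mult_right_mono)
    finally have "(norm v)\<^sup>2 / k \<le> (norm u)\<^sup>2"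
      using k by (simp add: field_simps)
    then have "(norm (c* *\<^sub>V u))\<^sup>2 \<le> (1 - 1 / k) * (norm v)\<^sup>2"
      using le[of 0 u] by (simp add: v algebra_simps)
    then have "norm (c* *\<^sub>V u) \<le> sqrt ((1 - 1 / k) * (norm v)\<^sup>2)"
      by (rule real_le_rsqrt)
    then show "norm ((c* o\<^sub>C\<^sub>L inverse_op (d*)) *\<^sub>V v) \<le> sqrt (1 - 1 / k) * norm v"
      by (simp add: u_def real_sqrt_mult)
  qed
  also have "sqrt (1 - 1 / k) < 1"
    using k by simp
  also have "norm (c* o\<^sub>C\<^sub>L inverse_op (d*)) = norm (inverse_op d o\<^sub>C\<^sub>L c)"
    using norm_adj[of "inverse_op d o\<^sub>C\<^sub>L c"] by (simp add: inverse_op_adj[OF d])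
  finally have "norm (inverse_op d o\<^sub>C\<^sub>L c) < 1" .
  then have "norm (inverse_op d o\<^sub>C\<^sub>L c o\<^sub>C\<^sub>L X) < 1"
    using norm_comp_op_le[of "inverse_op d o\<^sub>C\<^sub>L c" X]
      mult_left_mono[OF X, of "norm (inverse_op d o\<^sub>C\<^sub>L c)"] by simp
  then have "invertible_op (d o\<^sub>C\<^sub>L (id_op + inverse_op d o\<^sub>C\<^sub>L c o\<^sub>C\<^sub>L X))"
    by (intro invertible_comp_op d invertible_id_plus)
  moreover have "d o\<^sub>C\<^sub>L (id_op + inverse_op d o\<^sub>C\<^sub>L c o\<^sub>C\<^sub>L X) = c o\<^sub>C\<^sub>L X + d"
    by (rule cblinfun_eqI) (simp add: cblinfun_apply_add d)
  ultimately show inv: "invertible_op (c o\<^sub>C\<^sub>L X + d)"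
    by simp
  define F where "F = (a o\<^sub>C\<^sub>L X + b) o\<^sub>C\<^sub>L inverse_op (c o\<^sub>C\<^sub>L X + d)"
  have F: "F o\<^sub>C\<^sub>L (c o\<^sub>C\<^sub>L X + d) = a o\<^sub>C\<^sub>L X + b"
    using is_inverse_inverse_op[OF inv] by (simp add: F_def comp_op_assoc is_inverse_op_def)
  have "norm (F*) \<le> 1"
  proof (rule norm_cblinfun_bound)
    fix y
    define p where "p = a* *\<^sub>V y + c* *\<^sub>V (- (F* *\<^sub>V y))"
    have "(F o\<^sub>C\<^sub>L (c o\<^sub>C\<^sub>L X + d))* *\<^sub>V y = (a o\<^sub>C\<^sub>L X + b)* *\<^sub>V y"
      by (simp only: F)
    then have "b* *\<^sub>V y + d* *\<^sub>V (- (F* *\<^sub>V y)) = - (X* *\<^sub>V p)"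
      by (simp add: p_def cblinfun_apply_linear algebra_simps)
    then have eq: "norm (b* *\<^sub>V y + d* *\<^sub>V (- (F* *\<^sub>V y))) = norm (X* *\<^sub>V p)"
      by (simp only: norm_minus_cancel)
    have "norm (X* *\<^sub>V p) \<le> 1 * norm p"
      by (rule norm_cblinfun_le) (simp add: X)
    then have "(norm (X* *\<^sub>V p))\<^sup>2 \<le> (norm p)\<^sup>2"
      by (intro power_mono) simp_all
    then have "(norm (F* *\<^sub>V y))\<^sup>2 \<le> (norm y)\<^sup>2"
      using le[of y "- (F* *\<^sub>V y)"] unfolding eq p_def[symmetric] norm_minus_cancel by linarith
    then show "norm (F* *\<^sub>V y) \<le> 1 * norm y"
      unfolding mult_1 by (rule power2_le_imp_le) simp
  qed simp
  then show "norm ((a o\<^sub>C\<^sub>L X + b) o\<^sub>C\<^sub>L inverse_op (c o\<^sub>C\<^sub>L X + d)) \<le> 1"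
    by (simp only: norm_adj F_def)
qed

text \<open>Leech's theorem.  The displacement identity makes \<open>(a* f, N\<^sup>1\<^sup>/\<^sup>2 S* f) \<mapsto> (b* f, N\<^sup>1\<^sup>/\<^sup>2 f)\<close> isometric;
  the adjoint of a contractive extension is a system matrix whose transfer function is \<open>X\<close>.\<close>

lemma leech_solvable:
  fixes N :: "'y::chilbert_space ell2 \<Rightarrow>\<^sub>C\<^sub>L 'y ell2"
    and a :: "'e::chilbert_space \<Rightarrow>\<^sub>C\<^sub>L 'y ell2" and b :: "'u::chilbert_space \<Rightarrow>\<^sub>C\<^sub>L 'y ell2"
  assumes N: "nonneg_op N"
    and disp: "N - shift o\<^sub>C\<^sub>L N o\<^sub>C\<^sub>L shift* = a o\<^sub>C\<^sub>L a* - b o\<^sub>C\<^sub>L b*"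
  shows "\<exists>X. schur_class X \<and> (\<forall>z. cmod z < 1 \<longrightarrow> point_eval z o\<^sub>C\<^sub>L a o\<^sub>C\<^sub>L X z = point_eval z o\<^sub>C\<^sub>L b)"
proof -
  obtain L where L_all: "nonneg_op L \<and> L o\<^sub>C\<^sub>L L = N \<and> (\<forall>Z. N o\<^sub>C\<^sub>L Z = Z o\<^sub>C\<^sub>L N \<longrightarrow> L o\<^sub>C\<^sub>L Z = Z o\<^sub>C\<^sub>L L)"
    using nonneg_op_sqrt_exists[OF N] by (rule exE)
  have L_adj: "L* = L"
    by (rule nonneg_op_self_adjoint[OF conjunct1[OF L_all]])
  have LL: "L o\<^sub>C\<^sub>L L = N"
    by (rule conjunct1[OF conjunct2[OF L_all]])
  have "norm (pair_op (b*) L *\<^sub>V f) \<le> norm (pair_op (a*) (L o\<^sub>C\<^sub>L shift*) *\<^sub>V f)" for f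
  proof -
    have NL: "cinner (L *\<^sub>V g) (L *\<^sub>V g) = cinner (N *\<^sub>V g) g" for g
      using cinner_adj[of L "L *\<^sub>V g" g] by (simp add: L_adj flip: LL)
    have "cinner ((N - shift o\<^sub>C\<^sub>L N o\<^sub>C\<^sub>L shift*) *\<^sub>V f) f = cinner ((a o\<^sub>C\<^sub>L a* - b o\<^sub>C\<^sub>L b*) *\<^sub>V f) f"
      by (simp only: disp)
    then have "cinner (b* *\<^sub>V f) (b* *\<^sub>V f) + cinner (L *\<^sub>V f) (L *\<^sub>V f)
        = cinner (a* *\<^sub>V f) (a* *\<^sub>V f) + cinner (L *\<^sub>V shift* *\<^sub>V f) (L *\<^sub>V shift* *\<^sub>V f)"
      by (simp add: cinner_diff_left NL cinner_adj[of shift] cinner_adj[of a] cinner_adj[of b] algebra_simps)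
    then have "(norm (pair_op (b*) L *\<^sub>V f))\<^sup>2 = (norm (pair_op (a*) (L o\<^sub>C\<^sub>L shift*) *\<^sub>V f))\<^sup>2"
      unfolding norm_sq_cinner by simp
    then show ?thesis
      by simp
  qed
  then have "\<exists>V :: ('u \<times> 'y ell2) \<Rightarrow>\<^sub>C\<^sub>L ('e \<times> 'y ell2). norm V \<le> 1
      \<and> (\<forall>f k. cinner (pair_op (b*) L *\<^sub>V f) k = cinner (pair_op (a*) (L o\<^sub>C\<^sub>L shift*) *\<^sub>V f) (V *\<^sub>V k))"
    by (rule factorization_contraction)
  then obtain V :: "('u \<times> 'y ell2) \<Rightarrow>\<^sub>C\<^sub>L ('e \<times> 'y ell2)" where V: "norm V \<le> 1"
    and V_adj: "\<forall>f k. cinner (pair_op (b*) L *\<^sub>V f) k = cinner (pair_op (a*) (L o\<^sub>C\<^sub>L shift*) *\<^sub>V f) (V *\<^sub>V k)"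
    by (elim exE conjE) (rule that)
  \<comment> \<open>\<open>V_adj\<close> read against arbitrary \<open>f\<close>: every input and
    output of \<open>V\<close> satisfy this one equation between sequences.\<close>
  have system: "b *\<^sub>V u + L *\<^sub>V t = a *\<^sub>V e + shift *\<^sub>V L *\<^sub>V s" if es: "V *\<^sub>V (u, t) = (e, s)" for u t e s
  proof (rule cinner_eqI_right)
    fix f
    have "cinner (b* *\<^sub>V f) u + cinner (L *\<^sub>V f) t = cinner (a* *\<^sub>V f) e + cinner (L *\<^sub>V shift* *\<^sub>V f) s"
      using V_adj[rule_format, of f "(u, t)"] by (simp add: es)
    then show "cinner f (b *\<^sub>V u + L *\<^sub>V t) = cinner f (a *\<^sub>V e + shift *\<^sub>V L *\<^sub>V s)"
      by (simp add: cinner_adj cinner_adj_left cinner_add_right L_adj)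
  qed
  define \<alpha> where "\<alpha> = fst_op o\<^sub>C\<^sub>L V o\<^sub>C\<^sub>L pair_op id_op 0"
  define \<beta> where "\<beta> = fst_op o\<^sub>C\<^sub>L V o\<^sub>C\<^sub>L pair_op 0 id_op"
  define \<gamma> where "\<gamma> = snd_op o\<^sub>C\<^sub>L V o\<^sub>C\<^sub>L pair_op id_op 0"
  define \<delta> where "\<delta> = snd_op o\<^sub>C\<^sub>L V o\<^sub>C\<^sub>L pair_op 0 id_op"
  have V_blocks: "V *\<^sub>V (u, t) = (\<alpha> *\<^sub>V u + \<beta> *\<^sub>V t, \<gamma> *\<^sub>V u + \<delta> *\<^sub>V t)" for u t
  proof -
    have "V *\<^sub>V (u, t) = V *\<^sub>V ((u, 0) + (0, t))"
      by simp
    then show ?thesis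
      unfolding cblinfun_apply_add by (simp add: \<alpha>_def \<beta>_def \<gamma>_def \<delta>_def prod_eq_iff)
  qed
  have V_le: "(norm e)\<^sup>2 + (norm s)\<^sup>2 \<le> (norm u)\<^sup>2 + (norm t)\<^sup>2" if "V *\<^sub>V (u, t) = (e, s)" for u t e s
  proof -
    have "(norm (V *\<^sub>V (u, t)))\<^sup>2 \<le> (norm (u, t))\<^sup>2"
      using norm_cblinfun_le[OF V, of "(u, t)"] by (intro power_mono) simp_all
    then show ?thesis
      by (simp add: that norm_Pair)
  qed
  have "norm \<delta> \<le> 1"
  proof (rule norm_cblinfun_bound)
    fix t
    have "(norm (\<beta> *\<^sub>V t))\<^sup>2 + (norm (\<delta> *\<^sub>V t))\<^sup>2 \<le> (norm t)\<^sup>2"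
      using V_le[OF V_blocks[of 0 t]] by simp
    then have "(norm (\<delta> *\<^sub>V t))\<^sup>2 \<le> (norm t)\<^sup>2"
      using zero_le_power2[of "norm (\<beta> *\<^sub>V t)"] by linarith
    then show "norm (\<delta> *\<^sub>V t) \<le> 1 * norm t"
      unfolding mult_1 by (rule power2_le_imp_le) simp
  qed simp
  have res: "invertible_op (id_op - z *\<^sub>C \<delta>)" if "cmod z < 1" for z
  proof (rule invertible_id_minus)
    show "norm (z *\<^sub>C \<delta>) < 1"
      using mult_left_mono[OF \<open>norm \<delta> \<le> 1\<close>, of "cmod z"] that by (simp add: norm_scaleC)
  qed
  define X where "X z = \<alpha> + z *\<^sub>C (\<beta> o\<^sub>C\<^sub>L inverse_op (id_op - z *\<^sub>C \<delta>) o\<^sub>C\<^sub>L \<gamma>)" for z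
  \<comment> \<open>Feeding in the state \<open>z s\<close> returns the state \<open>s\<close>; this
    closed loop is what defines \<open>X z\<close>.\<close>
  have V_X: "V *\<^sub>V (u, z *\<^sub>C s) = (X z *\<^sub>V u, s)"
    if z: "cmod z < 1" and s: "s = inverse_op (id_op - z *\<^sub>C \<delta>) *\<^sub>V \<gamma> *\<^sub>V u" for z u s
  proof -
    have "(id_op - z *\<^sub>C \<delta>) *\<^sub>V s = \<gamma> *\<^sub>V u"
      by (simp only: s inverse_op_apply res[OF z])
    then have "\<gamma> *\<^sub>V u + z *\<^sub>C (\<delta> *\<^sub>V s) = s"
      by (simp add: diff_eq_eq)
    then show ?thesis
      unfolding V_blocks by (simp add: X_def s)
  qed
  have "schur_class X"
    unfolding schur_class_def
  proof (intro conjI ballI)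
    show "analytic_on_disc X"
      unfolding X_def[abs_def]
      by (intro analytic_add analytic_const analytic_scaleC_ident analytic_comp_op analytic_inverse_op
          analytic_diff res)
    fix z :: complex
    assume "z \<in> ball 0 1"
    then have z: "cmod z < 1"
      by simp
    show "norm (X z) \<le> 1"
    proof (rule norm_cblinfun_bound)
      fix u
      define s where "s = inverse_op (id_op - z *\<^sub>C \<delta>) *\<^sub>V \<gamma> *\<^sub>V u"
      have "norm (z *\<^sub>C s) \<le> norm s"
        using z by (simp add: norm_scaleC mult_left_le_one_le)
      then have "(norm (z *\<^sub>C s))\<^sup>2 \<le> (norm s)\<^sup>2"
        by (intro power_mono) simp_all
      \<comment> \<open>Energy balance \<open>|X u|^2 + |s|^2 \<le> |u|^2 + |z s|^2\<close>, where
        the state terms cancel in the right direction because \<open>|z| < 1\<close>.\<close>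
      then have "(norm (X z *\<^sub>V u))\<^sup>2 \<le> (norm u)\<^sup>2"
        using V_le[OF V_X[OF z s_def]] by linarith
      then show "norm (X z *\<^sub>V u) \<le> 1 * norm u"
        unfolding mult_1 by (rule power2_le_imp_le) simp
    qed simp
  qed
  moreover have "point_eval z o\<^sub>C\<^sub>L a o\<^sub>C\<^sub>L X z = point_eval z o\<^sub>C\<^sub>L b" if z: "cmod z < 1" for z
  proof (rule cblinfun_eqI)
    fix u
    \<comment> \<open>Evaluation at \<open>z\<close> turns \<open>S L s\<close> into
      \<open>z\<close> times the value of \<open>L s\<close>, which cancels the term from the state
      \<open>z s\<close>.\<close>
    show "(point_eval z o\<^sub>C\<^sub>L a o\<^sub>C\<^sub>L X z) *\<^sub>V u = (point_eval z o\<^sub>C\<^sub>L b) *\<^sub>V u"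
      using arg_cong[OF system[OF V_X[OF z refl, of u]], of "cblinfun_apply (point_eval z)"]
      by (simp add: cblinfun_apply_add point_eval_shift[OF z])
  qed
  ultimately show ?thesis
    by (intro exI[of _ X]) simp
qed

text \<open>The residual of projecting \<open>x\<close> onto the closure is annihilated by all point
  evaluations, so its power series vanishes.\<close>

lemma kernels_dense:
  fixes M :: "'a::chilbert_space ell2 set"
  assumes M: "csubspace M" and kernels: "\<And>z y. cmod z < 1 \<Longrightarrow> (point_eval z)* *\<^sub>V y \<in> M"
  shows "x \<in> closure M"
proof -
  have cl: "closed_csubspace (closure M)"
    by (simp add: closed_csubspace_def csubspace_closure M)
  define v where "v = x - proj (closure M) *\<^sub>V x"
  have "point_eval z *\<^sub>V v = 0" if "cmod z < 1" for z
  proof (rule cinner_eqI)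
    fix y
    have "cinner v ((point_eval z)* *\<^sub>V y) = 0"
      using proj_properties(2)[OF cl, of x] subsetD[OF closure_subset kernels[OF that, of y]]
      by (simp add: v_def orth_complement_def)
    then show "cinner (point_eval z *\<^sub>V v) y = cinner 0 y"
      by (simp add: cinner_adj)
  qed
  then have "v = 0"
    by (rule point_eval_inject)
  then have "x = proj (closure M) *\<^sub>V x"
    by (simp add: v_def)
  also have "\<dots> \<in> closure M"
    by (rule proj_properties(1)[OF cl])
  finally show ?thesis .
qed

text \<open>Conversely, \<open>a X = b\<close> identifies the form of \<open>N\<close> on the kernel functions \<open>k\<^sub>w y\<close> with the form of
  \<open>I - T\<^sub>X T\<^sub>X*\<close> on the vectors \<open>k\<^sub>w a(w)* y\<close>.\<close>

lemma leech_positive: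
  fixes N :: "'y::chilbert_space ell2 \<Rightarrow>\<^sub>C\<^sub>L 'y ell2"
    and a :: "'e::chilbert_space \<Rightarrow>\<^sub>C\<^sub>L 'y ell2" and b :: "'u::chilbert_space \<Rightarrow>\<^sub>C\<^sub>L 'y ell2"
  assumes disp: "N - shift o\<^sub>C\<^sub>L N o\<^sub>C\<^sub>L shift* = a o\<^sub>C\<^sub>L a* - b o\<^sub>C\<^sub>L b*"
    and X: "schur_class X"
    and aX: "\<And>z. cmod z < 1 \<Longrightarrow> point_eval z o\<^sub>C\<^sub>L a o\<^sub>C\<^sub>L X z = point_eval z o\<^sub>C\<^sub>L b"
  shows "0 \<le> Re (cinner (N *\<^sub>V f) f)"
proof -
  define N' where "N' = id_op - toeplitz X o\<^sub>C\<^sub>L (toeplitz X)*"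
  define \<alpha> where "\<alpha> z y = a* *\<^sub>V (point_eval z)* *\<^sub>V y" for z y
  \<comment> \<open>Pairs instead of a map: whether the assignment between kernel functions is well
    defined on their span need not be settled.\<close>
  define G where "G = {((point_eval z)* *\<^sub>V y, (point_eval z)* *\<^sub>V \<alpha> z y) | z y. cmod z < 1}"
  have \<beta>: "b* *\<^sub>V (point_eval z)* *\<^sub>V y = (X z)* *\<^sub>V \<alpha> z y" if z: "cmod z < 1" for z y
  proof -
    have "(point_eval z o\<^sub>C\<^sub>L b)* *\<^sub>V y = (point_eval z o\<^sub>C\<^sub>L a o\<^sub>C\<^sub>L X z)* *\<^sub>V y"
      by (simp only: aX[OF z])
    then show ?thesis
      by (simp add: \<alpha>_def)
  qed
  have TX: "(toeplitz X)* *\<^sub>V (point_eval z)* *\<^sub>V y = (point_eval z)* *\<^sub>V (X z)* *\<^sub>V y" if z: "cmod z < 1" for z y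
    by (rule cinner_eqI_right) (simp flip: cinner_adj add: point_eval_toeplitz[OF X z])
  have on_kernels: "cinner (N *\<^sub>V (point_eval w)* *\<^sub>V y) ((point_eval z)* *\<^sub>V y')
      = cinner (N' *\<^sub>V (point_eval w)* *\<^sub>V \<alpha> w y) ((point_eval z)* *\<^sub>V \<alpha> z y')"
    if w: "cmod w < 1" and z: "cmod z < 1" for w z y y'
  proof -
    have "cmod (z * cnj w) < 1"
      using mult_strict_mono[OF z w] by (simp add: norm_mult)
    then have ne: "1 - z * cnj w \<noteq> 0"
      by auto
    have "cinner ((N - shift o\<^sub>C\<^sub>L N o\<^sub>C\<^sub>L shift*) *\<^sub>V (point_eval w)* *\<^sub>V y) ((point_eval z)* *\<^sub>V y')
        = cinner ((a o\<^sub>C\<^sub>L a* - b o\<^sub>C\<^sub>L b*) *\<^sub>V (point_eval w)* *\<^sub>V y) ((point_eval z)* *\<^sub>V y')"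
      by (simp only: disp)
    then have "(1 - z * cnj w) * cinner (N *\<^sub>V (point_eval w)* *\<^sub>V y) ((point_eval z)* *\<^sub>V y')
        = cinner (\<alpha> w y) (\<alpha> z y') - cinner ((X w)* *\<^sub>V \<alpha> w y) ((X z)* *\<^sub>V \<alpha> z y')"
      by (simp add: cinner_diff_left cinner_adj[of shift] cinner_adj[of a] cinner_adj[of b]
          adj_shift_kernel w z \<beta> left_diff_distrib mult_ac flip: \<alpha>_def)
    also have "\<dots> = (1 - z * cnj w) * cinner (N' *\<^sub>V (point_eval w)* *\<^sub>V \<alpha> w y) ((point_eval z)* *\<^sub>V \<alpha> z y')"
      by (simp add: N'_def cinner_diff_left cinner_adj[of "toeplitz X"] TX w z right_diff_distrib
          cinner_kernels)
    finally show ?thesis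
      using ne by simp
  qed
  \<comment> \<open>\<open>span\<close> is the real span, so the real inner product is extended
    bilinearly from the generators.\<close>
  have pairing: "inner (N *\<^sub>V fst p) (fst q) = inner (N' *\<^sub>V snd p) (snd q)" if "p \<in> span G" "q \<in> span G" for p q
    using that(1)
  proof (induction p rule: span_induct)
    case base
    show ?case
      unfolding subspace_def by (simp add: cblinfun_apply_add cblinfun_apply_scaleR inner_add_left)
  next
    case (step p)
    then obtain w y where p: "p = ((point_eval w)* *\<^sub>V y, (point_eval w)* *\<^sub>V \<alpha> w y)" "cmod w < 1"
      by (auto simp: G_def)
    show ?case
      using that(2)
    proof (induction q rule: span_induct)
      case base
      show ?case
        unfolding subspace_def by (simp add: inner_add_right)
    next
      case (step q)
      then obtain z y' where q: "q = ((point_eval z)* *\<^sub>V y', (point_eval z)* *\<^sub>V \<alpha> z y')" "cmod z < 1"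
        by (auto simp: G_def)
      show ?case
        using arg_cong[OF on_kernels[OF p(2) q(2), of y y'], of Re] by (simp add: p(1) q(1) Re_cinner)
    qed
  qed
  have N'_pos: "0 \<le> inner (N' *\<^sub>V g) g" for g
  proof -
    have "norm ((toeplitz X)* *\<^sub>V g) \<le> 1 * norm g"
      by (rule norm_cblinfun_le) (simp add: norm_toeplitz_le[OF X])
    then have "(norm ((toeplitz X)* *\<^sub>V g))\<^sup>2 \<le> (norm g)\<^sup>2"
      by (intro power_mono) simp_all
    then have "0 \<le> Re (cinner (N' *\<^sub>V g) g)"
      unfolding norm_sq_cinner by (simp add: N'_def cinner_diff_left cinner_adj)
    then show ?thesis
      by (simp add: Re_cinner)
  qed
  \<comment> \<open>\<open>kernels_dense\<close> needs a complex subspace; the generators are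
    already stable under complex scalars.\<close>
  have scale: "c *\<^sub>C p \<in> span G" if "p \<in> span G" for c p
    using that
  proof (induction p rule: span_induct)
    case base
    show ?case
      unfolding subspace_def by (simp add: scaleC_add_right scaleC_scaleR span_add span_zero span_scale)
  next
    case (step p)
    then obtain w y where "p = ((point_eval w)* *\<^sub>V y, (point_eval w)* *\<^sub>V \<alpha> w y)" and w: "cmod w < 1"
      by (auto simp: G_def)
    then have "c *\<^sub>C p = ((point_eval w)* *\<^sub>V (c *\<^sub>C y), (point_eval w)* *\<^sub>V \<alpha> w (c *\<^sub>C y))"
      by (simp add: \<alpha>_def)
    also have "\<dots> \<in> span G"
      using w unfolding G_def by (intro span_base) blast
    finally show ?case .
  qed
  have "csubspace (fst ` span G)"
    unfolding csubspace_def
  proof (intro conjI ballI allI)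
    show "0 \<in> fst ` span G"
      by (rule image_eqI[of _ _ 0]) (simp_all add: span_zero)
  next
    fix x y
    assume "x \<in> fst ` span G" "y \<in> fst ` span G"
    then obtain p q where "p \<in> span G" "x = fst p" "q \<in> span G" "y = fst q"
      by blast
    then show "x + y \<in> fst ` span G"
      by (intro image_eqI[of _ _ "p + q"]) (simp_all add: span_add)
  next
    fix c x
    assume "x \<in> fst ` span G"
    then obtain p where "p \<in> span G" "x = fst p"
      by blast
    then show "c *\<^sub>C x \<in> fst ` span G"
      by (intro image_eqI[of _ _ "c *\<^sub>C p"] scale) (simp_all add: scaleC_prod_def)
  qed
  moreover have "(point_eval z)* *\<^sub>V y \<in> fst ` span G" if "cmod z < 1" for z y
  proof (rule image_eqI)
    show "((point_eval z)* *\<^sub>V y, (point_eval z)* *\<^sub>V \<alpha> z y) \<in> span G"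
      by (rule span_base) (use that in \<open>auto simp: G_def\<close>)
  qed simp
  ultimately have "f \<in> closure (fst ` span G)"
    by (rule kernels_dense)
  then obtain s where s: "\<And>n. s n \<in> fst ` span G" "s \<longlonglongrightarrow> f"
    using closure_sequential by blast
  have "0 \<le> inner (N *\<^sub>V s n) (s n)" for n
  proof -
    obtain p where p: "p \<in> span G" "s n = fst p"
      using s(1)[of n] by blast
    show ?thesis
      using pairing[OF p(1) p(1)] N'_pos[of "snd p"] by (simp add: p(2))
  qed
  moreover have "(\<lambda>n. inner (N *\<^sub>V s n) (s n)) \<longlonglongrightarrow> inner (N *\<^sub>V f) f"
    by (intro tendsto_inner tendsto_cblinfun_apply_right s)
  ultimately have "0 \<le> inner (N *\<^sub>V f) f"
    by (intro LIMSEQ_le_const) auto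
  then show ?thesis
    by (simp add: Re_cinner)
qed


section \<open>Solutions of the commutant lifting problem\<close>

context lifting_problem
begin

abbreviation "leech_a F \<equiv> Y11 - toeplitz F o\<^sub>C\<^sub>L Y21"
abbreviation "leech_b F \<equiv> toeplitz F o\<^sub>C\<^sub>L Y22 - Y12"
abbreviation "lft X z \<equiv> (U11 z o\<^sub>C\<^sub>L X z + U12 z) o\<^sub>C\<^sub>L inverse_op (U21 z o\<^sub>C\<^sub>L X z + U22 z)"

text \<open>The operator \<open>N\<close> of the overview: its form at \<open>f\<close> is
  \<open>pform\<close> at \<open>(f, - T_F* f)\<close>, where \<open>A* f - T_F* f\<close> is minus
  the adjoint of \<open>T_F - A\<close> applied to \<open>f\<close>.\<close>

definition defect :: "(complex \<Rightarrow> 'u \<Rightarrow>\<^sub>C\<^sub>L 'y) \<Rightarrow> 'y ell2 \<Rightarrow>\<^sub>C\<^sub>L 'y ell2" where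
  "defect F = T o\<^sub>C\<^sub>L T* - (toeplitz F - A) o\<^sub>C\<^sub>L \<Delta> o\<^sub>C\<^sub>L (toeplitz F - A)*"

lemma cinner_defect:
  "cinner (defect F *\<^sub>V f) f = cinner (T* *\<^sub>V f) (T* *\<^sub>V f)
    - cinner (\<Delta> *\<^sub>V (toeplitz F - A)* *\<^sub>V f) ((toeplitz F - A)* *\<^sub>V f)"
  unfolding defect_def minus_cblinfun_apply[of "T o\<^sub>C\<^sub>L T*"] cinner_diff_left comp_op_apply
  by (simp only: cinner_adj)

text \<open>\<open>pform_displacement\<close> at \<open>v = - T_F* f\<close>. As \<open>T_F*\<close>
  commutes with \<open>S*\<close>, the shifted term is again of this shape.\<close>

lemma defect_displacement:
  assumes F: "schur_class F"
  shows "defect F - shift o\<^sub>C\<^sub>L defect F o\<^sub>C\<^sub>L shift*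
    = leech_a F o\<^sub>C\<^sub>L (leech_a F)*
      - leech_b F o\<^sub>C\<^sub>L (leech_b F)*"
proof (rule cblinfun_eqI_quadratic)
  fix f
  have pform: "cinner (defect F *\<^sub>V g) g = pform g (- ((toeplitz F)* *\<^sub>V g))" for g
  proof -
    have "A* *\<^sub>V g + - ((toeplitz F)* *\<^sub>V g) = - ((toeplitz F - A)* *\<^sub>V g)"
      by simp
    then show ?thesis
      unfolding cinner_defect pform_def by (simp only: cblinfun_apply_minus cinner_minus_left cinner_minus_right minus_minus)
  qed
  have "shift* *\<^sub>V (toeplitz F)* *\<^sub>V f = (toeplitz F)* *\<^sub>V shift* *\<^sub>V f"
    by (rule cinner_eqI) (simp add: cinner_adj_left toeplitz_shift[OF F])
  then have "cinner ((defect F - shift o\<^sub>C\<^sub>L defect F o\<^sub>C\<^sub>L shift*) *\<^sub>V f) f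
      = pform f (- ((toeplitz F)* *\<^sub>V f)) - pform (shift* *\<^sub>V f) (shift* *\<^sub>V (- ((toeplitz F)* *\<^sub>V f)))"
    by (simp add: cinner_diff_left cinner_adj[of shift] pform cblinfun_apply_minus)
  also have "\<dots> = cinner ((leech_a F)* *\<^sub>V f) ((leech_a F)* *\<^sub>V f)
      - cinner ((leech_b F)* *\<^sub>V f) ((leech_b F)* *\<^sub>V f)"
  proof -
    have "Y11* *\<^sub>V f + Y21* *\<^sub>V (- ((toeplitz F)* *\<^sub>V f)) = (leech_a F)* *\<^sub>V f"
      "Y12* *\<^sub>V f + Y22* *\<^sub>V (- ((toeplitz F)* *\<^sub>V f)) = - ((leech_b F)* *\<^sub>V f)"
      by (simp_all add: cblinfun_apply_minus)
    then show ?thesis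
      unfolding pform_displacement by (simp only: cinner_minus_left cinner_minus_right minus_minus)
  qed
  finally show "cinner ((defect F - shift o\<^sub>C\<^sub>L defect F o\<^sub>C\<^sub>L shift*) *\<^sub>V f) f
      = cinner ((leech_a F o\<^sub>C\<^sub>L (leech_a F)*
        - leech_b F o\<^sub>C\<^sub>L (leech_b F)*) *\<^sub>V f) f"
    unfolding minus_cblinfun_apply[of "leech_a F o\<^sub>C\<^sub>L (leech_a F)*"]
      cinner_diff_left comp_op_apply[of "leech_a F"] comp_op_apply[of "leech_b F"]
      cinner_adj[of "leech_a F"] cinner_adj[of "leech_b F"] .
qed

text \<open>With \<open>v\<close>, \<open>k\<close>, \<open>t\<close> and \<open>m\<close> as below,
  \<open>m = <\<Omega> v, v>\<close>. Contractivity of \<open>T_F\<close> gives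
  \<open>|k|^2 \<le> m\<close>, while \<open>m = Re <k, t> \<le> |k| |t|\<close>; together
  \<open>m \<le> |t|^2\<close>, without a square root of \<open>\<Omega>\<close>.\<close>

lemma defect_nonneg:
  assumes F: "schur_class F" and sol: "P o\<^sub>C\<^sub>L toeplitz F = A"
  shows "nonneg_op (defect F)"
proof (rule nonneg_opI)
  show "(defect F)* = defect F"
    unfolding defect_def adj_diff[of "T o\<^sub>C\<^sub>L T*"] by (simp only: adj_comp adj_adj \<Delta>_adj comp_op_assoc)
  fix f
  define t where "t = T* *\<^sub>V f"
  define v where "v = \<Delta> *\<^sub>V (toeplitz F - A)* *\<^sub>V f"
  define k where "k = T* *\<^sub>V toeplitz F *\<^sub>V v"
  define m where "m = Re (cinner v ((toeplitz F - A)* *\<^sub>V f))"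
  have PF: "P *\<^sub>V toeplitz F *\<^sub>V x = A *\<^sub>V x" for x
    using arg_cong[OF sol, of "\<lambda>S. S *\<^sub>V x"] by simp
  have split: "toeplitz F *\<^sub>V v = A *\<^sub>V v + T *\<^sub>V k"
    using P_plus_T[of "toeplitz F *\<^sub>V v"] by (simp add: PF k_def)
  have "(toeplitz F - A) *\<^sub>V v = T *\<^sub>V k"
    by (simp add: split)
  then have "m = Re (cinner (T *\<^sub>V k) f)"
    by (simp only: m_def cinner_adj[symmetric])
  also have "\<dots> = Re (cinner k t)"
    by (simp add: cinner_adj t_def)
  also have "\<dots> \<le> norm k * norm t"
    by (rule order_trans[OF complex_Re_le_cmod norm_cinner_le])
  finally have m_le: "m \<le> norm k * norm t" .
  have "(norm k)\<^sup>2 \<le> m"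
  proof -
    have "cinner (A *\<^sub>V v) (T *\<^sub>V k) = 0"
      using cinner_adj_left[of T "A *\<^sub>V v" k] by simp
    moreover have "cinner (T *\<^sub>V k) (A *\<^sub>V v) = 0"
      by (simp add: cinner_adj)
    moreover have "cinner (T *\<^sub>V k) (T *\<^sub>V k) = cinner k k"
      by (simp add: cinner_adj)
    ultimately have "(norm (toeplitz F *\<^sub>V v))\<^sup>2 = (norm (A *\<^sub>V v))\<^sup>2 + (norm k)\<^sup>2"
      unfolding norm_sq_cinner split by (simp add: cinner_linear)
    moreover have "(norm (toeplitz F *\<^sub>V v))\<^sup>2 \<le> (norm v)\<^sup>2"
      using norm_cblinfun_le[OF norm_toeplitz_le[OF F], of v] by (intro power_mono) simp_all
    moreover have "m = (norm v)\<^sup>2 - (norm (A *\<^sub>V v))\<^sup>2"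
    proof -
      have "(toeplitz F - A)* *\<^sub>V f = \<Omega> *\<^sub>V v"
        by (simp add: v_def del: adj_diff)
      then show ?thesis
        by (simp add: m_def \<Omega>_apply cinner_diff_right norm_sq_cinner flip: cinner_adj)
    qed
    ultimately show ?thesis
      by simp
  qed
  with m_le have "norm k * norm k \<le> norm k * norm t"
    by (simp add: power2_eq_square)
  then have "norm k \<le> norm t \<or> norm k = 0"
    by (auto simp: mult_le_cancel_left)
  then have "norm k * norm t \<le> (norm t)\<^sup>2"
    by (auto simp: power2_eq_square mult_right_mono)
  with m_le have "m \<le> (norm t)\<^sup>2"
    by simp
  then show "0 \<le> Re (cinner (defect F *\<^sub>V f) f)"
    unfolding cinner_defect by (simp add: m_def v_def t_def norm_sq_cinner del: adj_diff)
qed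

text \<open>On \<open>H\<close> the term \<open>T T*\<close> vanishes, and what is left is minus a
  form that dominates a squared norm by \<open>\<Delta>_ge_id\<close>.\<close>

lemma solution_if_defect_nonneg:
  assumes pos: "\<And>f. 0 \<le> Re (cinner (defect F *\<^sub>V f) f)"
  shows "P o\<^sub>C\<^sub>L toeplitz F = A"
proof -
  have "(toeplitz F)* *\<^sub>V P *\<^sub>V x = A* *\<^sub>V x" for x
  proof -
    have "Re (cinner (\<Delta> *\<^sub>V (toeplitz F - A)* *\<^sub>V P *\<^sub>V x) ((toeplitz F - A)* *\<^sub>V P *\<^sub>V x)) \<le> 0"
      using pos[of "P *\<^sub>V x"] unfolding cinner_defect by (simp del: adj_diff)
    with \<Delta>_ge_id have "(norm ((toeplitz F - A)* *\<^sub>V P *\<^sub>V x))\<^sup>2 \<le> 0"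
      by (rule order_trans)
    then show ?thesis
      by simp
  qed
  then have "(P o\<^sub>C\<^sub>L toeplitz F)* = A*"
    by (intro cblinfun_eqI) simp
  then show ?thesis
    by (metis adj_adj)
qed

lemma point_eval_columns:
  assumes F: "schur_class F" and z: "cmod z < 1"
  shows "point_eval z o\<^sub>C\<^sub>L leech_a F = U11 z - F z o\<^sub>C\<^sub>L U21 z"
    and "point_eval z o\<^sub>C\<^sub>L leech_b F = F z o\<^sub>C\<^sub>L U22 z - U12 z"
  by (rule cblinfun_eqI;
      simp add: U11_def U12_def U21_def U22_def cblinfun_apply_diff point_eval_toeplitz[OF F z])+

lemma denominator_invertible:
  assumes "schur_class X" "cmod z < 1"
  shows "invertible_op (U21 z o\<^sub>C\<^sub>L X z + U22 z)"
  by (rule linear_fractional_contraction(1)[OF kernel_inequality U22_invertible schur_class_bound]) fact+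

lemma solution_iff:
  "commutant_lifting_solution H A F \<longleftrightarrow>
    (\<exists>X. schur_class X \<and> (\<forall>z. cmod z < 1 \<longrightarrow>
      F z = lft X z))"
proof
  assume "commutant_lifting_solution H A F"
  then have F: "schur_class F" and sol: "P o\<^sub>C\<^sub>L toeplitz F = A"
    by (simp_all add: commutant_lifting_solution_def)
  obtain X where X: "schur_class X" and aX: "\<forall>z. cmod z < 1 \<longrightarrow>
      point_eval z o\<^sub>C\<^sub>L leech_a F o\<^sub>C\<^sub>L X z = point_eval z o\<^sub>C\<^sub>L (leech_b F)"
    using leech_solvable[OF defect_nonneg[OF F sol] defect_displacement[OF F]]
    by (elim exE conjE) (rule that)
  have "F z = lft X z" if z: "cmod z < 1" for z
  proof (rule cblinfun_eqI)
    fix u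
    \<comment> \<open>Collecting the terms with \<open>F z\<close> in \<open>a X = b\<close> gives
      \<open>F z (U21 z X z + U22 z) = U11 z X z + U12 z\<close>, which is tested on the preimage
      \<open>v\<close> of \<open>u\<close>.\<close>
    define v where "v = inverse_op (U21 z o\<^sub>C\<^sub>L X z + U22 z) *\<^sub>V u"
    have u: "u = (U21 z o\<^sub>C\<^sub>L X z + U22 z) *\<^sub>V v"
      unfolding v_def using denominator_invertible[OF X z] by (simp only: inverse_op_apply)
    have "((U11 z - F z o\<^sub>C\<^sub>L U21 z) o\<^sub>C\<^sub>L X z) *\<^sub>V v = (F z o\<^sub>C\<^sub>L U22 z - U12 z) *\<^sub>V v"
      using aX[rule_format, OF z] by (simp only: point_eval_columns[OF F z])
    then have "F z *\<^sub>V u = (U11 z o\<^sub>C\<^sub>L X z + U12 z) *\<^sub>V v"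
      unfolding u by (simp add: cblinfun_apply_add algebra_simps)
    then show "F z *\<^sub>V u = lft X z *\<^sub>V u"
      by (simp only: comp_op_apply v_def)
  qed
  with X show "\<exists>X. schur_class X \<and> (\<forall>z. cmod z < 1 \<longrightarrow>
      F z = lft X z)"
    by blast
next
  assume "\<exists>X. schur_class X \<and> (\<forall>z. cmod z < 1 \<longrightarrow>
      F z = lft X z)"
  then obtain X where X: "schur_class X" and F_eq: "\<And>z. cmod z < 1 \<Longrightarrow>
      F z = lft X z"
    by blast
  have X_an: "analytic_on_disc X"
    using X by (simp add: schur_class_def)
  \<comment> \<open>The Schur property comes first, pointwise from \<open>kernel_inequality\<close>:
    the facts about the Toeplitz operator of \<open>F\<close> depend on it.\<close>
  have F: "schur_class F"
    unfolding schur_class_def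
  proof (intro conjI ballI)
    have "analytic_on_disc (lft X)"
      by (intro analytic_comp_op analytic_add analytic_inverse_op analytic_U X_an denominator_invertible X)
    then show "analytic_on_disc F"
      by (rule analytic_on_disc_cong) (rule F_eq)
    fix z :: complex
    assume "z \<in> ball 0 1"
    then have z: "cmod z < 1"
      by simp
    show "norm (F z) \<le> 1"
      unfolding F_eq[OF z]
      by (rule linear_fractional_contraction(2)[OF kernel_inequality[OF z] U22_invertible[OF z]
            schur_class_bound[OF X z]])
  qed
  have "P o\<^sub>C\<^sub>L toeplitz F = A"
  proof (rule solution_if_defect_nonneg, rule leech_positive[OF defect_displacement[OF F] X])
    fix z :: complex
    assume z: "cmod z < 1"
    have "F z o\<^sub>C\<^sub>L (U21 z o\<^sub>C\<^sub>L X z + U22 z) = U11 z o\<^sub>C\<^sub>L X z + U12 z"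
      using is_inverse_inverse_op[OF denominator_invertible[OF X z]]
      by (simp add: F_eq[OF z] comp_op_assoc is_inverse_op_def)
    from arg_cong[OF this, of "\<lambda>S. S *\<^sub>V u" for u]
    have "F z *\<^sub>V (U21 z *\<^sub>V X z *\<^sub>V u + U22 z *\<^sub>V u) = U11 z *\<^sub>V X z *\<^sub>V u + U12 z *\<^sub>V u" for u
      by simp
    then show "point_eval z o\<^sub>C\<^sub>L leech_a F o\<^sub>C\<^sub>L X z = point_eval z o\<^sub>C\<^sub>L (leech_b F)"
      unfolding point_eval_columns[OF F z]
      by (intro cblinfun_eqI) (simp add: cblinfun_apply_add algebra_simps)
  qed
  then show "commutant_lifting_solution H A F"
    using F by (simp add: commutant_lifting_solution_def)
qed

text \<open>The push-through identity, with \<open>P\<close> as the identity of \<open>H\<close>. It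
  lets all four coefficients be written with \<open>\<Delta>\<close> alone.\<close>

lemma inverse_op_on_H: "inverse_op_on H (P - A o\<^sub>C\<^sub>L A*) = P + A o\<^sub>C\<^sub>L \<Delta> o\<^sub>C\<^sub>L A*"
  unfolding inverse_op_on_def
proof (rule the_equality)
  define G where "G = P + A o\<^sub>C\<^sub>L \<Delta> o\<^sub>C\<^sub>L A*"
  have PP: "P *\<^sub>V P *\<^sub>V x = P *\<^sub>V x" for x
    by (rule proj_idem[OF H_closed proj_properties(1)[OF H_closed]])
  \<comment> \<open>Both come from
    \<open>\<Delta> - I = A* A \<Delta> = \<Delta> A* A\<close>.\<close>
  have AA: "A *\<^sub>V A* *\<^sub>V A *\<^sub>V \<Delta> *\<^sub>V x = A *\<^sub>V \<Delta> *\<^sub>V x - A *\<^sub>V x" "A *\<^sub>V \<Delta> *\<^sub>V A* *\<^sub>V A *\<^sub>V x = A *\<^sub>V \<Delta> *\<^sub>V x - A *\<^sub>V x" for x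
    using arg_cong[OF \<Delta>_eq(1)[of x], of "cblinfun_apply A"] arg_cong[OF \<Delta>_eq(2)[of x], of "cblinfun_apply A"]
    by (simp_all add: cblinfun_apply_add)
  have G: "P o\<^sub>C\<^sub>L G = G" "G o\<^sub>C\<^sub>L P = G" "G o\<^sub>C\<^sub>L (P - A o\<^sub>C\<^sub>L A*) = P" "(P - A o\<^sub>C\<^sub>L A*) o\<^sub>C\<^sub>L G = P"
    by (rule cblinfun_eqI; simp add: G_def cblinfun_apply_add cblinfun_apply_diff PP AA)+
  then show "P o\<^sub>C\<^sub>L (P + A o\<^sub>C\<^sub>L \<Delta> o\<^sub>C\<^sub>L A*) = P + A o\<^sub>C\<^sub>L \<Delta> o\<^sub>C\<^sub>L A*
      \<and> (P + A o\<^sub>C\<^sub>L \<Delta> o\<^sub>C\<^sub>L A*) o\<^sub>C\<^sub>L P = P + A o\<^sub>C\<^sub>L \<Delta> o\<^sub>C\<^sub>L A*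
      \<and> (P + A o\<^sub>C\<^sub>L \<Delta> o\<^sub>C\<^sub>L A*) o\<^sub>C\<^sub>L (P - A o\<^sub>C\<^sub>L A*) = P
      \<and> (P - A o\<^sub>C\<^sub>L A*) o\<^sub>C\<^sub>L (P + A o\<^sub>C\<^sub>L \<Delta> o\<^sub>C\<^sub>L A*) = P"
    unfolding G_def by (intro conjI)
  fix S
  assume S: "P o\<^sub>C\<^sub>L S = S \<and> S o\<^sub>C\<^sub>L P = S \<and> S o\<^sub>C\<^sub>L (P - A o\<^sub>C\<^sub>L A*) = P \<and> (P - A o\<^sub>C\<^sub>L A*) o\<^sub>C\<^sub>L S = P"
  then have "S = S o\<^sub>C\<^sub>L ((P - A o\<^sub>C\<^sub>L A*) o\<^sub>C\<^sub>L G)"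
    by (simp only: G)
  also have "\<dots> = P o\<^sub>C\<^sub>L G"
    unfolding comp_op_assoc[symmetric, of S] using S by (simp only:)
  finally show "S = P + A o\<^sub>C\<^sub>L \<Delta> o\<^sub>C\<^sub>L A*"
    by (simp only: G) (simp only: G_def)
qed

text \<open>\<open>Qinv = Q + W* \<Delta> W Q\<close>, and the second summand contributes
  \<open>T E W* \<Delta> W Q\<close>, which cancels the correction term in
  \<open>A_shift\<close>.\<close>

lemma Y11_apply:
  "Y11 *\<^sub>V e = embed0 *\<^sub>V \<Theta> 0 *\<^sub>V Q *\<^sub>V e + shift *\<^sub>V (C* *\<^sub>V Q *\<^sub>V e + A *\<^sub>V \<Delta> *\<^sub>V W *\<^sub>V Q *\<^sub>V e)"
proof -
  have "Qinv *\<^sub>V e = Qinv *\<^sub>V Qinv *\<^sub>V Q *\<^sub>V e"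
    by simp
  also have "\<dots> = Q *\<^sub>V e + W* *\<^sub>V \<Delta> *\<^sub>V W *\<^sub>V Q *\<^sub>V e"
    by (rule Qinv_Qinv)
  finally have q: "Qinv *\<^sub>V e = Q *\<^sub>V e + W* *\<^sub>V \<Delta> *\<^sub>V W *\<^sub>V Q *\<^sub>V e" .
  have "Y11 *\<^sub>V e = T *\<^sub>V embed0 *\<^sub>V Q *\<^sub>V e + shift *\<^sub>V A *\<^sub>V \<Delta> *\<^sub>V W *\<^sub>V Q *\<^sub>V e"
    by (simp add: Y11_def q A_shift cblinfun_apply_add)
  also have "\<dots> = embed0 *\<^sub>V \<Theta> 0 *\<^sub>V Q *\<^sub>V e + shift *\<^sub>V (C* *\<^sub>V Q *\<^sub>V e + A *\<^sub>V \<Delta> *\<^sub>V W *\<^sub>V Q *\<^sub>V e)"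
    by (simp add: T_embed0 cblinfun_apply_add)
  finally show ?thesis .
qed

lemma P_C_adj [simp]: "P *\<^sub>V C* *\<^sub>V e = C* *\<^sub>V e"
  using proj_idem[OF H_closed proj_properties(1)[OF H_closed]] by (simp add: C_eq)

lemma coefficients:
  assumes z: "cmod z < 1"
  shows "((\<Theta> 0)*)* o\<^sub>C\<^sub>L Q + z *\<^sub>C (embed0* o\<^sub>C\<^sub>L inverse_op (id_op - z *\<^sub>C shift*) o\<^sub>C\<^sub>L P* o\<^sub>C\<^sub>L
      inverse_op_on H (P - A o\<^sub>C\<^sub>L A*) o\<^sub>C\<^sub>L C* o\<^sub>C\<^sub>L Q) = U11 z"
    and "embed0* o\<^sub>C\<^sub>L inverse_op (id_op - z *\<^sub>C shift*) o\<^sub>C\<^sub>L P* o\<^sub>C\<^sub>L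
      A o\<^sub>C\<^sub>L inverse_op (id_op - A* o\<^sub>C\<^sub>L A) o\<^sub>C\<^sub>L embed0 o\<^sub>C\<^sub>L R = U12 z"
    and "z *\<^sub>C (embed0* o\<^sub>C\<^sub>L inverse_op (id_op - z *\<^sub>C shift*) o\<^sub>C\<^sub>L
      A* o\<^sub>C\<^sub>L inverse_op_on H (P - A o\<^sub>C\<^sub>L A*) o\<^sub>C\<^sub>L C* o\<^sub>C\<^sub>L Q) = U21 z"
    and "embed0* o\<^sub>C\<^sub>L inverse_op (id_op - z *\<^sub>C shift*) o\<^sub>C\<^sub>L
      inverse_op (id_op - A* o\<^sub>C\<^sub>L A) o\<^sub>C\<^sub>L embed0 o\<^sub>C\<^sub>L R = U22 z"
  unfolding inverse_op_on_H \<Omega>_def[symmetric] \<Delta>_def[symmetric] point_eval_def[symmetric]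
proof -
  have WC: "A* *\<^sub>V C* *\<^sub>V e = W *\<^sub>V e" for e
    by (simp add: W_def)
  show "((\<Theta> 0)*)* o\<^sub>C\<^sub>L Q + z *\<^sub>C (point_eval z o\<^sub>C\<^sub>L P* o\<^sub>C\<^sub>L (P + A o\<^sub>C\<^sub>L \<Delta> o\<^sub>C\<^sub>L A*) o\<^sub>C\<^sub>L C* o\<^sub>C\<^sub>L Q) = U11 z"
    by (rule cblinfun_eqI) (simp add: U11_def Y11_apply cblinfun_apply_add scaleC_add_right z point_eval_shift WC)
  show "point_eval z o\<^sub>C\<^sub>L P* o\<^sub>C\<^sub>L A o\<^sub>C\<^sub>L \<Delta> o\<^sub>C\<^sub>L embed0 o\<^sub>C\<^sub>L R = U12 z"
    by (rule cblinfun_eqI) (simp add: U12_def Y12_def)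
  show "point_eval z o\<^sub>C\<^sub>L \<Delta> o\<^sub>C\<^sub>L embed0 o\<^sub>C\<^sub>L R = U22 z"
    by (rule cblinfun_eqI) (simp add: U22_def Y22_def)
  show "z *\<^sub>C (point_eval z o\<^sub>C\<^sub>L A* o\<^sub>C\<^sub>L (P + A o\<^sub>C\<^sub>L \<Delta> o\<^sub>C\<^sub>L A*) o\<^sub>C\<^sub>L C* o\<^sub>C\<^sub>L Q) = U21 z"
  proof (rule cblinfun_eqI)
    fix e
    \<comment> \<open>The theorem's formula produces \<open>W + A* A \<Delta> W\<close> in front of
      \<open>Q e\<close>, which collapses to \<open>\<Delta> W\<close>.\<close>
    have "\<Delta> *\<^sub>V W *\<^sub>V Q *\<^sub>V e = W *\<^sub>V Q *\<^sub>V e + A* *\<^sub>V A *\<^sub>V \<Delta> *\<^sub>V W *\<^sub>V Q *\<^sub>V e"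
      by (rule \<Delta>_eq(1))
    then show "(z *\<^sub>C (point_eval z o\<^sub>C\<^sub>L A* o\<^sub>C\<^sub>L (P + A o\<^sub>C\<^sub>L \<Delta> o\<^sub>C\<^sub>L A*) o\<^sub>C\<^sub>L C* o\<^sub>C\<^sub>L Q)) *\<^sub>V e = U21 z *\<^sub>V e"
      by (simp add: U21_def Y21_def z point_eval_shift WC cblinfun_apply_add[of "A*"])
  qed
qed

end


theorem theorem8p1:
  fixes H :: "'y::chilbert_space ell2 set"
    and A :: "'u::chilbert_space ell2 \<Rightarrow>\<^sub>C\<^sub>L 'y ell2"
    and \<Theta> :: "complex \<Rightarrow> 'e::chilbert_space \<Rightarrow>\<^sub>C\<^sub>L 'y"
    and C :: "'y ell2 \<Rightarrow>\<^sub>C\<^sub>L 'e" and D :: "'y \<Rightarrow>\<^sub>C\<^sub>L 'e"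
    and Q :: "'e \<Rightarrow>\<^sub>C\<^sub>L 'e" and R :: "'u \<Rightarrow>\<^sub>C\<^sub>L 'u"
    and \<Upsilon>11 :: "complex \<Rightarrow> 'e \<Rightarrow>\<^sub>C\<^sub>L 'y" and \<Upsilon>12 :: "complex \<Rightarrow> 'u \<Rightarrow>\<^sub>C\<^sub>L 'y"
    and \<Upsilon>21 :: "complex \<Rightarrow> 'e \<Rightarrow>\<^sub>C\<^sub>L 'u" and \<Upsilon>22 :: "complex \<Rightarrow> 'u \<Rightarrow>\<^sub>C\<^sub>L 'u"
  assumes data: "commutant_lifting_data H A"
    and strict: "norm A < 1"
    and \<Theta>_inner: "inner_function \<Theta>"
    and \<Theta>_range: "orth_complement H = range (cblinfun_apply (toeplitz \<Theta>))"
  defines "C \<equiv> embed0* o\<^sub>C\<^sub>L (toeplitz \<Theta>)* o\<^sub>C\<^sub>L shift o\<^sub>C\<^sub>L proj H"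
    and "D \<equiv> (\<Theta> 0)*"
    and "Q \<equiv> inv_sqrt_op (id_op + C o\<^sub>C\<^sub>L A o\<^sub>C\<^sub>L inverse_op (id_op - A* o\<^sub>C\<^sub>L A) o\<^sub>C\<^sub>L A* o\<^sub>C\<^sub>L C*)"
    and "R \<equiv> inv_sqrt_op (embed0* o\<^sub>C\<^sub>L inverse_op (id_op - A* o\<^sub>C\<^sub>L A) o\<^sub>C\<^sub>L embed0)"
    and "\<Upsilon>11 \<equiv> \<lambda>z. D* o\<^sub>C\<^sub>L Q + z *\<^sub>C (embed0* o\<^sub>C\<^sub>L inverse_op (id_op - z *\<^sub>C shift*) o\<^sub>C\<^sub>L (proj H)* o\<^sub>C\<^sub>L
            inverse_op_on H (proj H - A o\<^sub>C\<^sub>L A*) o\<^sub>C\<^sub>L C* o\<^sub>C\<^sub>L Q)"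
    and "\<Upsilon>12 \<equiv> \<lambda>z. embed0* o\<^sub>C\<^sub>L inverse_op (id_op - z *\<^sub>C shift*) o\<^sub>C\<^sub>L (proj H)* o\<^sub>C\<^sub>L
            A o\<^sub>C\<^sub>L inverse_op (id_op - A* o\<^sub>C\<^sub>L A) o\<^sub>C\<^sub>L embed0 o\<^sub>C\<^sub>L R"
    and "\<Upsilon>21 \<equiv> \<lambda>z. z *\<^sub>C (embed0* o\<^sub>C\<^sub>L inverse_op (id_op - z *\<^sub>C shift*) o\<^sub>C\<^sub>L
            A* o\<^sub>C\<^sub>L inverse_op_on H (proj H - A o\<^sub>C\<^sub>L A*) o\<^sub>C\<^sub>L C* o\<^sub>C\<^sub>L Q)"
    and "\<Upsilon>22 \<equiv> \<lambda>z. embed0* o\<^sub>C\<^sub>L inverse_op (id_op - z *\<^sub>C shift*) o\<^sub>C\<^sub>L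
            inverse_op (id_op - A* o\<^sub>C\<^sub>L A) o\<^sub>C\<^sub>L embed0 o\<^sub>C\<^sub>L R"
  shows "strictly_positive_op Q \<and> strictly_positive_op R \<and>
    analytic_on_disc \<Upsilon>11 \<and> analytic_on_disc \<Upsilon>12 \<and> analytic_on_disc \<Upsilon>21 \<and> analytic_on_disc \<Upsilon>22 \<and>
    (\<forall>X. schur_class X \<longrightarrow> (\<forall>z\<in>ball 0 1. invertible_op (\<Upsilon>21 z o\<^sub>C\<^sub>L X z + \<Upsilon>22 z))) \<and>
    (\<forall>F. commutant_lifting_solution H A F \<longleftrightarrow>
      (\<exists>X. schur_class X \<and>
        (\<forall>z\<in>ball 0 1. F z = (\<Upsilon>11 z o\<^sub>C\<^sub>L X z + \<Upsilon>12 z) o\<^sub>C\<^sub>L inverse_op (\<Upsilon>21 z o\<^sub>C\<^sub>L X z + \<Upsilon>22 z))))"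
proof -
  interpret lifting_problem H A \<Theta> C Q R
  proof
    show "C = embed0* o\<^sub>C\<^sub>L (toeplitz \<Theta>)* o\<^sub>C\<^sub>L shift o\<^sub>C\<^sub>L proj H"
      by (simp only: C_def)
    show "Q = inv_sqrt_op (id_op + C o\<^sub>C\<^sub>L A o\<^sub>C\<^sub>L inverse_op (id_op - A* o\<^sub>C\<^sub>L A) o\<^sub>C\<^sub>L A* o\<^sub>C\<^sub>L C*)"
      by (simp only: Q_def)
    show "R = inv_sqrt_op (embed0* o\<^sub>C\<^sub>L inverse_op (id_op - A* o\<^sub>C\<^sub>L A) o\<^sub>C\<^sub>L embed0)"
      by (simp only: R_def)
  qed (fact data strict \<Theta>_inner \<Theta>_range)+
  \<comment> \<open>The identification is made on the disc only, where the resolvent of the backward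
    shift exists; the remaining claims only look there.\<close>
  have \<Upsilon>: "\<Upsilon>11 z = U11 z" "\<Upsilon>12 z = U12 z" "\<Upsilon>21 z = U21 z" "\<Upsilon>22 z = U22 z" if "cmod z < 1" for z
    unfolding \<Upsilon>11_def \<Upsilon>12_def \<Upsilon>21_def \<Upsilon>22_def D_def by (rule coefficients[OF that])+
  have analytic: "analytic_on_disc \<Upsilon>11" "analytic_on_disc \<Upsilon>12" "analytic_on_disc \<Upsilon>21" "analytic_on_disc \<Upsilon>22"
    by (rule analytic_on_disc_cong[OF analytic_U(1) \<Upsilon>(1)] analytic_on_disc_cong[OF analytic_U(2) \<Upsilon>(2)]
        analytic_on_disc_cong[OF analytic_U(3) \<Upsilon>(3)] analytic_on_disc_cong[OF analytic_U(4) \<Upsilon>(4)]; assumption)+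
  have invertible: "invertible_op (\<Upsilon>21 z o\<^sub>C\<^sub>L X z + \<Upsilon>22 z)" if "schur_class X" "z \<in> ball 0 1" for X z
    using denominator_invertible[of X z] that by (simp add: \<Upsilon>)
  have "commutant_lifting_solution H A F \<longleftrightarrow> (\<exists>X. schur_class X \<and>
      (\<forall>z\<in>ball 0 1. F z = (\<Upsilon>11 z o\<^sub>C\<^sub>L X z + \<Upsilon>12 z) o\<^sub>C\<^sub>L inverse_op (\<Upsilon>21 z o\<^sub>C\<^sub>L X z + \<Upsilon>22 z)))" for F
    unfolding solution_iff Ball_def mem_ball_0 by (simp add: \<Upsilon> cong: imp_cong)
  with Q_pos R_pos analytic invertible show ?thesis
    by blast
qed

end
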